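(* Consider the point-to-point channel $p_{Y|X_2,S}$ with i.i.d. states of PMF $p_S$, in which a state encoder observes the state sequence $S^n$ non-causally and produces $X_1^n\in\mathcal{X}_1^n$, the transmitter observes the state encoder's output in a strictly causal manner (so $X_{2,i}$ is a function of the message and $X_1^{i-1}$), and the decoder knows $S^n$. The capacity of this channel is $$C=\max_{\substack{p_{U|S}\,p_{X_2|U}:\\ I(U;S)\le\log_2|\mathcal{X}_1|}} I(X_2;Y|U,S),$$ where $U$ takes values in a finite alphabet and the information quantities are computed under $p_S\,p_{U|S}\,p_{X_2|U}\,p_{Y|X_2,S}$.
   Context: All alphabets $\mathcal{S},\mathcal{X}_1,\mathcal{X}_2,\mathcal{Y}$ are finite; logarithms are base 2; $[1:2^{nR}]$ denotes the set of integers from $1$ to $2^{nR}$ (with $2^{nR}$ treated as an integer). The states $S_1,\dots,S_n$ are i.i.d. $\sim p_S$; the message $M_2$ is uniform on $[1:2^{nR_2}]$ and independent of $S^n$. The channel is memoryless and without feedback: $Y_i$ is drawn from $p_{Y|X_2,S}(\cdot|x_{2,i},s_i)$. The output $Y$ does not depend on $X_1$. A code of rate $R_2$ and length $n$ consists of: state-encoder functions $x_{1,i}:\mathcal{S}^n\to\mathcal{X}_1$, encoder functions $x_{2,i}:[1:2^{nR_2}]\times\mathcal{X}_1^{i-1}\to\mathcal{X}_2$, for $1\le i\le n$, and a decoder $\hat m_2:\mathcal{Y}^n\times\mathcal{S}^n\to[1:2^{nR_2}]$. A rate is achievable if for every $\epsilon>0$ there is, for some sufficiently large $n$, such a code with $\Pr[\hat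 m_2(Y^n,S^n)\ne M_2]\le\epsilon$. The capacity is the supremum of achievable rates. *)

theory Defs
  imports "HOL-Probability.Probability"
begin

text \<open>
  Alphabets are finite types. A sequence of length \<open>n\<close> is a function on \<open>nat\<close> that is
  \<open>undefined\<close> outside the index set \<open>{1..n}\<close>, i.e. an element of \<open>{1..n} \<rightarrow>\<^sub>E UNIV\<close>;
  this agrees with \<open>Pi_pmf {1..n} undefined\<close> and with \<open>restrict\<close>.
  The channel law is \<open>W x2 s\<close>, the PMF of \<open>Y\<close> given \<open>X2 = x2\<close> and \<open>S = s\<close>.
\<close>

section \<open>Codes, achievable rates and capacity\<close>

text \<open>\<open>[1:2^{nR}]\<close>, read as the integers between \<open>1\<close> and \<open>2^{nR}\<close>.\<close>

definition messages :: "nat \<Rightarrow> real \<Rightarrow> nat set" where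
  "messages n R = {1..nat \<lfloor>2 powr (real n * R)\<rfloor>}"

record ('s, 'x1, 'x2, 'y) code =
  state_enc :: "nat \<Rightarrow> (nat \<Rightarrow> 's) \<Rightarrow> 'x1"
  msg_enc :: "nat \<Rightarrow> nat \<Rightarrow> (nat \<Rightarrow> 'x1) \<Rightarrow> 'x2"
  decoder :: "(nat \<Rightarrow> 'y) \<Rightarrow> (nat \<Rightarrow> 's) \<Rightarrow> nat"

definition is_code :: "nat \<Rightarrow> real \<Rightarrow> ('s, 'x1, 'x2, 'y) code \<Rightarrow> bool" where
  "is_code n R c \<longleftrightarrow>
     (\<forall>y \<in> {1..n} \<rightarrow>\<^sub>E UNIV. \<forall>s \<in> {1..n} \<rightarrow>\<^sub>E UNIV. decoder c y s \<in> messages n R)"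

text \<open>Strict causality: at time \<open>i\<close> only the restriction of \<open>X1\<close> to the times \<open>1..i-1\<close> is passed
  to the encoder.\<close>

definition channel_input :: "('s, 'x1, 'x2, 'y) code \<Rightarrow> nat \<Rightarrow> (nat \<Rightarrow> 's) \<Rightarrow> nat \<Rightarrow> 'x2" where
  "channel_input c m s i = msg_enc c i m (\<lambda>j\<in>{1..<i}. state_enc c j s)"

definition transmission_pmf ::
  "nat \<Rightarrow> real \<Rightarrow> 's pmf \<Rightarrow> ('x2 \<Rightarrow> 's \<Rightarrow> 'y pmf) \<Rightarrow> ('s, 'x1, 'x2, 'y) code \<Rightarrow>
     (nat \<times> (nat \<Rightarrow> 's) \<times> (nat \<Rightarrow> 'y)) pmf" where
  "transmission_pmf n R pS W c =
     bind_pmf (pmf_of_set (messages n R)) (\<lambda>m.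
     bind_pmf (Pi_pmf {1..n} undefined (\<lambda>_. pS)) (\<lambda>s.
     bind_pmf (Pi_pmf {1..n} undefined (\<lambda>i. W (channel_input c m s i) (s i))) (\<lambda>y.
     return_pmf (m, s, y))))"

definition error_prob ::
  "nat \<Rightarrow> real \<Rightarrow> 's pmf \<Rightarrow> ('x2 \<Rightarrow> 's \<Rightarrow> 'y pmf) \<Rightarrow> ('s, 'x1, 'x2, 'y) code \<Rightarrow> real" where
  "error_prob n R pS W c =
     measure_pmf.prob (transmission_pmf n R pS W c) {(m, s, y). decoder c y s \<noteq> m}"

text \<open>The alphabet of the state encoder's output enters only through its type, hence the
  \<open>itself\<close> argument. Arbitrarily large \<open>n\<close> are required since for small \<open>n\<close> the set
  \<open>messages n R\<close> may be a singleton.\<close>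

definition achievable ::
  "'x1::finite itself \<Rightarrow> 's::finite pmf \<Rightarrow> ('x2::finite \<Rightarrow> 's \<Rightarrow> 'y::finite pmf) \<Rightarrow> real \<Rightarrow> bool" where
  "achievable X1 pS W R \<longleftrightarrow>
     0 \<le> R \<and>
     (\<forall>\<epsilon>>0. \<forall>N. \<exists>n\<ge>N. \<exists>c :: ('s, 'x1, 'x2, 'y) code.
        is_code n R c \<and> error_prob n R pS W c \<le> \<epsilon>)"

text \<open>The supremum is taken in \<open>ereal\<close>, so that it is meaningful without knowing beforehand that
  the achievable rates are bounded.\<close>

definition capacity ::
  "'x1::finite itself \<Rightarrow> 's::finite pmf \<Rightarrow> ('x2::finite \<Rightarrow> 's \<Rightarrow> 'y::finite pmf) \<Rightarrow> ereal" where
  "capacity X1 pS W = Sup (ereal ` {R. achievable X1 pS W R})"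

section \<open>Single-letter expression\<close>

definition mutual_info :: "'w pmf \<Rightarrow> ('w \<Rightarrow> 'a) \<Rightarrow> ('w \<Rightarrow> 'b) \<Rightarrow> real" where
  "mutual_info p X Y =
     prob_space.mutual_information (measure_pmf p) 2 (count_space UNIV) (count_space UNIV) X Y"

definition cond_mutual_info ::
  "'w pmf \<Rightarrow> ('w \<Rightarrow> 'a) \<Rightarrow> ('w \<Rightarrow> 'b) \<Rightarrow> ('w \<Rightarrow> 'c) \<Rightarrow> real" where
  "cond_mutual_info p X Y Z =
     prob_space.conditional_mutual_information (measure_pmf p) 2
       (count_space UNIV) (count_space UNIV) (count_space UNIV) X Y Z"

text \<open>The law of \<open>(S, U, X2, Y)\<close>. Every finite alphabet of \<open>U\<close> is, up to relabelling, a finite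
  subset of \<open>nat\<close>.\<close>

definition joint_pmf ::
  "'s pmf \<Rightarrow> ('x2 \<Rightarrow> 's \<Rightarrow> 'y pmf) \<Rightarrow> ('s \<Rightarrow> nat pmf) \<Rightarrow> (nat \<Rightarrow> 'x2 pmf) \<Rightarrow>
     ('s \<times> nat \<times> 'x2 \<times> 'y) pmf" where
  "joint_pmf pS W pU pX =
     bind_pmf pS (\<lambda>s.
     bind_pmf (pU s) (\<lambda>u.
     bind_pmf (pX u) (\<lambda>x.
     bind_pmf (W x s) (\<lambda>y.
     return_pmf (s, u, x, y)))))"

definition feasible ::
  "'x1::finite itself \<Rightarrow> 's pmf \<Rightarrow> ('x2 \<Rightarrow> 's \<Rightarrow> 'y pmf) \<Rightarrow>
     ('s \<Rightarrow> nat pmf) \<Rightarrow> (nat \<Rightarrow> 'x2 pmf) \<Rightarrow> bool" where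
  "feasible X1 pS W pU pX \<longleftrightarrow>
     (\<exists>A. finite A \<and> (\<forall>s. set_pmf (pU s) \<subseteq> A)) \<and>
     mutual_info (joint_pmf pS W pU pX) (\<lambda>(s, u, x, y). u) (\<lambda>(s, u, x, y). s)
       \<le> log 2 (real CARD('x1))"

definition objective ::
  "'s pmf \<Rightarrow> ('x2 \<Rightarrow> 's \<Rightarrow> 'y pmf) \<Rightarrow> ('s \<Rightarrow> nat pmf) \<Rightarrow> (nat \<Rightarrow> 'x2 pmf) \<Rightarrow> real" where
  "objective pS W pU pX =
     cond_mutual_info (joint_pmf pS W pU pX)
       (\<lambda>(s, u, x, y). x) (\<lambda>(s, u, x, y). y) (\<lambda>(s, u, x, y). (u, s))"

end

theory Submission
  imports Defs
begin

text \<open>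
  A test channel splits \<open>p\<^sub>S\<close> into posteriors \<open>\<pi>\<^sub>u\<close>, each paired with an input law \<open>q\<^sub>u\<close>;
  \<open>I(U;S)\<close> and \<open>I(X\<^sub>2;Y|U,S)\<close> are affine in the weights of the splitting. So the admissible pairs
  are a slice of the convex hull of a compact set: the maximum exists without a bound on the
  alphabet of \<open>U\<close>, and time sharing costs nothing.

  Converse: given \<open>S\<^sup>n\<close>, the code is a point-to-point code over a memoryless channel, so comparison
  with the product of the output marginals single-letterizes the rate. With \<open>U\<^sub>i = X\<^sub>1\<^sup>n\<close>, a second
  comparison with a product law gives \<open>\<Sum>\<^sub>i I(U\<^sub>i;S\<^sub>i) \<le> n log |X\<^sub>1|\<close>.

  Achievability: in each block the state encoder describes an auxiliary sequence for the states of
  the next block, which is a lossy source code whose negative distortion is the information gained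
  per letter. The message selects a sequence of Shannon strategies, evaluated at the described
  auxiliary letters, from a greedily built code.
\<close>

section \<open>Finite expectations and channel information\<close>

text \<open>The auxiliary letters of a block must be known before the block starts. The noncausal
  state encoder can look one block ahead, so only the first block is lost, a fraction 1/B of the
  time. No typicality is involved. A description is judged by one number, the sum of
  \<open>channel_info\<close> over the pairs (s_i, u_i), and a channel code needs only that this
  number exceeds the rate: the decoder knows S^n, hence also the auxiliary sequence, and can
  threshold the likelihood ratio of a memoryless, time-varying channel. The message encoder knows u
  but not s, which is why codewords are strategies and why one code must serve all state sequences
  on average. The test channels form no compact set, since U ranges over arbitrary finite subsets of
  \<open>nat\<close>; compactness appears only after each letter u is replaced by its posterior, the
  entropy of this posterior and its gain. The covering step needs I(U;S) strictly below log|X1|, and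
  convexity of the region supplies the gap except when |X1| = 1.\<close>

lemma expectation_bind_pmf_finite:
  fixes h :: "'b \<Rightarrow> real"
  assumes "finite (set_pmf p)" "\<And>x. x \<in> set_pmf p \<Longrightarrow> finite (set_pmf (f x))"
  shows "measure_pmf.expectation (bind_pmf p f) h =
    measure_pmf.expectation p (\<lambda>x. measure_pmf.expectation (f x) h)"
  using assms
  by (simp add: pmf_expectation_bind[where A = "set_pmf p"]
      integral_measure_pmf[where A = "set_pmf p" and M = p])

lemma expectation_cong_pmf:
  fixes f g :: "'a \<Rightarrow> real"
  assumes "\<And>x. x \<in> set_pmf p \<Longrightarrow> f x = g x"
  shows "measure_pmf.expectation p f = measure_pmf.expectation p g"
  using assms by (intro integral_cong_AE) (auto simp: AE_measure_pmf_iff)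

lemma expectation_mono_pmf:
  fixes f g :: "'a \<Rightarrow> real"
  assumes "finite (set_pmf p)" "\<And>x. x \<in> set_pmf p \<Longrightarrow> f x \<le> g x"
  shows "measure_pmf.expectation p f \<le> measure_pmf.expectation p g"
  using assms by (intro integral_mono_AE integrable_measure_pmf_finite) (auto simp: AE_measure_pmf_iff)

lemma expectation_finite_type:
  fixes p :: "'a::finite pmf" and f :: "'a \<Rightarrow> real"
  shows "measure_pmf.expectation p f = (\<Sum>a\<in>UNIV. pmf p a * f a)"
  by (subst integral_measure_pmf[where A = UNIV]) auto

lemma finite_set_Pi_pmf:
  assumes "finite I" "\<And>i. i \<in> I \<Longrightarrow> finite (set_pmf (P i))"
  shows "finite (set_pmf (Pi_pmf I d P))"
  using assms by (auto simp: set_Pi_pmf)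

lemma log2_le_minus_one: "t > 0 \<Longrightarrow> log 2 t \<le> (t - 1) / ln 2"
  using ln_le_minus_one[of t] by (simp add: log_def divide_right_mono)

text \<open>The tangent line of the logarithm is taken at \<open>c\<close> instead of at the mean,
  so an upper bound on the mean suffices. With \<open>f\<close> built from likelihood ratios,
  positive on the support, this gives the nonnegativity of \<open>channel_info\<close> and both
  inequalities of the converse.\<close>

lemma log2_jensen:
  fixes f :: "'a \<Rightarrow> real"
  assumes fin: "finite (set_pmf p)" and pos: "\<And>a. a \<in> set_pmf p \<Longrightarrow> f a > 0"
    and le: "measure_pmf.expectation p f \<le> c"
  shows "measure_pmf.expectation p (\<lambda>a. log 2 (f a)) \<le> log 2 c"
proof -
  have int: "integrable (measure_pmf p) g" for g :: "'a \<Rightarrow> real"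
    using fin by (rule integrable_measure_pmf_finite)
  have "measure_pmf.expectation p f > 0"
  proof -
    obtain a where a: "a \<in> set_pmf p" using set_pmf_not_empty by fast
    have "0 < pmf p a * f a" using a pos by (simp add: pmf_positive)
    also have "\<dots> \<le> (\<Sum>a\<in>set_pmf p. pmf p a * f a)"
      using fin a pos by (intro member_le_sum) (auto simp: less_imp_le)
    also have "\<dots> = measure_pmf.expectation p f"
      using fin by (subst integral_measure_pmf[where A = "set_pmf p"]) auto
    finally show ?thesis .
  qed
  with le have c: "c > 0" by linarith
  have "measure_pmf.expectation p (\<lambda>a. log 2 (f a)) \<le>
      measure_pmf.expectation p (\<lambda>a. log 2 c + (f a / c - 1) / ln 2)"
  proof (rule expectation_mono_pmf[OF fin])
    fix a assume a: "a \<in> set_pmf p"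
    have "log 2 (f a) - log 2 c = log 2 (f a / c)"
      using pos[OF a] c by (simp add: log_divide)
    also have "\<dots> \<le> (f a / c - 1) / ln 2"
      using pos[OF a] c by (intro log2_le_minus_one) auto
    finally show "log 2 (f a) \<le> log 2 c + (f a / c - 1) / ln 2" by simp
  qed
  also have "\<dots> = log 2 c + (measure_pmf.expectation p f / c - 1) / ln 2"
    by (subst Bochner_Integration.integral_add[OF int int]) (simp add: int)
  also have "\<dots> \<le> log 2 c"
    using le c by (simp add: divide_le_0_iff)
  finally show ?thesis .
qed

section \<open>Entropy and the information of one channel\<close>

definition eta :: "real \<Rightarrow> real" where
  "eta t = - t * log 2 t"

definition shannon :: "'a::finite pmf \<Rightarrow> real" where
  "shannon p = (\<Sum>a\<in>UNIV. eta (pmf p a))"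

text \<open>The mutual information between an input of law \<open>q\<close> and the output of
  \<open>V\<close>, in the form H(Y) - H(Y|X), whose continuity in \<open>q\<close> can be read off.
  The equivalent mean of an information density is \<open>channel_info_eq\<close>; it serves for
  single-letterization and concentration.\<close>

definition channel_info :: "('x::finite \<Rightarrow> 'y::finite pmf) \<Rightarrow> 'x pmf \<Rightarrow> real" where
  "channel_info V q = shannon (bind_pmf q V) - (\<Sum>x\<in>UNIV. pmf q x * shannon (V x))"

lemma shannon_eq_expectation: "shannon p = measure_pmf.expectation p (\<lambda>a. - log 2 (pmf p a))"
  by (simp add: shannon_def eta_def expectation_finite_type sum_negf)

lemma channel_info_eq:
  "channel_info V q = measure_pmf.expectation q (\<lambda>x. measure_pmf.expectation (V x)
     (\<lambda>y. log 2 (pmf (V x) y / pmf (bind_pmf q V) y)))"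
proof -
  let ?r = "bind_pmf q V"
  have "measure_pmf.expectation q (\<lambda>x. measure_pmf.expectation (V x) (\<lambda>y. log 2 (pmf (V x) y / pmf ?r y)))
     = measure_pmf.expectation q (\<lambda>x. measure_pmf.expectation (V x) (\<lambda>y. - log 2 (pmf ?r y)) - shannon (V x))"
  proof (rule expectation_cong_pmf)
    fix x assume x: "x \<in> set_pmf q"
    have "measure_pmf.expectation (V x) (\<lambda>y. log 2 (pmf (V x) y / pmf ?r y)) =
      measure_pmf.expectation (V x) (\<lambda>y. - log 2 (pmf ?r y) - (- log 2 (pmf (V x) y)))"
    proof (rule expectation_cong_pmf)
      fix y assume "y \<in> set_pmf (V x)"
      then have "pmf (V x) y > 0" "pmf ?r y > 0"
        using x by (auto simp: pmf_positive_iff)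
      then show "log 2 (pmf (V x) y / pmf ?r y) = - log 2 (pmf ?r y) - (- log 2 (pmf (V x) y))"
        by (simp add: log_divide)
    qed
    then show "measure_pmf.expectation (V x) (\<lambda>y. log 2 (pmf (V x) y / pmf ?r y)) =
      measure_pmf.expectation (V x) (\<lambda>y. - log 2 (pmf ?r y)) - shannon (V x)"
      by (simp add: shannon_eq_expectation integrable_measure_pmf_finite)
  qed
  also have "\<dots> = measure_pmf.expectation ?r (\<lambda>y. - log 2 (pmf ?r y)) - (\<Sum>x\<in>UNIV. pmf q x * shannon (V x))"
    by (subst Bochner_Integration.integral_diff)
       (auto simp: expectation_bind_pmf_finite integrable_measure_pmf_finite expectation_finite_type[of q])
  finally show ?thesis
    by (simp add: channel_info_def shannon_eq_expectation[of ?r])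
qed

text \<open>Gibbs' inequality: the inverse likelihood ratio has mean at most 1 under the joint law,
  since the mass of \<open>?r\<close> outside the support of \<open>V x\<close> is lost.\<close>

lemma channel_info_nonneg: "channel_info V q \<ge> 0"
proof -
  let ?J = "bind_pmf q (\<lambda>x. map_pmf (Pair x) (V x))" and ?r = "bind_pmf q V"
  let ?f = "\<lambda>(x, y). pmf ?r y / pmf (V x) y"
  have J: "measure_pmf.expectation ?J h = measure_pmf.expectation q (\<lambda>x. measure_pmf.expectation (V x) (\<lambda>y. h (x, y)))"
    for h :: "_ \<Rightarrow> real"
    by (simp add: expectation_bind_pmf_finite)
  have "measure_pmf.expectation ?J (\<lambda>z. log 2 (?f z)) \<le> log 2 1"
  proof (rule log2_jensen)
    show "measure_pmf.expectation ?J ?f \<le> 1"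
    proof -
      have "measure_pmf.expectation ?J ?f \<le> measure_pmf.expectation q (\<lambda>x. 1)"
        unfolding J
      proof (rule expectation_mono_pmf, simp)
        fix x
        have "measure_pmf.expectation (V x) (\<lambda>y. ?f (x, y)) \<le> (\<Sum>y\<in>UNIV. pmf ?r y)"
          unfolding expectation_finite_type by (intro sum_mono) auto
        then show "measure_pmf.expectation (V x) (\<lambda>y. ?f (x, y)) \<le> 1"
          by (simp add: sum_pmf_eq_1)
      qed
      then show ?thesis by simp
    qed
  qed (auto simp: pmf_positive_iff intro!: divide_pos_pos)
  also have "measure_pmf.expectation ?J (\<lambda>z. log 2 (?f z)) = - channel_info V q"
  proof -
    have "log 2 (b / a) = - log 2 (a / b)" for a b :: real
      by (simp add: log_divide)
    from this[of "pmf ?r _"] show ?thesis unfolding J channel_info_eq by simp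
  qed
  finally show ?thesis by simp
qed

text \<open>Countability makes the product of the counting measures a counting measure. Point masses
  are then densities, and the general integral formula becomes the mean of a log ratio.\<close>

lemma mutual_info_eq:
  fixes X :: "'w \<Rightarrow> 'a::countable" and Y :: "'w \<Rightarrow> 'b::countable"
  shows "mutual_info p X Y = measure_pmf.expectation p (\<lambda>w. log 2
    (pmf (map_pmf (\<lambda>w. (X w, Y w)) p) (X w, Y w) / (pmf (map_pmf X p) (X w) * pmf (map_pmf Y p) (Y w))))"
proof -
  interpret information_space "measure_pmf p" 2
    by unfold_locales simp
  have dist: "distributed (measure_pmf p) (count_space UNIV) Z (\<lambda>z. ennreal (pmf (map_pmf Z p) z))"
    for Z :: "'w \<Rightarrow> 'z"
    unfolding distributed_def
    by (simp add: map_pmf_rep_eq[symmetric] measure_pmf_eq_density[symmetric])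
  have pair: "count_space UNIV \<Otimes>\<^sub>M count_space UNIV = (count_space UNIV :: ('a \<times> 'b) measure)"
    by (simp add: pair_measure_countable)
  have "mutual_info p X Y = (\<integral>z. pmf (map_pmf (\<lambda>w. (X w, Y w)) p) z *
     log 2 (pmf (map_pmf (\<lambda>w. (X w, Y w)) p) z / (pmf (map_pmf X p) (fst z) * pmf (map_pmf Y p) (snd z)))
     \<partial>(count_space UNIV \<Otimes>\<^sub>M count_space UNIV))"
    unfolding mutual_info_def
    by (rule mutual_information_distr)
       (auto simp: pair dist sigma_finite_measure_count_space_countable)
  also have "\<dots> = measure_pmf.expectation (map_pmf (\<lambda>w. (X w, Y w)) p) (\<lambda>z.
     log 2 (pmf (map_pmf (\<lambda>w. (X w, Y w)) p) z / (pmf (map_pmf X p) (fst z) * pmf (map_pmf Y p) (snd z))))"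
    unfolding pair measure_pmf_eq_density by (subst integral_density) auto
  finally show ?thesis by simp
qed

section \<open>The single-letter expression\<close>

lemma pmf_bind_map_Pair: "pmf (bind_pmf p (\<lambda>a. map_pmf (Pair a) (f a))) (a, b) = pmf p a * pmf (f a) b"
proof -
  have "pmf (map_pmf (Pair a') (f a')) (a, b) = indicator {a} a' * pmf (f a) b" for a'
  proof (cases "a' = a")
    case True
    then show ?thesis by (simp add: pmf_map_inj' inj_on_def)
  next
    case False
    then have "(a, b) \<notin> set_pmf (map_pmf (Pair a') (f a'))" by auto
    with False show ?thesis by (simp add: pmf_eq_0_set_pmf)
  qed
  then show ?thesis by (simp add: pmf_bind measure_pmf_single)
qed

text \<open>I(U;S) as a mean information density. Together with \<open>test_gain\<close>, which is
  I(X2;Y|U,S), it frees the argument from the joint law of all four variables; the identifications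
  are \<open>mutual_info_joint\<close> and \<open>objective_eq\<close>.\<close>

definition test_info :: "'s::finite pmf \<Rightarrow> ('s \<Rightarrow> nat pmf) \<Rightarrow> real" where
  "test_info pS pU = measure_pmf.expectation pS (\<lambda>s. measure_pmf.expectation (pU s)
     (\<lambda>u. log 2 (pmf (pU s) u / pmf (bind_pmf pS pU) u)))"

definition test_gain ::
  "'s::finite pmf \<Rightarrow> ('x2::finite \<Rightarrow> 's \<Rightarrow> 'y::finite pmf) \<Rightarrow> ('s \<Rightarrow> nat pmf) \<Rightarrow> (nat \<Rightarrow> 'x2 pmf) \<Rightarrow> real" where
  "test_gain pS W pU pX = measure_pmf.expectation pS (\<lambda>s. measure_pmf.expectation (pU s)
     (\<lambda>u. channel_info (\<lambda>x. W x s) (pX u)))"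

lemma joint_pmf_altdef:
  "joint_pmf pS W pU pX =
    bind_pmf pS (\<lambda>s. map_pmf (Pair s) (bind_pmf (pU s) (\<lambda>u. map_pmf (Pair u)
      (bind_pmf (pX u) (\<lambda>x. map_pmf (Pair x) (W x s))))))"
  by (simp add: joint_pmf_def map_pmf_def bind_assoc_pmf bind_return_pmf)

context
  fixes pS :: "'s::finite pmf" and W :: "'x2::finite \<Rightarrow> 's \<Rightarrow> 'y::finite pmf"
    and pU :: "'s \<Rightarrow> nat pmf" and pX :: "nat \<Rightarrow> 'x2 pmf"
  assumes fin: "\<And>s. finite (set_pmf (pU s))"
begin

lemma expectation_joint_pmf:
  fixes h :: "'s \<times> nat \<times> 'x2 \<times> 'y \<Rightarrow> real"
  shows "measure_pmf.expectation (joint_pmf pS W pU pX) h =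
    measure_pmf.expectation pS (\<lambda>s. measure_pmf.expectation (pU s) (\<lambda>u.
      measure_pmf.expectation (pX u) (\<lambda>x. measure_pmf.expectation (W x s) (\<lambda>y. h (s, u, x, y)))))"
  unfolding joint_pmf_altdef by (simp add: expectation_bind_pmf_finite fin)

lemma set_joint_pmf:
  "(s, u, x, y) \<in> set_pmf (joint_pmf pS W pU pX) \<longleftrightarrow>
    pmf pS s > 0 \<and> pmf (pU s) u > 0 \<and> pmf (pX u) x > 0 \<and> pmf (W x s) y > 0"
  unfolding joint_pmf_def by (auto simp: pmf_positive_iff)

lemma pmf_joint_marginals:
  shows "pmf (map_pmf (\<lambda>(s, u, x, y). (u, s)) (joint_pmf pS W pU pX)) (u, s) = pmf pS s * pmf (pU s) u"
    and "pmf (map_pmf (\<lambda>(s, u, x, y). s) (joint_pmf pS W pU pX)) s = pmf pS s"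
    and "pmf (map_pmf (\<lambda>(s, u, x, y). u) (joint_pmf pS W pU pX)) u = pmf (bind_pmf pS pU) u"
    and "pmf (map_pmf (\<lambda>(s, u, x, y). (x, u, s)) (joint_pmf pS W pU pX)) (x, u, s) =
      pmf pS s * pmf (pU s) u * pmf (pX u) x"
    and "pmf (map_pmf (\<lambda>(s, u, x, y). (y, u, s)) (joint_pmf pS W pU pX)) (y, u, s) =
      pmf pS s * pmf (pU s) u * pmf (bind_pmf (pX u) (\<lambda>x. W x s)) y"
    and "pmf (map_pmf (\<lambda>(s, u, x, y). (x, y, u, s)) (joint_pmf pS W pU pX)) (x, y, u, s) =
      pmf pS s * pmf (pU s) u * pmf (pX u) x * pmf (W x s) y"
proof -
  let ?J = "joint_pmf pS W pU pX"
  \<comment> \<open>When several variables are kept, the law is a nested pair law up to a reordering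
    of coordinates; the reordering is injective, so \<open>pmf_bind_map_Pair\<close> gives the
    product.\<close>
  have "map_pmf (\<lambda>(s, u, x, y). (u, s)) ?J = map_pmf (\<lambda>(s, u). (u, s))
      (bind_pmf pS (\<lambda>s. map_pmf (Pair s) (pU s)))"
    by (simp add: joint_pmf_def map_pmf_def bind_assoc_pmf bind_return_pmf)
  also have "pmf \<dots> ((\<lambda>(s, u). (u, s)) (s, u)) = pmf pS s * pmf (pU s) u"
    by (subst pmf_map_inj') (auto simp: inj_def pmf_bind_map_Pair)
  finally show "pmf (map_pmf (\<lambda>(s, u, x, y). (u, s)) ?J) (u, s) = pmf pS s * pmf (pU s) u"
    by simp
  have "map_pmf (\<lambda>(s, u, x, y). s) ?J = pS"
    by (simp add: joint_pmf_def map_pmf_def bind_assoc_pmf bind_return_pmf bind_return_pmf')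
  then show "pmf (map_pmf (\<lambda>(s, u, x, y). s) ?J) s = pmf pS s" by simp
  have "map_pmf (\<lambda>(s, u, x, y). u) ?J = bind_pmf pS pU"
    by (simp add: joint_pmf_def map_pmf_def bind_assoc_pmf bind_return_pmf bind_return_pmf')
  then show "pmf (map_pmf (\<lambda>(s, u, x, y). u) ?J) u = pmf (bind_pmf pS pU) u" by simp
  have "map_pmf (\<lambda>(s, u, x, y). (x, u, s)) ?J = map_pmf (\<lambda>(s, u, x). (x, u, s))
      (bind_pmf pS (\<lambda>s. map_pmf (Pair s) (bind_pmf (pU s) (\<lambda>u. map_pmf (Pair u) (pX u)))))"
    by (simp add: joint_pmf_def map_pmf_def bind_assoc_pmf bind_return_pmf)
  also have "pmf \<dots> ((\<lambda>(s, u, x). (x, u, s)) (s, u, x)) = pmf pS s * pmf (pU s) u * pmf (pX u) x"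
    by (subst pmf_map_inj') (auto simp: inj_def pmf_bind_map_Pair)
  finally show "pmf (map_pmf (\<lambda>(s, u, x, y). (x, u, s)) ?J) (x, u, s) =
      pmf pS s * pmf (pU s) u * pmf (pX u) x"
    by simp
  have "map_pmf (\<lambda>(s, u, x, y). (y, u, s)) ?J = map_pmf (\<lambda>(s, u, y). (y, u, s))
      (bind_pmf pS (\<lambda>s. map_pmf (Pair s) (bind_pmf (pU s) (\<lambda>u. map_pmf (Pair u)
        (bind_pmf (pX u) (\<lambda>x. W x s))))))"
    by (simp add: joint_pmf_def map_pmf_def bind_assoc_pmf bind_return_pmf)
  also have "pmf \<dots> ((\<lambda>(s, u, y). (y, u, s)) (s, u, y)) =
      pmf pS s * pmf (pU s) u * pmf (bind_pmf (pX u) (\<lambda>x. W x s)) y"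
    by (subst pmf_map_inj') (auto simp: inj_def pmf_bind_map_Pair)
  finally show "pmf (map_pmf (\<lambda>(s, u, x, y). (y, u, s)) ?J) (y, u, s) =
      pmf pS s * pmf (pU s) u * pmf (bind_pmf (pX u) (\<lambda>x. W x s)) y"
    by simp
  have "pmf (map_pmf (\<lambda>(s, u, x, y). (x, y, u, s)) ?J) ((\<lambda>(s, u, x, y). (x, y, u, s)) (s, u, x, y)) =
      pmf pS s * pmf (pU s) u * pmf (pX u) x * pmf (W x s) y"
    by (subst pmf_map_inj') (auto simp: inj_def pmf_bind_map_Pair joint_pmf_altdef)
  then show "pmf (map_pmf (\<lambda>(s, u, x, y). (x, y, u, s)) ?J) (x, y, u, s) =
      pmf pS s * pmf (pU s) u * pmf (pX u) x * pmf (W x s) y"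
    by simp
qed

lemma mutual_info_joint:
  "mutual_info (joint_pmf pS W pU pX) (\<lambda>(s, u, x, y). u) (\<lambda>(s, u, x, y). s) = test_info pS pU"
proof -
  let ?J = "joint_pmf pS W pU pX"
  have "mutual_info ?J (\<lambda>(s, u, x, y). u) (\<lambda>(s, u, x, y). s) =
    measure_pmf.expectation ?J (\<lambda>(s, u, x, y). log 2 (pmf (pU s) u / pmf (bind_pmf pS pU) u))"
    unfolding mutual_info_eq
  proof (rule expectation_cong_pmf, safe)
    fix s u x y assume "(s, u, x, y) \<in> set_pmf ?J"
    then have "pmf pS s > 0" by (simp add: set_joint_pmf)
    then show "log 2
        (pmf (map_pmf (\<lambda>w. ((case w of (s, u, x, y) \<Rightarrow> u), (case w of (s, u, x, y) \<Rightarrow> s))) ?J) (u, s) /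
         (pmf (map_pmf (\<lambda>(s, u, x, y). u) ?J) u * pmf (map_pmf (\<lambda>(s, u, x, y). s) ?J) s)) =
       log 2 (pmf (pU s) u / pmf (bind_pmf pS pU) u)"
      using pmf_joint_marginals(1)[of u s] pmf_joint_marginals(2)[of s] pmf_joint_marginals(3)[of u]
      by (simp add: case_prod_unfold)
  qed
  then show ?thesis by (simp add: expectation_joint_pmf test_info_def)
qed

text \<open>Conditional mutual information unfolds to I(X2;Y,U,S) - I(X2;U,S). Under a single
  expectation the law of X2 cancels between the two ratios, so this marginal never has to be
  computed.\<close>

lemma objective_eq: "objective pS W pU pX = test_gain pS W pU pX"
proof -
  let ?J = "joint_pmf pS W pU pX"
  let ?X = "\<lambda>(s :: 's, u :: nat, x :: 'x2, y :: 'y). x"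
  let ?Y = "\<lambda>(s :: 's, u :: nat, x :: 'x2, y :: 'y). y"
  let ?Z = "\<lambda>(s :: 's, u :: nat, x :: 'x2, y :: 'y). (u, s)"
  have fJ: "finite (set_pmf ?J)" by (simp add: joint_pmf_def fin)
  have pair: "count_space UNIV \<Otimes>\<^sub>M count_space UNIV = (count_space UNIV :: ('y \<times> nat \<times> 's) measure)"
    by (simp add: pair_measure_countable)
  have "objective pS W pU pX = mutual_info ?J ?X (\<lambda>w. (?Y w, ?Z w)) - mutual_info ?J ?X ?Z"
    unfolding objective_def cond_mutual_info_def prob_space.conditional_mutual_information_def[OF measure_pmf.prob_space_axioms] mutual_info_def pair ..
  also have "\<dots> = measure_pmf.expectation ?J (\<lambda>w.
      log 2 (pmf (map_pmf (\<lambda>w. (?X w, (?Y w, ?Z w))) ?J) (?X w, (?Y w, ?Z w)) /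
        (pmf (map_pmf ?X ?J) (?X w) * pmf (map_pmf (\<lambda>w. (?Y w, ?Z w)) ?J) (?Y w, ?Z w))) -
      log 2 (pmf (map_pmf (\<lambda>w. (?X w, ?Z w)) ?J) (?X w, ?Z w) /
        (pmf (map_pmf ?X ?J) (?X w) * pmf (map_pmf ?Z ?J) (?Z w))))"
    unfolding mutual_info_eq
    by (rule Bochner_Integration.integral_diff[symmetric]; rule integrable_measure_pmf_finite; rule fJ)
  also have "\<dots> = measure_pmf.expectation ?J
      (\<lambda>(s, u, x, y). log 2 (pmf (W x s) y / pmf (bind_pmf (pX u) (\<lambda>x. W x s)) y))"
  proof (rule expectation_cong_pmf)
    fix w assume w0: "w \<in> set_pmf ?J"
    obtain s u x y where weq: "w = (s, u, x, y)" by (cases w)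
    with w0 have w: "(s, u, x, y) \<in> set_pmf ?J" by simp
    let ?r = "pmf (bind_pmf (pX u) (\<lambda>x. W x s)) y"
    let ?px = "pmf (map_pmf ?X ?J) x"
    have pos: "pmf pS s > 0" "pmf (pU s) u > 0" "pmf (pX u) x > 0" "pmf (W x s) y > 0"
      using w by (auto simp: set_joint_pmf)
    then have r: "?r > 0" by (auto simp: pmf_positive_iff)
    have px: "?px > 0" using w by (force simp: pmf_positive_iff)
    have e: "(\<lambda>w. (?X w, (?Y w, ?Z w))) = (\<lambda>(s, u, x, y). (x, y, u, s))"
       "(\<lambda>w. (?Y w, ?Z w)) = (\<lambda>(s, u, x, y). (y, u, s))"
       "(\<lambda>w. (?X w, ?Z w)) = (\<lambda>(s, u, x, y). (x, u, s))"
      by auto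
    let ?c = "pmf pS s * pmf (pU s) u"
    have "log 2 (?c * pmf (pX u) x * pmf (W x s) y / (?px * (?c * ?r))) -
       log 2 (?c * pmf (pX u) x / (?px * ?c)) =
       log 2 ((?c * pmf (pX u) x * pmf (W x s) y / (?px * (?c * ?r))) / (?c * pmf (pX u) x / (?px * ?c)))"
      using pos r px by (intro log_divide_pos[symmetric] divide_pos_pos mult_pos_pos) auto
    also have "(?c * pmf (pX u) x * pmf (W x s) y / (?px * (?c * ?r))) / (?c * pmf (pX u) x / (?px * ?c))
       = pmf (W x s) y / ?r"
      using pos r px by (simp add: field_simps)
    finally show "log 2 (pmf (map_pmf (\<lambda>w. (?X w, (?Y w, ?Z w))) ?J) (?X w, (?Y w, ?Z w)) /
        (pmf (map_pmf ?X ?J) (?X w) * pmf (map_pmf (\<lambda>w. (?Y w, ?Z w)) ?J) (?Y w, ?Z w))) -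
      log 2 (pmf (map_pmf (\<lambda>w. (?X w, ?Z w)) ?J) (?X w, ?Z w) /
        (pmf (map_pmf ?X ?J) (?X w) * pmf (map_pmf ?Z ?J) (?Z w))) =
      (case w of (s, u, x, y) \<Rightarrow> log 2 (pmf (W x s) y / pmf (bind_pmf (pX u) (\<lambda>x. W x s)) y))"
      by (simp only: weq e prod.case pmf_joint_marginals)
  qed
  also have "\<dots> = test_gain pS W pU pX"
    by (simp add: expectation_joint_pmf test_gain_def channel_info_eq)
  finally show ?thesis .
qed

end

section \<open>The information region\<close>

definition pmf_vec :: "'a::finite pmf \<Rightarrow> real ^ 'a" where
  "pmf_vec p = (\<chi> a. pmf p a)"

text \<open>The contribution of one letter of U. With weights P(U=u) the coordinates average to
  \<open>pS\<close>, H(S|U) and I(X2;Y|U,S), so the hull in \<open>info_region\<close> collects the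
  test channels of all state laws at once.\<close>

definition info_point ::
  "('x2::finite \<Rightarrow> 's::finite \<Rightarrow> 'y::finite pmf) \<Rightarrow> 's pmf \<Rightarrow> 'x2 pmf \<Rightarrow> (real ^ 's) \<times> real \<times> real" where
  "info_point W \<pi> q =
    (pmf_vec \<pi>, shannon \<pi>, \<Sum>s\<in>UNIV. pmf \<pi> s * channel_info (\<lambda>x. W x s) q)"

definition info_region ::
  "('x2::finite \<Rightarrow> 's::finite \<Rightarrow> 'y::finite pmf) \<Rightarrow> ((real ^ 's) \<times> real \<times> real) set" where
  "info_region W = convex hull (\<Union>\<pi> q. {info_point W \<pi> q})"

section \<open>Compactness of the region\<close>

lemma pmf_exists:
  fixes f :: "'a \<Rightarrow> real"
  assumes "finite A" "\<And>a. f a \<ge> 0" "\<And>a. a \<notin> A \<Longrightarrow> f a = 0" "sum f A = 1"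
  shows "\<exists>p. \<forall>a. pmf p a = f a"
proof (intro exI allI)
  fix a show "pmf (embed_pmf f) a = f a"
  proof (rule pmf_embed_pmf)
    have "(\<integral>\<^sup>+ x. ennreal (f x) \<partial>count_space UNIV) = (\<Sum>x\<in>A. ennreal (f x))"
      by (rule nn_integral_count_space'[OF assms(1)]) (auto simp: assms(3))
    then show "(\<integral>\<^sup>+ x. ennreal (f x) \<partial>count_space UNIV) = 1"
      using assms by (simp add: sum_ennreal)
  qed (rule assms)
qed

lemma range_pmf_vec: "range (pmf_vec :: 'a::finite pmf \<Rightarrow> _) = {v. (\<forall>a. 0 \<le> v $ a) \<and> (\<Sum>a\<in>UNIV. v $ a) = 1}"
proof (intro equalityI subsetI)
  fix v :: "real ^ 'a" assume v: "v \<in> {v. (\<forall>a. 0 \<le> v $ a) \<and> (\<Sum>a\<in>UNIV. v $ a) = 1}"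
  obtain p where "\<forall>a. pmf p a = v $ a"
    using pmf_exists[of UNIV "\<lambda>a. v $ a"] v by auto
  then have "v = pmf_vec p" by (simp add: pmf_vec_def vec_eq_iff)
  then show "v \<in> range pmf_vec" by simp
qed (auto simp: pmf_vec_def sum_pmf_eq_1)

lemma compact_range_pmf_vec: "compact (range (pmf_vec :: 'a::finite pmf \<Rightarrow> _))"
proof -
  have "closed {v :: real ^ 'a. (\<forall>a. 0 \<le> v $ a) \<and> (\<Sum>a\<in>UNIV. v $ a) = 1}"
    by (intro closed_Collect_conj closed_Collect_all closed_Collect_le closed_Collect_eq continuous_intros)
  moreover have "bounded {v :: real ^ 'a. (\<forall>a. 0 \<le> v $ a) \<and> (\<Sum>a\<in>UNIV. v $ a) = 1}"
  proof (rule boundedI)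
    fix v :: "real ^ 'a" assume "v \<in> {v. (\<forall>a. 0 \<le> v $ a) \<and> (\<Sum>a\<in>UNIV. v $ a) = 1}"
    then have "(\<Sum>a\<in>UNIV. \<bar>v $ a\<bar>) = 1" by simp
    then show "norm v \<le> 1" using norm_le_l1_cart[of v] by simp
  qed
  ultimately show ?thesis by (simp add: range_pmf_vec compact_eq_bounded_closed)
qed

text \<open>Only the point 0 is delicate: t log t tends to 0 there, and the factor t makes
  \<open>eta 0\<close> equal to 0.\<close>

lemma continuous_on_eta: "continuous_on {0..} eta"
proof -
  have "isCont eta t" if "t > 0" for t
    unfolding eta_def using that by (intro continuous_intros) auto
  moreover have "(eta \<longlongrightarrow> eta 0) (at 0 within {0..})"
  proof -
    have "((\<lambda>t::real. - t * log 2 t) \<longlongrightarrow> 0) (at_right 0)" by real_asymp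
    moreover have "at 0 within {0..} = at_right (0::real)"
      by (rule at_within_nhd[where S = UNIV]) auto
    ultimately show ?thesis unfolding eta_def by simp
  qed
  ultimately have "(eta \<longlongrightarrow> eta t) (at t within {0..})" if "t \<in> {0..}" for t
    using that by (cases "t = 0") (auto simp: isCont_def intro: tendsto_within_subset[where S = UNIV])
  then show ?thesis by (simp add: continuous_on_def)
qed

lemma continuous_on_eta_comp:
  assumes "continuous_on S f" "\<And>x. x \<in> S \<Longrightarrow> f x \<ge> 0"
  shows "continuous_on S (\<lambda>x. eta (f x))"
  using continuous_on_compose2[OF continuous_on_eta assms(1)] assms(2) by auto

text \<open>\<open>F\<close> is \<open>info_point\<close> in coordinates, where continuity can be
  stated. Its image of a product of simplices is compact, and in finite dimension so is the hull of
  this image.\<close>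

lemma compact_info_region: "compact (info_region W)"
  for W :: "'x2::finite \<Rightarrow> 's::finite \<Rightarrow> 'y::finite pmf"
proof -
  define F where "F = (\<lambda>(v :: real ^ 's, w :: real ^ 'x2). (v, \<Sum>s\<in>UNIV. eta (v $ s),
     \<Sum>s\<in>UNIV. v $ s * ((\<Sum>y\<in>UNIV. eta (\<Sum>x\<in>UNIV. w $ x * pmf (W x s) y)) -
       (\<Sum>x\<in>UNIV. w $ x * shannon (W x s)))))"
  let ?D = "range (pmf_vec :: 's pmf \<Rightarrow> _) \<times> range (pmf_vec :: 'x2 pmf \<Rightarrow> _)"
  have "continuous_on ?D F"
    unfolding F_def case_prod_unfold
    by (intro continuous_intros continuous_on_eta_comp)
       (auto simp: pmf_vec_def intro!: sum_nonneg)
  then have "compact (F ` ?D)"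
    by (intro compact_continuous_image compact_Times compact_range_pmf_vec)
  moreover have "F (pmf_vec \<pi>, pmf_vec q) = info_point W \<pi> q" for \<pi> q
    by (simp add: F_def info_point_def pmf_vec_def shannon_def channel_info_def pmf_bind expectation_finite_type)
  then have "F ` ?D = (\<Union>\<pi> q. {info_point W \<pi> q})" by (auto simp: image_iff) blast+
  ultimately show ?thesis
    unfolding info_region_def by (intro compact_convex_hull) simp
qed

section \<open>Test channels as convex combinations\<close>

lemma info_region_combination:
  assumes "finite A" "\<And>a. a \<in> A \<Longrightarrow> w a \<ge> 0" "sum w A = 1"
  shows "(\<Sum>a\<in>A. w a *\<^sub>R info_point W (\<pi> a) (q a)) \<in> info_region W"
  unfolding info_region_def using assms
  by (intro convex_sum) (auto intro!: hull_inc)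

text \<open>\<open>bayes\<close> factors the joint law of (S, U) in both ways, which forces
  \<open>w\<close> to be the marginal of U. The density log p(u|s)/w(u) then equals the log ratio of
  posterior and prior, and I(U;S) = H(S) - H(S|U) becomes affine in the weights.\<close>

lemma test_channel_combination:
  fixes W :: "'x2::finite \<Rightarrow> 's::finite \<Rightarrow> 'y::finite pmf"
  assumes A: "finite A" "\<And>s. set_pmf (pU s) \<subseteq> A"
    and bayes: "\<And>s u. pmf pS s * pmf (pU s) u = w u * pmf (\<pi> u) s"
  shows "(\<Sum>u\<in>A. w u *\<^sub>R info_point W (\<pi> u) (pX u)) =
    (pmf_vec pS, shannon pS - test_info pS pU, test_gain pS W pU pX)"
proof -
  have EU: "measure_pmf.expectation (pU s) f = (\<Sum>u\<in>A. pmf (pU s) u * f u)" for s and f :: "nat \<Rightarrow> real"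
    using A by (subst integral_measure_pmf[where A = A]) auto
  have sumU: "(\<Sum>u\<in>A. pmf (pU s) u) = 1" for s
    using A by (simp add: sum_pmf_eq_1)
  have sumw: "(\<Sum>u\<in>A. w u * pmf (\<pi> u) s) = pmf pS s" for s
    by (simp add: bayes[symmetric] sum_distrib_left[symmetric] sumU)
  have w: "pmf (bind_pmf pS pU) u = w u" for u
    by (simp add: pmf_bind expectation_finite_type bayes sum_distrib_left[symmetric] sum_pmf_eq_1)
  have "test_info pS pU = (\<Sum>s\<in>UNIV. \<Sum>u\<in>A. pmf pS s * pmf (pU s) u * log 2 (pmf (pU s) u / w u))"
    by (simp add: test_info_def expectation_finite_type EU w sum_distrib_left mult.assoc)
  also have "\<dots> = (\<Sum>s\<in>UNIV. \<Sum>u\<in>A. w u * pmf (\<pi> u) s * log 2 (pmf (\<pi> u) s) -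
      w u * pmf (\<pi> u) s * log 2 (pmf pS s))"
  proof (intro sum.cong refl)
    fix s u
    show "pmf pS s * pmf (pU s) u * log 2 (pmf (pU s) u / w u) = w u * pmf (\<pi> u) s * log 2 (pmf (\<pi> u) s) -
      w u * pmf (\<pi> u) s * log 2 (pmf pS s)"
    proof (cases "pmf pS s * pmf (pU s) u = 0")
      case True
      with bayes[of s u] have "w u * pmf (\<pi> u) s = 0" by simp
      with True show ?thesis by (simp only: mult_zero_left diff_self)
    next
      case False
      then have nz: "w u \<noteq> 0" "pmf (\<pi> u) s \<noteq> 0" "pmf pS s \<noteq> 0" "pmf (pU s) u \<noteq> 0"
        using bayes[of s u] by auto
      then have "pmf (pU s) u / w u = pmf (\<pi> u) s / pmf pS s"
        using bayes[of s u] by (simp add: field_simps)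
      then show ?thesis using nz by (simp add: bayes log_divide algebra_simps)
    qed
  qed
  also have "\<dots> = (\<Sum>s\<in>UNIV. \<Sum>u\<in>A. w u * pmf (\<pi> u) s * log 2 (pmf (\<pi> u) s)) -
      (\<Sum>s\<in>UNIV. pmf pS s * log 2 (pmf pS s))"
    by (simp add: sum_subtractf sum_distrib_right[symmetric] sumw)
  also have "\<dots> = shannon pS - (\<Sum>u\<in>A. w u * shannon (\<pi> u))"
    by (subst sum.swap) (simp add: shannon_def eta_def sum_negf sum_distrib_left mult.assoc)
  finally have info: "shannon pS - test_info pS pU = (\<Sum>u\<in>A. w u * shannon (\<pi> u))" by simp
  have gain: "test_gain pS W pU pX = (\<Sum>u\<in>A. w u * (\<Sum>s\<in>UNIV. pmf (\<pi> u) s * channel_info (\<lambda>x. W x s) (pX u)))"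
    by (simp add: test_gain_def expectation_finite_type EU sum_distrib_left bayes mult.assoc[symmetric])
       (rule sum.swap)
  have "(\<Sum>u\<in>A. w u *\<^sub>R pmf_vec (\<pi> u)) = pmf_vec pS"
    by (simp add: vec_eq_iff pmf_vec_def sumw)
  with info gain show ?thesis
    by (simp add: prod_eq_iff fst_sum snd_sum info_point_def)
qed

lemma test_channel_in_info_region:
  assumes A: "finite A" "\<And>s. set_pmf (pU s) \<subseteq> A"
  shows "(pmf_vec pS, shannon pS - test_info pS pU, test_gain pS W pU pX) \<in> info_region W"
proof -
  define w where "w u = (\<Sum>s\<in>UNIV. pmf pS s * pmf (pU s) u)" for u
  have w: "w u \<ge> 0" for u by (auto simp: w_def intro!: sum_nonneg)
  \<comment> \<open>A letter of probability zero has no posterior; the identity then reads 0 = 0 for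
    any pmf.\<close>
  have "\<exists>\<pi>. \<forall>s. pmf pS s * pmf (pU s) u = w u * pmf \<pi> s" for u
  proof (cases "w u = 0")
    case True
    then have "pmf pS s * pmf (pU s) u = 0" for s
      unfolding w_def by (subst (asm) sum_nonneg_eq_0_iff) auto
    with True show ?thesis by simp
  next
    case False
    then obtain \<pi> where "\<forall>s. pmf \<pi> s = pmf pS s * pmf (pU s) u / w u"
      using pmf_exists[of UNIV "\<lambda>s. pmf pS s * pmf (pU s) u / w u"] w[of u]
      by (auto simp: sum_divide_distrib[symmetric] w_def[symmetric])
    with False show ?thesis by (intro exI[of _ \<pi>]) simp
  qed
  then obtain \<pi> where \<pi>: "\<And>u s. pmf pS s * pmf (pU s) u = w u * pmf (\<pi> u) s" by metis
  have "sum w A = (\<Sum>s\<in>UNIV. pmf pS s * (\<Sum>u\<in>A. pmf (pU s) u))"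
    unfolding w_def by (subst sum.swap) (simp add: sum_distrib_left)
  also have "\<dots> = 1" using A by (simp add: sum_pmf_eq_1)
  finally have "sum w A = 1" .
  with info_region_combination[of A w W \<pi> pX] A(1) w show ?thesis
    using test_channel_combination[OF A \<pi>, of W pX] by simp
qed

text \<open>The index in a convex combination serves as the auxiliary letter, and Bayes' rule turns
  weights and posteriors back into \<open>pU\<close>. The number of points is arbitrary, which
  matches the free choice of alphabet for U.\<close>

lemma info_region_test_channel:
  assumes z: "(pmf_vec pS, h, g) \<in> info_region W"
  obtains A pU pX where "finite A" "\<And>s. set_pmf (pU s) \<subseteq> A"
    "h = shannon pS - test_info pS pU" "g = test_gain pS W pU pX"
proof -
  from z have "\<exists>(k :: nat) w x. (\<forall>i\<in>{1..k}. 0 \<le> w i \<and> x i \<in> (\<Union>\<pi> q. {info_point W \<pi> q})) \<and>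
    sum w {1..k} = 1 \<and> (\<Sum>i = 1..k. w i *\<^sub>R x i) = (pmf_vec pS, h, g)"
    unfolding info_region_def convex_hull_indexed mem_Collect_eq .
  then obtain k :: nat and w x where x: "\<forall>i\<in>{1..k}. 0 \<le> w i \<and> x i \<in> (\<Union>\<pi> q. {info_point W \<pi> q})"
    and w1: "sum w {1..k} = 1" and zz: "(\<Sum>i = 1..k. w i *\<^sub>R x i) = (pmf_vec pS, h, g)"
    by (elim exE conjE)
  from x have "\<forall>i\<in>{1..k}. \<exists>\<pi> q. x i = info_point W \<pi> q" by blast
  then obtain \<pi> pX where x': "\<And>i. i \<in> {1..k} \<Longrightarrow> x i = info_point W (\<pi> i) (pX i)" by metis
  \<comment> \<open>Zero weight off \<open>{1..k}\<close> lets the Bayes identity hold for all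
    natural numbers, as \<open>test_channel_combination\<close> demands.\<close>
  define w' where "w' i = (if i \<in> {1..k} then w i else 0)" for i
  have w': "w' i \<ge> 0" "i \<notin> {1..k} \<Longrightarrow> w' i = 0" for i using x by (auto simp: w'_def)
  have sum_w': "(\<Sum>i=1..k. w' i *\<^sub>R info_point W (\<pi> i) (pX i)) = (pmf_vec pS, h, g)"
    using zz x' by (simp add: w'_def)
  then have marg: "(\<Sum>i=1..k. w' i * pmf (\<pi> i) s) = pmf pS s" for s
    by (auto simp: prod_eq_iff fst_sum info_point_def pmf_vec_def vec_eq_iff)
  have "k \<ge> 1" using w1 by (cases k) auto
  have "\<exists>p. set_pmf p \<subseteq> {1..k} \<and> (\<forall>u. pmf pS s * pmf p u = w' u * pmf (\<pi> u) s)" for s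
  proof (cases "pmf pS s = 0")
    case True
    then have "w' i * pmf (\<pi> i) s = 0" for i
      using marg[of s] w' by (cases "i \<in> {1..k}") (auto simp: sum_nonneg_eq_0_iff)
    \<comment> \<open>For a state of probability zero any law on the letters will do; 1 is a letter
      because the weights sum to 1 and so \<open>k\<close> is positive.\<close>
    with True \<open>k \<ge> 1\<close> show ?thesis by (intro exI[of _ "return_pmf 1"]) auto
  next
    case False
    have "(\<Sum>u=1..k. w' u * pmf (\<pi> u) s / pmf pS s) = 1"
      unfolding sum_divide_distrib[symmetric] marg using False by simp
    then have "\<exists>p. \<forall>u. pmf p u = w' u * pmf (\<pi> u) s / pmf pS s"
      using w' by (intro pmf_exists[of "{1..k}"]) auto
    then obtain p where p: "\<forall>u. pmf p u = w' u * pmf (\<pi> u) s / pmf pS s" ..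
    have "set_pmf p \<subseteq> {1..k}"
    proof
      fix u assume "u \<in> set_pmf p"
      then have "w' u \<noteq> 0" using p by (auto simp: set_pmf_eq)
      then show "u \<in> {1..k}" using w'(2) by blast
    qed
    with p False show ?thesis by (intro exI[of _ p]) simp
  qed
  then obtain pU where pU: "\<And>s. set_pmf (pU s) \<subseteq> {1..k}"
    "\<And>s u. pmf pS s * pmf (pU s) u = w' u * pmf (\<pi> u) s" by metis
  have "(pmf_vec pS, shannon pS - test_info pS pU, test_gain pS W pU pX) = (pmf_vec pS, h, g)"
    using test_channel_combination[OF _ pU(1) pU(2), of W pX] sum_w' by simp
  with that[of "{1..k}" pU pX] pU(1) show ?thesis by simp
qed

lemma info_region_max_exists:
  fixes W :: "'x2::finite \<Rightarrow> 's::finite \<Rightarrow> 'y::finite pmf"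
  assumes "c \<ge> 0"
  obtains h g where "(pmf_vec pS, h, g) \<in> info_region W" "h \<ge> shannon pS - c"
    "\<And>h' g'. (pmf_vec pS, h', g') \<in> info_region W \<Longrightarrow> h' \<ge> shannon pS - c \<Longrightarrow> g' \<le> g"
proof -
  let ?Z = "info_region W \<inter> {z. fst z = pmf_vec pS \<and> shannon pS - c \<le> fst (snd z)}"
  have "closed {z :: (real ^ 's) \<times> real \<times> real. fst z = pmf_vec pS \<and> shannon pS - c \<le> fst (snd z)}"
    by (intro closed_Collect_conj closed_Collect_le closed_Collect_eq continuous_intros)
  then have "compact ?Z" by (intro compact_Int_closed compact_info_region)
  \<comment> \<open>The split with constant U has I(U;S) = 0, so the slice is not empty.\<close>
  moreover have "info_point W pS (return_pmf undefined) \<in> ?Z"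
    using assms unfolding info_region_def by (auto simp: info_point_def intro!: hull_inc)
  ultimately obtain z where z: "z \<in> ?Z" "\<forall>z'\<in>?Z. snd (snd z') \<le> snd (snd z)"
    using continuous_attains_sup[of ?Z "\<lambda>z. snd (snd z)"] by (force intro: continuous_intros)
  show ?thesis
  proof (rule that[of "fst (snd z)" "snd (snd z)"])
    show "(pmf_vec pS, fst (snd z), snd (snd z)) \<in> info_region W" "fst (snd z) \<ge> shannon pS - c"
      using z(1) by (cases z; auto)+
    fix h' g' assume "(pmf_vec pS, h', g') \<in> info_region W" "h' \<ge> shannon pS - c"
    then have "(pmf_vec pS, h', g') \<in> ?Z" by simp
    from bspec[OF z(2) this] show "g' \<le> snd (snd z)" by simp
  qed
qed

lemma test_gain_nonneg:
  assumes "\<And>s. finite (set_pmf (pU s))"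
  shows "test_gain pS W pU pX \<ge> 0"
  unfolding test_gain_def by (intro integral_nonneg_AE) (auto simp: channel_info_nonneg)

section \<open>Converse\<close>

lemma expectation_eq_sum_set_pmf:
  fixes f :: "'a \<Rightarrow> real"
  assumes "finite (set_pmf p)"
  shows "measure_pmf.expectation p f = (\<Sum>a\<in>set_pmf p. pmf p a * f a)"
  using assms by (subst integral_measure_pmf[where A = "set_pmf p"]) auto

lemma prob_eq_expectation: "measure_pmf.prob p A = measure_pmf.expectation p (indicator A)"
  by simp

text \<open>Change of measure; only an inequality, because the part of \<open>q\<close> outside the
  support of \<open>p\<close> is invisible under \<open>p\<close>.\<close>

lemma expectation_likelihood_le:
  fixes f :: "'a \<Rightarrow> real"
  assumes fin: "finite (set_pmf p)" "finite (set_pmf q)" and f: "\<And>a. f a \<ge> 0"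
  shows "measure_pmf.expectation p (\<lambda>a. pmf q a / pmf p a * f a) \<le> measure_pmf.expectation q f"
proof -
  have "measure_pmf.expectation p (\<lambda>a. pmf q a / pmf p a * f a) = (\<Sum>a\<in>set_pmf p. pmf q a * f a)"
    using fin by (auto simp: expectation_eq_sum_set_pmf set_pmf_eq intro!: sum.cong)
  also have "\<dots> \<le> (\<Sum>a\<in>set_pmf p \<union> set_pmf q. pmf q a * f a)"
    using fin f by (intro sum_mono2) auto
  also have "\<dots> = (\<Sum>a\<in>set_pmf q. pmf q a * f a)"
    using fin by (intro sum.mono_neutral_right) (auto simp: set_pmf_eq)
  also have "\<dots> = measure_pmf.expectation q f"
    using fin by (simp add: expectation_eq_sum_set_pmf)
  finally show ?thesis .
qed

lemma log2_prod:
  assumes "finite I" "\<And>i. i \<in> I \<Longrightarrow> f i > (0::real)"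
  shows "log 2 (\<Prod>i\<in>I. f i) = (\<Sum>i\<in>I. log 2 (f i))"
  using assms by (simp add: log_def sum_divide_distrib ln_prod less_imp_neq[symmetric])

lemma set_Pi_pmf_iff:
  "finite I \<Longrightarrow> y \<in> set_pmf (Pi_pmf I d P) \<longleftrightarrow> (\<forall>i\<in>I. y i \<in> set_pmf (P i)) \<and> (\<forall>i. i \<notin> I \<longrightarrow> y i = d)"
  by (auto simp: set_Pi_pmf PiE_dflt_def)

lemma expectation_sum_component_Pi_pmf:
  fixes f :: "'i \<Rightarrow> 'a \<Rightarrow> real"
  assumes "finite I" "\<And>i. i \<in> I \<Longrightarrow> finite (set_pmf (P i))"
  shows "measure_pmf.expectation (Pi_pmf I d P) (\<lambda>y. \<Sum>i\<in>I. f i (y i)) =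
    (\<Sum>i\<in>I. measure_pmf.expectation (P i) (f i))"
proof -
  have int: "integrable (measure_pmf (Pi_pmf I d P)) g" for g :: "_ \<Rightarrow> real"
    by (intro integrable_measure_pmf_finite finite_set_Pi_pmf assms)
  have "measure_pmf.expectation (Pi_pmf I d P) (\<lambda>y. \<Sum>i\<in>I. f i (y i)) =
      (\<Sum>i\<in>I. measure_pmf.expectation (map_pmf (\<lambda>y. y i) (Pi_pmf I d P)) (f i))"
    by (simp add: Bochner_Integration.integral_sum int)
  also have "\<dots> = (\<Sum>i\<in>I. measure_pmf.expectation (P i) (f i))"
    using assms by (intro sum.cong) (auto simp: Pi_pmf_component)
  finally show ?thesis .
qed

lemma log2_pmf_Pi_ratio:
  assumes "finite I" "y \<in> set_pmf (Pi_pmf I d P)" "\<And>i. i \<in> I \<Longrightarrow> pmf (Q i) (y i) > 0"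
  shows "log 2 (pmf (Pi_pmf I d P) y / pmf (Pi_pmf I d Q) y) =
    (\<Sum>i\<in>I. log 2 (pmf (P i) (y i) / pmf (Q i) (y i)))"
    and "pmf (Pi_pmf I d Q) y > 0"
proof -
  have y: "\<And>i. i \<notin> I \<Longrightarrow> y i = d" "\<And>i. i \<in> I \<Longrightarrow> pmf (P i) (y i) > 0"
    using assms by (auto simp: set_Pi_pmf_iff pmf_positive_iff)
  show "pmf (Pi_pmf I d Q) y > 0"
    using assms y by (subst pmf_Pi') (auto intro!: prod_pos)
  have "pmf (Pi_pmf I d P) y / pmf (Pi_pmf I d Q) y = (\<Prod>i\<in>I. pmf (P i) (y i) / pmf (Q i) (y i))"
    using assms y by (simp add: pmf_Pi' prod_dividef)
  then show "log 2 (pmf (Pi_pmf I d P) y / pmf (Pi_pmf I d Q) y) =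
    (\<Sum>i\<in>I. log 2 (pmf (P i) (y i) / pmf (Q i) (y i)))"
    using assms y by (simp add: log2_prod)
qed

text \<open>Jensen's inequality for the likelihood ratio of the output law \<open>R\<close> with independent letters
  against the true one, tilted by \<open>|M|\<close> on correct decoding, replaces Fano's inequality and the
  chain rule.\<close>

lemma fano_memoryless:
  fixes V :: "nat \<Rightarrow> 'x::finite \<Rightarrow> 'y::finite pmf" and x :: "'m \<Rightarrow> nat \<Rightarrow> 'x"
  assumes M: "finite M" "M \<noteq> {}" and I: "finite I"
  shows "measure_pmf.prob (bind_pmf (pmf_of_set M) (\<lambda>m. map_pmf (Pair m) (Pi_pmf I undefined (\<lambda>i. V i (x m i)))))
      {(m, y). d y = m} * log 2 (card M) \<le>
    1 + (\<Sum>i\<in>I. channel_info (V i) (map_pmf (\<lambda>m. x m i) (pmf_of_set M)))"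
proof -
  define B where "B m = Pi_pmf I undefined (\<lambda>i. V i (x m i))" for m
  define r where "r i = bind_pmf (map_pmf (\<lambda>m. x m i) (pmf_of_set M)) (V i)" for i
  define R where "R = Pi_pmf I undefined r"
  define P where "P = bind_pmf (pmf_of_set M) (\<lambda>m. map_pmf (Pair m) (B m))"
  define g where "g = (\<lambda>(m, y). if d y = m then real (card M) else 1)"
  define f where "f = (\<lambda>(m, y). pmf R y / pmf (B m) y * g (m, y))"
  have cM: "card M > 0" using M by (simp add: card_gt_0_iff)
  have setM [simp]: "set_pmf (pmf_of_set M) = M" using M by (simp add: set_pmf_of_set)
  have finB [simp]: "finite (set_pmf (B m))" and finR [simp]: "finite (set_pmf R)" for m
    unfolding B_def R_def by (intro finite_set_Pi_pmf I; simp)+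
  have EP: "measure_pmf.expectation P h =
    measure_pmf.expectation (pmf_of_set M) (\<lambda>m. measure_pmf.expectation (B m) (\<lambda>y. h (m, y)))" for h :: "_ \<Rightarrow> real"
    unfolding P_def using M by (subst expectation_bind_pmf_finite) auto
  have finP: "finite (set_pmf P)" unfolding P_def using M by auto
  have gpos: "g z > 0" for z using cM by (auto simp: g_def split: prod.split)
  have rpos: "pmf (r i) (y i) > 0" if "m \<in> M" "y \<in> set_pmf (B m)" "i \<in> I" for m y i
    using that I by (auto simp: pmf_positive_iff r_def B_def set_Pi_pmf_iff)
  have ratio: "log 2 (pmf (B m) y / pmf R y) = (\<Sum>i\<in>I. log 2 (pmf (V i (x m i)) (y i) / pmf (r i) (y i)))"
      and Rpos: "pmf R y > 0"
    if "m \<in> M" "y \<in> set_pmf (B m)" for m y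
    using log2_pmf_Pi_ratio[OF I, of y undefined "\<lambda>i. V i (x m i)" r] rpos[OF that] that(2)
    unfolding B_def R_def by auto
  have supp: "\<exists>m y. z = (m, y) \<and> m \<in> M \<and> y \<in> set_pmf (B m)" if "z \<in> set_pmf P" for z
    using that unfolding P_def by auto
  \<comment> \<open>Under \<open>R\<close> the output is independent of the message. There the tilt
    \<open>g\<close> has mean at most 1 plus \<open>card M\<close> times the chance of deciding for
    \<open>m\<close>; averaging over the uniform \<open>m\<close> leaves at most 1 + 1, because
    different decisions are disjoint events.\<close>
  have "measure_pmf.expectation P (\<lambda>z. log 2 (f z)) \<le> log 2 2"
  proof (rule log2_jensen[OF finP])
    show "f z > 0" if "z \<in> set_pmf P" for z
      using supp[OF that] Rpos gpos by (auto simp: f_def pmf_positive_iff intro!: mult_pos_pos divide_pos_pos)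
    have "measure_pmf.expectation P f \<le> measure_pmf.expectation (pmf_of_set M) (\<lambda>m. measure_pmf.expectation R (\<lambda>y. g (m, y)))"
      unfolding EP f_def prod.case
      using M by (intro expectation_mono_pmf expectation_likelihood_le) (auto intro: less_imp_le gpos)
    also have "\<dots> \<le> measure_pmf.expectation (pmf_of_set M) (\<lambda>m. 1 + real (card M) * measure_pmf.prob R {y. d y = m})"
    proof (rule expectation_mono_pmf)
      fix m
      have "measure_pmf.expectation R (\<lambda>y. g (m, y)) \<le>
          measure_pmf.expectation R (\<lambda>y. 1 + real (card M) * indicator {y. d y = m} y)"
        by (intro expectation_mono_pmf) (auto simp: g_def)
      also have "\<dots> = 1 + real (card M) * measure_pmf.prob R {y. d y = m}"
        by (subst Bochner_Integration.integral_add) (auto intro: integrable_measure_pmf_finite)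
      finally show "measure_pmf.expectation R (\<lambda>y. g (m, y)) \<le> 1 + real (card M) * measure_pmf.prob R {y. d y = m}" .
    qed (use M in auto)
    also have "\<dots> = (\<Sum>m\<in>M. 1 + real (card M) * measure_pmf.prob R {y. d y = m}) / card M"
      using M by (simp add: integral_pmf_of_set)
    also have "\<dots> = 1 + (\<Sum>m\<in>M. measure_pmf.prob R {y. d y = m})"
      using cM by (simp add: sum.distrib sum_distrib_left[symmetric] field_simps)
    also have "(\<Sum>m\<in>M. measure_pmf.prob R {y. d y = m}) = measure_pmf.prob R (\<Union>m\<in>M. {y. d y = m})"
      using M by (intro measure_pmf.finite_measure_finite_Union[symmetric]) (auto simp: disjoint_family_on_def)
    also have "\<dots> \<le> 1" by simp
    finally show "measure_pmf.expectation P f \<le> 2" by simp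
  qed
  also have "log 2 2 = (1::real)" by simp
  \<comment> \<open>In the logarithm, the tilt contributes \<open>log 2 (card M)\<close> exactly on
    correct decoding, and the ratio of product laws splits into information densities of the
    letters.\<close>
  also have "measure_pmf.expectation P (\<lambda>z. log 2 (f z)) =
    measure_pmf.expectation P (\<lambda>z. indicator {(m, y). d y = m} z * log 2 (card M) -
      (\<Sum>i\<in>I. log 2 (pmf (V i (x (fst z) i)) (snd z i) / pmf (r i) (snd z i))))"
  proof (rule expectation_cong_pmf)
    fix z assume "z \<in> set_pmf P"
    with supp obtain m y where z: "z = (m, y)" "m \<in> M" "y \<in> set_pmf (B m)" by blast
    then have "pmf (B m) y > 0" by (simp add: pmf_positive_iff)
    then have "log 2 (f z) = log 2 (g z) - log 2 (pmf (B m) y / pmf R y)"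
      using Rpos[OF z(2,3)] gpos[of z] by (simp add: f_def z(1) log_mult log_divide)
    then show "log 2 (f z) = indicator {(m, y). d y = m} z * log 2 (card M) -
      (\<Sum>i\<in>I. log 2 (pmf (V i (x (fst z) i)) (snd z i) / pmf (r i) (snd z i)))"
      using z ratio[OF z(2,3)] by (simp add: g_def indicator_def)
  qed
  also have "\<dots> = measure_pmf.prob P {(m, y). d y = m} * log 2 (card M) -
      measure_pmf.expectation P (\<lambda>z. \<Sum>i\<in>I. log 2 (pmf (V i (x (fst z) i)) (snd z i) / pmf (r i) (snd z i)))"
    by (subst Bochner_Integration.integral_diff) (auto intro: integrable_measure_pmf_finite finP)
  also have "measure_pmf.expectation P (\<lambda>z. \<Sum>i\<in>I. log 2 (pmf (V i (x (fst z) i)) (snd z i) / pmf (r i) (snd z i))) =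
    measure_pmf.expectation (pmf_of_set M) (\<lambda>m. \<Sum>i\<in>I. measure_pmf.expectation (V i (x m i))
      (\<lambda>b. log 2 (pmf (V i (x m i)) b / pmf (r i) b)))"
    unfolding EP B_def fst_conv snd_conv by (subst expectation_sum_component_Pi_pmf) (auto simp: I)
  also have "\<dots> = (\<Sum>i\<in>I. channel_info (V i) (map_pmf (\<lambda>m. x m i) (pmf_of_set M)))"
    using M by (subst Bochner_Integration.integral_sum)
      (auto simp: channel_info_eq r_def intro: integrable_measure_pmf_finite)
  finally show ?thesis unfolding P_def B_def by simp
qed

section \<open>Conditioning the states on a description\<close>

lemma pmf_disintegration:
  "bind_pmf (map_pmf f P) (\<lambda>z. cond_pmf P (f -` {z})) = P"
proof (rule pmf_eqI)
  fix s
  have "pmf (bind_pmf (map_pmf f P) (\<lambda>z. cond_pmf P (f -` {z}))) s =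
    measure_pmf.expectation (map_pmf f P) (\<lambda>z. indicator {f s} z * (pmf P s / measure_pmf.prob P (f -` {f s})))"
    unfolding pmf_bind
  proof (rule expectation_cong_pmf)
    fix z assume "z \<in> set_pmf (map_pmf f P)"
    then have "set_pmf P \<inter> f -` {z} \<noteq> {}" by auto
    then show "pmf (cond_pmf P (f -` {z})) s = indicator {f s} z * (pmf P s / measure_pmf.prob P (f -` {f s}))"
      by (auto simp: pmf_cond indicator_def)
  qed
  also have "\<dots> = pmf (map_pmf f P) (f s) * (pmf P s / measure_pmf.prob P (f -` {f s}))"
    by (simp add: measure_pmf_single del: integral_map_pmf)
  also have "\<dots> = pmf P s"
  proof (cases "s \<in> set_pmf P")
    case True
    then have "measure_pmf.prob P (f -` {f s}) > 0"
      by (intro measure_pmf_posI) auto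
    then show ?thesis by (simp add: pmf_map)
  next
    case False
    then have "pmf P s = 0" by (simp add: pmf_eq_0_set_pmf)
    then show ?thesis by simp
  qed
  finally show "pmf (bind_pmf (map_pmf f P) (\<lambda>z. cond_pmf P (f -` {z}))) s = pmf P s" .
qed

text \<open>One comparison of \<open>P\<close> with the product of the letter marginals given the
  description does two jobs: it bounds the information in the description by log|Z|, and it discards
  the dependence between letters that conditioning creates. The constant is \<open>card Z\<close>
  because the products \<open>Q z\<close>, summed over z in \<open>Z\<close>, have total mass at
  most \<open>card Z\<close>.\<close>

lemma sum_shannon_given_description:
  fixes pS :: "'s::finite pmf" and f :: "(nat \<Rightarrow> 's) \<Rightarrow> 'z" and I :: "nat set"
  defines "P \<equiv> Pi_pmf I undefined (\<lambda>_. pS)"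
  defines "\<pi> \<equiv> \<lambda>i z. map_pmf (\<lambda>s. s i) (cond_pmf P (f -` {z}))"
  assumes I: "finite I" and Z: "finite Z" "\<And>s. f s \<in> Z"
  shows "measure_pmf.expectation (map_pmf f P) (\<lambda>z. \<Sum>i\<in>I. shannon (\<pi> i z)) \<ge>
    card I * shannon pS - log 2 (card Z)"
proof -
  have finP: "finite (set_pmf P)" unfolding P_def using I by (intro finite_set_Pi_pmf) auto
  have setC: "set_pmf (cond_pmf P (f -` {z})) = set_pmf P \<inter> f -` {z}" if "z \<in> set_pmf (map_pmf f P)" for z
    using that by (intro set_cond_pmf) auto
  have E: "measure_pmf.expectation P g = measure_pmf.expectation (map_pmf f P)
      (\<lambda>z. measure_pmf.expectation (cond_pmf P (f -` {z})) g)" for g :: "_ \<Rightarrow> real"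
    by (subst pmf_disintegration[of f P, symmetric], subst expectation_bind_pmf_finite)
       (use finP setC in auto)
  define Q where "Q z = Pi_pmf I undefined (\<lambda>i. \<pi> i z)" for z
  have supp: "pmf (\<pi> i (f s)) (s i) > 0" if "s \<in> set_pmf P" for s i
    using that setC[of "f s"] by (auto simp: pmf_positive_iff \<pi>_def)
  have "measure_pmf.expectation P (\<lambda>s. log 2 (pmf (Q (f s)) s / pmf P s)) \<le> log 2 (card Z)"
  proof (rule log2_jensen[OF finP])
    fix s assume s: "s \<in> set_pmf P"
    have "pmf (Q (f s)) s > 0"
      using log2_pmf_Pi_ratio(2)[OF I, of s undefined "\<lambda>_. pS" "\<lambda>i. \<pi> i (f s)"] s supp[OF s]
      unfolding P_def Q_def by simp
    then show "pmf (Q (f s)) s / pmf P s > 0" using s by (simp add: pmf_positive_iff)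
  next
    have "measure_pmf.expectation P (\<lambda>s. pmf (Q (f s)) s / pmf P s) = (\<Sum>s\<in>set_pmf P. pmf (Q (f s)) s)"
      using finP by (auto simp: expectation_eq_sum_set_pmf set_pmf_eq intro!: sum.cong)
    \<comment> \<open>Enlarging the single value \<open>f s\<close> to all of \<open>Z\<close>
      removes the dependence of the product law on \<open>s\<close>, so that each can be summed to
      at most 1.\<close>
    also have "\<dots> \<le> (\<Sum>s\<in>set_pmf P. \<Sum>z\<in>Z. pmf (Q z) s)"
      by (intro sum_mono member_le_sum Z) auto
    also have "\<dots> = (\<Sum>z\<in>Z. \<Sum>s\<in>set_pmf P. pmf (Q z) s)" by (rule sum.swap)
    also have "\<dots> \<le> (\<Sum>z\<in>Z. 1)"
      by (intro sum_mono) (simp add: measure_measure_pmf_finite[symmetric] finP)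
    finally show "measure_pmf.expectation P (\<lambda>s. pmf (Q (f s)) s / pmf P s) \<le> card Z" by simp
  qed
  also have "measure_pmf.expectation P (\<lambda>s. log 2 (pmf (Q (f s)) s / pmf P s)) =
      measure_pmf.expectation P (\<lambda>s. (\<Sum>i\<in>I. - log 2 (pmf pS (s i))) - (\<Sum>i\<in>I. - log 2 (pmf (\<pi> i (f s)) (s i))))"
  proof (rule expectation_cong_pmf)
    fix s assume s: "s \<in> set_pmf P"
    have r: "log 2 (pmf P s / pmf (Q (f s)) s) = (\<Sum>i\<in>I. log 2 (pmf pS (s i) / pmf (\<pi> i (f s)) (s i)))"
        "pmf (Q (f s)) s > 0"
      using log2_pmf_Pi_ratio[OF I, of s undefined "\<lambda>_. pS" "\<lambda>i. \<pi> i (f s)"] s supp[OF s]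
      unfolding P_def Q_def by auto
    have p: "pmf pS (s i) > 0" if "i \<in> I" for i
      using s that I by (auto simp: P_def set_Pi_pmf_iff pmf_positive_iff)
    have "pmf P s > 0" using s by (simp add: pmf_positive_iff)
    then have "log 2 (pmf (Q (f s)) s / pmf P s) = - log 2 (pmf P s / pmf (Q (f s)) s)"
      using r(2) by (simp add: log_divide)
    also have "\<dots> = (\<Sum>i\<in>I. - log 2 (pmf pS (s i)) - (- log 2 (pmf (\<pi> i (f s)) (s i))))"
      unfolding r sum_negf[symmetric] using p supp[OF s] by (intro sum.cong) (auto simp: log_divide_pos)
    finally show "log 2 (pmf (Q (f s)) s / pmf P s) =
        (\<Sum>i\<in>I. - log 2 (pmf pS (s i))) - (\<Sum>i\<in>I. - log 2 (pmf (\<pi> i (f s)) (s i)))"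
      by (simp only: sum_subtractf)
  qed
  also have "\<dots> = measure_pmf.expectation P (\<lambda>s. \<Sum>i\<in>I. - log 2 (pmf pS (s i))) -
      measure_pmf.expectation P (\<lambda>s. \<Sum>i\<in>I. - log 2 (pmf (\<pi> i (f s)) (s i)))"
    by (intro Bochner_Integration.integral_diff integrable_measure_pmf_finite finP)
  also have "measure_pmf.expectation P (\<lambda>s. \<Sum>i\<in>I. - log 2 (pmf pS (s i))) = card I * shannon pS"
    unfolding P_def shannon_eq_expectation by (subst expectation_sum_component_Pi_pmf) (auto simp: I)
  also have "measure_pmf.expectation P (\<lambda>s. \<Sum>i\<in>I. - log 2 (pmf (\<pi> i (f s)) (s i))) =
      measure_pmf.expectation (map_pmf f P) (\<lambda>z. \<Sum>i\<in>I. shannon (\<pi> i z))"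
  proof (subst E, rule expectation_cong_pmf)
    fix z assume z: "z \<in> set_pmf (map_pmf f P)"
    have "measure_pmf.expectation (cond_pmf P (f -` {z})) (\<lambda>s. \<Sum>i\<in>I. - log 2 (pmf (\<pi> i (f s)) (s i))) =
        measure_pmf.expectation (cond_pmf P (f -` {z})) (\<lambda>s. \<Sum>i\<in>I. - log 2 (pmf (\<pi> i z) (s i)))"
      by (rule expectation_cong_pmf) (use setC[OF z] in auto)
    also have "\<dots> = (\<Sum>i\<in>I. measure_pmf.expectation (cond_pmf P (f -` {z})) (\<lambda>s. - log 2 (pmf (\<pi> i z) (s i))))"
      by (intro Bochner_Integration.integral_sum integrable_measure_pmf_finite) (use finP setC[OF z] in auto)
    also have "\<dots> = (\<Sum>i\<in>I. shannon (\<pi> i z))"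
      unfolding shannon_eq_expectation by (intro sum.cong refl) (simp add: \<pi>_def)
    finally show "measure_pmf.expectation (cond_pmf P (f -` {z})) (\<lambda>s. \<Sum>i\<in>I. - log 2 (pmf (\<pi> i (f s)) (s i))) =
        (\<Sum>i\<in>I. shannon (\<pi> i z))" .
  qed
  finally show ?thesis by linarith
qed


text \<open>The auxiliary letter is a pair of a uniform time \<open>i\<close> and a whole output
  word \<open>z\<close> of the state encoder. Given the pair, X2 has law \<open>q z i\<close>; its
  randomness is that of the message, hence independent of the states. The weights
  \<open>pmf D z / n\<close> make time sharing part of the convex combination.\<close>

lemma info_region_converse:
  fixes pS :: "'s::finite pmf" and W :: "'x2::finite \<Rightarrow> 's \<Rightarrow> 'y::finite pmf"
    and c :: "('s, 'x1::finite, 'x2, 'y) code"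
  assumes n: "n \<ge> 1" and M: "messages n R \<noteq> {}"
    and obt: "\<And>h g. (pmf_vec pS, h, g) \<in> info_region W \<Longrightarrow>
      h \<ge> shannon pS - log 2 (real CARD('x1)) \<Longrightarrow>
      (1 - error_prob n R pS W c) * log 2 (card (messages n R)) \<le> 1 + n * g \<Longrightarrow> thesis"
  shows thesis
proof -
  define I where "I = {1..n}"
  have I: "finite I" and cI: "card I = n" by (auto simp: I_def)
  define P where "P = Pi_pmf I undefined (\<lambda>_. pS)"
  define f where "f s = (\<lambda>i\<in>I. state_enc c i s)" for s
  define Z where "Z = (I \<rightarrow>\<^sub>E (UNIV :: 'x1 set))"
  define x where "x z m i = msg_enc c i m (restrict z {1..<i})" for z m i
  define U where "U = pmf_of_set (messages n R)"
  define q where "q z i = map_pmf (\<lambda>m. x z m i) U" for z i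
  define \<pi> where "\<pi> i z = map_pmf (\<lambda>s. s i) (cond_pmf P (f -` {z}))" for i z
  define D where "D = map_pmf f P"
  have finM: "finite (messages n R)" by (simp add: messages_def)
  have finP: "finite (set_pmf P)" unfolding P_def using I by (intro finite_set_Pi_pmf) auto
  then have finD: "finite (set_pmf D)" by (simp add: D_def)
  have Z: "finite Z" "\<And>s. f s \<in> Z" by (auto simp: Z_def f_def I intro!: finite_PiE)
  have cZ: "card Z = CARD('x1) ^ n" by (simp add: Z_def card_PiE I cI)
  have setC: "set_pmf (cond_pmf P (f -` {z})) = set_pmf P \<inter> f -` {z}" if "z \<in> set_pmf D" for z
    using that by (intro set_cond_pmf) (auto simp: D_def)
  have E: "measure_pmf.expectation P g = measure_pmf.expectation D
      (\<lambda>z. measure_pmf.expectation (cond_pmf P (f -` {z})) g)" for g :: "_ \<Rightarrow> real"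
    unfolding D_def by (subst pmf_disintegration[of f P, symmetric], subst expectation_bind_pmf_finite)
       (use finP setC in \<open>auto simp: D_def\<close>)
  have final: thesis
    if "z \<in> info_region W" "fst z = pmf_vec pS" "fst (snd z) \<ge> shannon pS - log 2 (real CARD('x1))"
      "(1 - error_prob n R pS W c) * log 2 (card (messages n R)) \<le> 1 + n * snd (snd z)" for z :: "(real ^ 's) \<times> real \<times> real"
  proof -
    from \<open>fst z = pmf_vec pS\<close> have "z = (pmf_vec pS, fst (snd z), snd (snd z))"
      by (cases z) simp
    with that(1) have "(pmf_vec pS, fst (snd z), snd (snd z)) \<in> info_region W" by simp
    from obt[OF this that(3,4)] show thesis .
  qed
  let ?G = "\<lambda>z i a. channel_info (\<lambda>x. W x a) (q z i)"
  let ?z = "\<Sum>(i, z)\<in>I \<times> set_pmf D. (pmf D z / n) *\<^sub>R info_point W (\<pi> i z) (q z i)"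
  have "?z \<in> info_region W"
  proof -
    have "(\<Sum>(i, z)\<in>I \<times> set_pmf D. pmf D z / n) = 1"
      using n by (simp add: sum.cartesian_product[symmetric] sum_divide_distrib[symmetric] sum_pmf_eq_1 finD cI)
    then show ?thesis
      using info_region_combination[of "I \<times> set_pmf D" "\<lambda>(i, z). pmf D z / n" W "\<lambda>(i, z). \<pi> i z" "\<lambda>(i, z). q z i"]
      by (simp add: I finD case_prod_unfold)
  qed
  moreover have "fst ?z = pmf_vec pS"
  proof -
    have "(\<Sum>z\<in>set_pmf D. pmf D z * pmf (\<pi> i z) a) = pmf pS a" if "i \<in> I" for i a
    proof -
      have "pS = map_pmf (\<lambda>s. s i) (bind_pmf D (\<lambda>z. cond_pmf P (f -` {z})))"
        using that I by (simp add: D_def pmf_disintegration P_def Pi_pmf_component)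
      also have "\<dots> = bind_pmf D (\<lambda>z. \<pi> i z)"
        by (simp add: map_bind_pmf \<pi>_def)
      finally have "pmf pS a = measure_pmf.expectation D (\<lambda>z. pmf (\<pi> i z) a)"
        by (simp add: pmf_bind)
      then show ?thesis using finD by (simp add: expectation_eq_sum_set_pmf)
    qed
    then have "(\<Sum>i\<in>I. \<Sum>z\<in>set_pmf D. pmf D z / n * pmf (\<pi> i z) a) = pmf pS a" for a
      using n by (simp add: sum_divide_distrib[symmetric] cI)
    moreover have "fst ?z $ a = (\<Sum>i\<in>I. \<Sum>z\<in>set_pmf D. pmf D z / n * pmf (\<pi> i z) a)" for a
      by (simp add: fst_sum case_prod_unfold pmf_vec_def info_point_def sum.cartesian_product)
    ultimately show ?thesis by (simp add: vec_eq_iff pmf_vec_def)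
  qed
  moreover have "fst (snd ?z) \<ge> shannon pS - log 2 (real CARD('x1))"
  proof -
    have "n * shannon pS - log 2 (card Z) \<le> measure_pmf.expectation D (\<lambda>z. \<Sum>i\<in>I. shannon (\<pi> i z))"
      using sum_shannon_given_description[OF I Z, of pS] unfolding P_def[symmetric] D_def \<pi>_def cI by simp
    also have "\<dots> = (\<Sum>i\<in>I. \<Sum>z\<in>set_pmf D. pmf D z * shannon (\<pi> i z))"
      by (subst sum.swap) (simp add: expectation_eq_sum_set_pmf finD sum_distrib_left)
    also have "\<dots> = n * fst (snd ?z)"
      using n by (simp add: fst_sum snd_sum case_prod_unfold info_point_def sum_distrib_left
         sum.cartesian_product[symmetric, where g = "\<lambda>i z. pmf D z * shannon (\<pi> i z)", unfolded case_prod_unfold])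
    also have "log 2 (card Z) = n * log 2 (real CARD('x1))"
      by (simp add: cZ log_nat_power)
    finally have "n * (shannon pS - log 2 (real CARD('x1))) \<le> n * fst (snd ?z)"
      by (simp add: algebra_simps)
    then show ?thesis using n by simp
  qed
  moreover have "(1 - error_prob n R pS W c) * log 2 (card (messages n R)) \<le> 1 + n * snd (snd ?z)"
  proof -
    define B where "B s = bind_pmf U (\<lambda>m. map_pmf (Pair m) (Pi_pmf I undefined (\<lambda>i. W (x (f s) m i) (s i))))" for s
    define T where "T s = {(m, y). decoder c y s = m}" for s
    \<comment> \<open>The past letters seen at time \<open>i\<close> are part of the word
      \<open>f s\<close>, so the input depends on the states only through the description.\<close>
    have ci: "channel_input c m s i = x (f s) m i" if "i \<in> I" for m s i
    proof -
      have "restrict (f s) {1..<i} = (\<lambda>j\<in>{1..<i}. state_enc c j s)"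
        using that by (auto simp: f_def I_def)
      then show ?thesis by (simp only: x_def channel_input_def)
    qed
    \<comment> \<open>Message and states are independent, so the states may be drawn first. With
      \<open>s\<close> fixed, the channel at time \<open>i\<close> is \<open>W _ (s i)\<close> and
      \<open>fano_memoryless\<close> applies.\<close>
    have "transmission_pmf n R pS W c = bind_pmf P (\<lambda>s. map_pmf (\<lambda>(m, y). (m, s, y)) (B s))"
      unfolding transmission_pmf_def I_def[symmetric] P_def[symmetric] B_def U_def[symmetric]
      by (subst bind_commute_pmf)
         (auto simp: map_pmf_def bind_assoc_pmf bind_return_pmf ci
           intro!: bind_pmf_cong Pi_pmf_cong)
    then have "1 - error_prob n R pS W c =
        measure_pmf.prob (bind_pmf P (\<lambda>s. map_pmf (\<lambda>(m, y). (m, s, y)) (B s))) (- {(m, s, y). decoder c y s \<noteq> m})"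
      unfolding error_prob_def using measure_pmf.prob_compl[of "{(m, s, y). decoder c y s \<noteq> m}"]
      by (simp add: Compl_eq_Diff_UNIV)
    also have "\<dots> = measure_pmf.expectation P (\<lambda>s. measure_pmf.prob (B s) (T s))"
    proof -
      have vimage: "(\<lambda>(m, y). (m, s, y)) -` (- {(m, s, y). decoder c y s \<noteq> m}) = T s" for s
        by (auto simp: T_def)
      have "finite (set_pmf (B s))" for s
        using finM M I by (simp add: B_def U_def finite_set_Pi_pmf)
      then show ?thesis
        unfolding prob_eq_expectation
        by (subst expectation_bind_pmf_finite) (auto simp: finP vimage)
    qed
    finally have "(1 - error_prob n R pS W c) * log 2 (card (messages n R)) =
        measure_pmf.expectation P (\<lambda>s. measure_pmf.prob (B s) (T s) * log 2 (card (messages n R)))"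
      by simp
    also have "\<dots> \<le> measure_pmf.expectation P (\<lambda>s. 1 + (\<Sum>i\<in>I. ?G (f s) i (s i)))"
    proof (rule expectation_mono_pmf[OF finP])
      fix s
      show "measure_pmf.prob (B s) (T s) * log 2 (card (messages n R)) \<le> 1 + (\<Sum>i\<in>I. ?G (f s) i (s i))"
        using fano_memoryless[OF finM M I, of "\<lambda>i x. W x (s i)" "x (f s)" "\<lambda>y. decoder c y s"]
        unfolding B_def T_def U_def q_def .
    qed
    also have "\<dots> = 1 + measure_pmf.expectation P (\<lambda>s. \<Sum>i\<in>I. ?G (f s) i (s i))"
      by (subst Bochner_Integration.integral_add) (auto intro: integrable_measure_pmf_finite finP)
    \<comment> \<open>Given \<open>z\<close>, the state at time \<open>i\<close> is distributed as
      the posterior \<open>\<pi> i z\<close>, and the mean gain under it is the last coordinate of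
      \<open>info_point\<close>.\<close>
    also have "measure_pmf.expectation P (\<lambda>s. \<Sum>i\<in>I. ?G (f s) i (s i)) =
        measure_pmf.expectation D (\<lambda>z. \<Sum>i\<in>I. \<Sum>a\<in>UNIV. pmf (\<pi> i z) a * ?G z i a)"
    proof (subst E, rule expectation_cong_pmf)
      fix z assume z: "z \<in> set_pmf D"
      have "measure_pmf.expectation (cond_pmf P (f -` {z})) (\<lambda>s. \<Sum>i\<in>I. ?G (f s) i (s i)) =
          measure_pmf.expectation (cond_pmf P (f -` {z})) (\<lambda>s. \<Sum>i\<in>I. ?G z i (s i))"
        by (rule expectation_cong_pmf) (use setC[OF z] in auto)
      also have "\<dots> = (\<Sum>i\<in>I. measure_pmf.expectation (cond_pmf P (f -` {z})) (\<lambda>s. ?G z i (s i)))"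
        by (intro Bochner_Integration.integral_sum integrable_measure_pmf_finite) (use finP setC[OF z] in auto)
      also have "\<dots> = (\<Sum>i\<in>I. measure_pmf.expectation (\<pi> i z) (?G z i))"
        by (simp add: \<pi>_def)
      finally show "measure_pmf.expectation (cond_pmf P (f -` {z})) (\<lambda>s. \<Sum>i\<in>I. ?G (f s) i (s i)) =
          (\<Sum>i\<in>I. \<Sum>a\<in>UNIV. pmf (\<pi> i z) a * ?G z i a)"
        by (simp add: expectation_finite_type)
    qed
    also have "\<dots> = (\<Sum>i\<in>I. \<Sum>z\<in>set_pmf D. pmf D z * (\<Sum>a\<in>UNIV. pmf (\<pi> i z) a * ?G z i a))"
      by (subst sum.swap) (simp add: expectation_eq_sum_set_pmf finD sum_distrib_left)
    also have "\<dots> = n * snd (snd ?z)"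
      using n by (simp add: snd_sum case_prod_unfold info_point_def sum_distrib_left
         sum.cartesian_product[symmetric, where g = "\<lambda>i z. \<Sum>a\<in>UNIV. pmf D z * (pmf (\<pi> i z) a * ?G z i a)", unfolded case_prod_unfold])
    finally show ?thesis by simp
  qed
  ultimately show ?thesis by (rule final)
qed

section \<open>Concentration and greedy codes\<close>

lemma Pi_pmf_lower_tail:
  fixes f :: "'i \<Rightarrow> 'a \<Rightarrow> real" and C \<epsilon> :: real
  assumes I: "finite I" "I \<noteq> {}" and C: "C > 0" and \<epsilon>: "\<epsilon> \<ge> 0"
    and bound: "\<And>i a. i \<in> I \<Longrightarrow> a \<in> set_pmf (P i) \<Longrightarrow> \<bar>f i a\<bar> \<le> C"
  shows "measure_pmf.prob (Pi_pmf I d P)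
      {z. (\<Sum>i\<in>I. f i (z i)) \<le> (\<Sum>i\<in>I. measure_pmf.expectation (P i) (f i)) - card I * \<epsilon>}
    \<le> exp (- (card I * \<epsilon>\<^sup>2 / (2 * C\<^sup>2)))"
proof -
  let ?P = "Pi_pmf I d P"
  have E: "measure_pmf.expectation ?P (\<lambda>z. f i (z i)) = measure_pmf.expectation (P i) (f i)" if "i \<in> I" for i
  proof -
    have "measure_pmf.expectation ?P (\<lambda>z. f i (z i)) = measure_pmf.expectation (map_pmf (\<lambda>z. z i) ?P) (f i)"
      by simp
    then show ?thesis using that I by (simp add: Pi_pmf_component)
  qed
  interpret Hoeffding_ineq "measure_pmf ?P" I "\<lambda>i z. f i (z i)" "\<lambda>_. - C" "\<lambda>_. C"
    "\<Sum>i\<in>I. measure_pmf.expectation ?P (\<lambda>z. f i (z i))"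
  proof unfold_locales
    show "prob_space.indep_vars (measure_pmf ?P) (\<lambda>_. borel) (\<lambda>i z. f i (z i)) I"
      by (rule prob_space.indep_vars_compose2[OF measure_pmf.prob_space_axioms indep_vars_Pi_pmf[OF I(1)]]) simp
    show "AE z in measure_pmf ?P. f i (z i) \<in> {- C..C}" if "i \<in> I" for i
      using bound[OF that] that I by (fastforce simp: AE_measure_pmf_iff set_Pi_pmf_iff abs_le_iff)
  qed (use I in auto)
  have cI: "card I > 0" using I by (simp add: card_gt_0_iff)
  have "measure_pmf.prob ?P {z \<in> space (measure_pmf ?P).
      (\<Sum>i\<in>I. f i (z i)) \<le> (\<Sum>i\<in>I. measure_pmf.expectation ?P (\<lambda>z. f i (z i))) - card I * \<epsilon>} \<le>
    exp (- 2 * (card I * \<epsilon>)\<^sup>2 / (\<Sum>i\<in>I. (C - - C)\<^sup>2))"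
    by (rule Hoeffding_ineq_le) (use \<epsilon> C cI in auto)
  also have "- 2 * (card I * \<epsilon>)\<^sup>2 / (\<Sum>i\<in>I. (C - - C)\<^sup>2) = - (card I * \<epsilon>\<^sup>2 / (2 * C\<^sup>2))"
    using cI C by (simp add: power2_eq_square field_simps)
  finally show ?thesis by (simp add: E cong: sum.cong)
qed

text \<open>The threshold \<open>N\<close> depends on \<open>C\<close>, \<open>\<epsilon>\<close>
  and \<open>\<eta>\<close> alone. This uniformity in the letter laws matters later, where they vary
  with the state sequence and with the described letters.\<close>

lemma Pi_pmf_lower_tail_vanishes:
  fixes C \<epsilon> \<eta> :: real
  assumes "C > 0" "\<epsilon> > 0" "\<eta> > 0"
  obtains N where "N \<ge> 1" "\<And>(I :: 'i set) (d :: 'a) P f. finite I \<Longrightarrow> card I \<ge> N \<Longrightarrow>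
    (\<And>i a. i \<in> I \<Longrightarrow> a \<in> set_pmf (P i) \<Longrightarrow> \<bar>f i a\<bar> \<le> C) \<Longrightarrow>
    measure_pmf.prob (Pi_pmf I d P)
      {z. (\<Sum>i\<in>I. f i (z i)) \<le> (\<Sum>i\<in>I. measure_pmf.expectation (P i) (f i)) - card I * \<epsilon>} \<le> \<eta>"
proof -
  define c where "c = \<epsilon>\<^sup>2 / (2 * C\<^sup>2)"
  have c: "c > 0" using assms by (simp add: c_def)
  obtain N :: nat where N: "real N \<ge> - ln \<eta> / c" using real_arch_simple by blast
  show ?thesis
  proof (rule that[of "max N 1"])
    fix I :: "'i set" and d :: 'a and P :: "'i \<Rightarrow> 'a pmf" and f
    assume I: "finite I" "card I \<ge> max N 1"
      and b: "\<And>i a. i \<in> I \<Longrightarrow> a \<in> set_pmf (P i) \<Longrightarrow> \<bar>f i a\<bar> \<le> C"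
    have "real (card I) \<ge> - ln \<eta> / c" using N I by simp
    then have "card I * c \<ge> - ln \<eta>" using c by (simp add: field_simps)
    then have "exp (- (card I * c)) \<le> exp (ln \<eta>)" by (subst exp_le_cancel_iff) simp
    moreover have "I \<noteq> {}" using I by auto
    ultimately show "measure_pmf.prob (Pi_pmf I d P)
      {z. (\<Sum>i\<in>I. f i (z i)) \<le> (\<Sum>i\<in>I. measure_pmf.expectation (P i) (f i)) - card I * \<epsilon>} \<le> \<eta>"
      using Pi_pmf_lower_tail[of I C \<epsilon> P f d] I b assms by (simp add: c_def)
  qed simp
qed

text \<open>Lets the tail bound for independent letters act on a pair of sequences, by viewing it as
  one sequence of independent pairs.\<close>

lemma Pi_pmf_joint:
  fixes P :: "'a \<Rightarrow> 'b pmf" and V :: "'a \<Rightarrow> 'b \<Rightarrow> 'c pmf"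
  assumes I: "finite I"
  shows "bind_pmf (Pi_pmf I d P) (\<lambda>x. map_pmf (Pair x) (Pi_pmf I d' (\<lambda>i. V i (x i)))) =
    map_pmf (\<lambda>z. (\<lambda>i. fst (z i), \<lambda>i. snd (z i)))
      (Pi_pmf I (d, d') (\<lambda>i. bind_pmf (P i) (\<lambda>x. map_pmf (Pair x) (V i x))))"
    (is "?L = map_pmf ?h ?R")
proof (rule pmf_eqI)
  fix w
  obtain x :: "'a \<Rightarrow> 'b" and y :: "'a \<Rightarrow> 'c" where w: "w = (x, y)" by (cases w)
  let ?z = "\<lambda>i. (x i, y i)"
  have "inj ?h" by (auto simp: inj_def fun_eq_iff prod_eq_iff)
  then have "pmf (map_pmf ?h ?R) (?h ?z) = pmf ?R ?z" by (rule pmf_map_inj')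
  moreover have "pmf ?L (x, y) = pmf ?R ?z"
    using I by (auto simp: pmf_bind_map_Pair pmf_Pi prod.distrib)
  ultimately show "pmf ?L w = pmf (map_pmf ?h ?R) w" by (simp add: w)
qed

section \<open>Selection by averaging: covering and packing\<close>

lemma exists_le_expectation:
  fixes f :: "'a \<Rightarrow> real"
  assumes fin: "finite (set_pmf p)"
  shows "\<exists>a\<in>set_pmf p. f a \<le> measure_pmf.expectation p f"
proof (rule ccontr)
  assume "\<not> ?thesis"
  then have "pmf p a * measure_pmf.expectation p f < pmf p a * f a" if "a \<in> set_pmf p" for a
    using that by (intro mult_strict_left_mono) (auto simp: pmf_positive not_le)
  then have "(\<Sum>a\<in>set_pmf p. pmf p a * measure_pmf.expectation p f) < (\<Sum>a\<in>set_pmf p. pmf p a * f a)"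
    by (intro sum_strict_mono fin set_pmf_not_empty)
  moreover have "(\<Sum>a\<in>set_pmf p. pmf p a * measure_pmf.expectation p f) = measure_pmf.expectation p f"
    unfolding sum_distrib_right[symmetric] using fin by (simp add: sum_pmf_eq_1)
  ultimately show False
    using expectation_eq_sum_set_pmf[OF fin, of f] by linarith
qed

lemma exists_ge_expectation:
  fixes f :: "'a \<Rightarrow> real"
  assumes fin: "finite (set_pmf p)"
  shows "\<exists>a\<in>set_pmf p. f a \<ge> measure_pmf.expectation p f"
  using exists_le_expectation[OF fin, of "\<lambda>a. - f a"] by simp

text \<open>Choosing the codewords one at a time, each at least as good as a random one for the
  not yet covered weight, derandomises the i.i.d. codebook.\<close>

lemma greedy_codebook:
  fixes a :: "'s \<Rightarrow> real" and w :: "'u pmf" and G :: "'s \<Rightarrow> 'u set"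
  assumes S: "finite S" and fin: "finite (set_pmf w)" and a: "\<And>s. s \<in> S \<Longrightarrow> a s \<ge> 0"
  shows "\<exists>C. finite C \<and> card C \<le> M \<and> C \<subseteq> set_pmf w \<and>
    (\<Sum>s\<in>S. a s * of_bool (C \<inter> G s = {})) \<le> (\<Sum>s\<in>S. a s * (1 - measure_pmf.prob w (G s)) ^ M)"
  using a
proof (induction M arbitrary: a)
  case 0
  show ?case by (intro exI[of _ "{}"]) simp
next
  case (Suc M)
  let ?\<rho> = "\<lambda>s. measure_pmf.prob w (G s)"
  \<comment> \<open>\<open>?f u\<close> is the random-coding bound, with \<open>M\<close> further
    codewords, for the weight that \<open>u\<close> leaves uncovered. Some \<open>u\<close> does no
    worse than the average, and the average is the bound for \<open>Suc M\<close> codewords.\<close>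
  let ?f = "\<lambda>u. \<Sum>s\<in>S. a s * of_bool (u \<notin> G s) * (1 - ?\<rho> s) ^ M"
  obtain u where u: "u \<in> set_pmf w" "?f u \<le> measure_pmf.expectation w ?f"
    using exists_le_expectation[OF fin, of ?f] by (elim bexE)
  have "\<exists>C. finite C \<and> card C \<le> M \<and> C \<subseteq> set_pmf w \<and>
    (\<Sum>s\<in>S. a s * of_bool (u \<notin> G s) * of_bool (C \<inter> G s = {})) \<le> ?f u"
    by (rule Suc.IH) (simp add: Suc.prems)
  then obtain C where C: "finite C" "card C \<le> M" "C \<subseteq> set_pmf w"
    "(\<Sum>s\<in>S. a s * of_bool (u \<notin> G s) * of_bool (C \<inter> G s = {})) \<le> ?f u"
    by (elim exE conjE)
  have "measure_pmf.expectation w (\<lambda>u. of_bool (u \<notin> G s)) = 1 - ?\<rho> s" for s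
  proof -
    have "measure_pmf.expectation w (\<lambda>u. of_bool (u \<notin> G s)) = measure_pmf.prob w (- G s)"
      unfolding prob_eq_expectation by (intro Bochner_Integration.integral_cong) (auto simp: indicator_def)
    then show ?thesis using measure_pmf.prob_compl[of "G s" w] by (simp add: Compl_eq_Diff_UNIV)
  qed
  then have "measure_pmf.expectation w ?f = (\<Sum>s\<in>S. a s * (1 - ?\<rho> s) ^ Suc M)"
    by (subst Bochner_Integration.integral_sum)
       (auto simp: mult.assoc intro: integrable_measure_pmf_finite fin)
  moreover have "(\<Sum>s\<in>S. a s * of_bool (insert u C \<inter> G s = {})) =
      (\<Sum>s\<in>S. a s * of_bool (u \<notin> G s) * of_bool (C \<inter> G s = {}))"
    by (intro sum.cong) auto
  ultimately show ?case
    using C u by (intro exI[of _ "insert u C"]) (auto simp: card_insert_if)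
qed

text \<open>In the covering argument, \<open>\<rho>\<close> is the chance that a random codeword is
  good, \<open>\<beta>\<close> the chance of the good event under the true conditional law, and
  \<open>\<kappa>\<close> the price of changing the measure. Convexity of exp between 0 and
  \<open>- (M / \<kappa>)\<close> makes the bound affine in \<open>\<beta>\<close>, so that it can
  be averaged over the states.\<close>

lemma power_one_minus_le_exp:
  fixes \<rho> \<beta> \<kappa> :: real
  assumes "0 \<le> \<rho>" "\<rho> \<le> 1" "0 \<le> \<beta>" "\<beta> \<le> 1" "\<kappa> > 0" "\<beta> \<le> \<kappa> * \<rho>"
  shows "(1 - \<rho>) ^ M \<le> 1 - \<beta> + exp (- (M / \<kappa>))"
proof -
  have "(1 - \<rho>) ^ M \<le> exp (- \<rho>) ^ M"
    using assms exp_ge_add_one_self[of "- \<rho>"] by (intro power_mono) auto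
  also have "\<dots> = exp (- (M * \<rho>))" by (simp add: exp_of_nat_mult[symmetric])
  also have "\<dots> \<le> exp (- (M / \<kappa> * \<beta>))"
  proof -
    have "M * \<beta> \<le> M * (\<kappa> * \<rho>)" using assms by (intro mult_left_mono) auto
    then show ?thesis using assms by (simp add: field_simps)
  qed
  also have "\<dots> = exp ((1 - \<beta>) *\<^sub>R 0 + \<beta> *\<^sub>R (- (M / \<kappa>)))" by simp
  also have "\<dots> \<le> (1 - \<beta>) * exp 0 + \<beta> * exp (- (M / \<kappa>))"
    using convex_onD[OF convex_on_exp[of 1], of \<beta> 0 "- (M / \<kappa>)"] assms by simp
  also have "\<dots> \<le> 1 - \<beta> + exp (- (M / \<kappa>))"
    using assms by (simp add: mult_left_le_one_le)
  finally show ?thesis .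
qed

lemma prob_le_of_pmf_le:
  assumes "finite (set_pmf p)" "c \<ge> 0" "\<And>a. a \<in> A \<Longrightarrow> pmf p a \<le> c * pmf q a"
  shows "measure_pmf.prob p A \<le> c * measure_pmf.prob q A"
proof -
  have "measure_pmf.prob p A = (\<Sum>a\<in>A \<inter> set_pmf p. pmf p a)"
    using assms by (subst measure_Int_set_pmf[symmetric], subst measure_measure_pmf_finite) auto
  also have "\<dots> \<le> c * (\<Sum>a\<in>A \<inter> set_pmf p. pmf q a)"
    unfolding sum_distrib_left using assms by (intro sum_mono) auto
  also have "(\<Sum>a\<in>A \<inter> set_pmf p. pmf q a) = measure_pmf.prob q (A \<inter> set_pmf p)"
    using assms by (subst measure_measure_pmf_finite) auto
  also have "\<dots> \<le> measure_pmf.prob q A" by (intro measure_pmf.finite_measure_mono) auto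
  finally show ?thesis using assms by (simp add: mult_left_mono)
qed

lemma prob_bind_map_Pair:
  assumes "finite (set_pmf p)" "\<And>a. a \<in> set_pmf p \<Longrightarrow> finite (set_pmf (f a))"
  shows "measure_pmf.prob (bind_pmf p (\<lambda>a. map_pmf (Pair a) (f a))) A =
    measure_pmf.expectation p (\<lambda>a. measure_pmf.prob (f a) {b. (a, b) \<in> A})"
  unfolding prob_eq_expectation using assms
  by (subst expectation_bind_pmf_finite) (auto simp: vimage_def)

text \<open>Feinstein's argument: the decoding sets chosen so far have total output probability at most
  \<open>M * \<kappa>\<close>, so some input still reaches its own decoding set outside of them.\<close>

lemma feinstein:
  fixes Q :: "'t pmf" and P :: "'t \<Rightarrow> 'o pmf" and D :: "'t \<Rightarrow> 'o set" and M :: nat and \<epsilon> \<kappa> :: real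
  assumes fin: "finite (set_pmf Q)" "\<And>t. finite (set_pmf (P t))"
    and small: "\<And>t. measure_pmf.prob (bind_pmf Q P) (D t) \<le> \<kappa>"
    and large: "measure_pmf.expectation Q (\<lambda>t. measure_pmf.prob (P t) (D t)) \<ge> 1 - \<epsilon> + M * \<kappa>"
    and "\<kappa> \<ge> 0"
  shows "\<exists>t. \<forall>k\<in>{1..M}. measure_pmf.prob (P (t k)) (D (t k) - (\<Union>j\<in>{1..<k}. D (t j))) \<ge> 1 - \<epsilon>"
proof -
  have "\<exists>t. \<forall>k\<in>{1..L}. measure_pmf.prob (P (t k)) (D (t k) - (\<Union>j\<in>{1..<k}. D (t j))) \<ge> 1 - \<epsilon>" if "L \<le> M" for L
    using that
  proof (induction L)
    case 0
    show ?case by simp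
  next
    case (Suc L)
    then obtain t where t: "\<forall>k\<in>{1..L}.
        measure_pmf.prob (P (t k)) (D (t k) - (\<Union>j\<in>{1..<k}. D (t j))) \<ge> 1 - \<epsilon>" by (meson Suc_leD)
    define B where "B = (\<Union>j\<in>{1..<Suc L}. D (t j))"
    have int: "integrable (measure_pmf Q) h" for h :: "_ \<Rightarrow> real"
      by (intro integrable_measure_pmf_finite fin)
    have "measure_pmf.prob (bind_pmf Q P) B \<le> (\<Sum>j\<in>{1..<Suc L}. measure_pmf.prob (bind_pmf Q P) (D (t j)))"
      unfolding B_def by (intro measure_pmf.finite_measure_subadditive_finite) auto
    also have "\<dots> \<le> (\<Sum>j\<in>{1..<Suc L}. \<kappa>)" by (intro sum_mono small)
    also have "\<dots> \<le> M * \<kappa>" using Suc.prems \<open>\<kappa> \<ge> 0\<close> by (simp add: mult_right_mono)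
    finally have B: "measure_pmf.expectation Q (\<lambda>t. measure_pmf.prob (P t) B) \<le> M * \<kappa>"
      unfolding prob_eq_expectation by (subst (asm) expectation_bind_pmf_finite) (auto simp: fin)
    have "1 - \<epsilon> \<le> measure_pmf.expectation Q (\<lambda>t. measure_pmf.prob (P t) (D t) - measure_pmf.prob (P t) B)"
      using large B by (simp add: int)
    also obtain t' where t': "\<dots> \<le> measure_pmf.prob (P t') (D t') - measure_pmf.prob (P t') B"
      using exists_ge_expectation[OF fin(1), of "\<lambda>t. measure_pmf.prob (P t) (D t) - measure_pmf.prob (P t) B"] by blast
    note t'
    also have "measure_pmf.prob (P t') (D t') - measure_pmf.prob (P t') B \<le> measure_pmf.prob (P t') (D t' - B)"
    proof -
      have "measure_pmf.prob (P t') (D t') \<le> measure_pmf.prob (P t') ((D t' - B) \<union> B)"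
        by (intro measure_pmf.finite_measure_mono) auto
      also have "\<dots> \<le> measure_pmf.prob (P t') (D t' - B) + measure_pmf.prob (P t') B"
        by (intro measure_Un_le) auto
      finally show ?thesis by simp
    qed
    finally have new: "1 - \<epsilon> \<le> measure_pmf.prob (P t') (D t' - B)" .
    show ?case
    proof (intro exI[of _ "t(Suc L := t')"] ballI)
      fix k assume k: "k \<in> {1..Suc L}"
      have U: "(\<Union>j\<in>{1..<k}. D ((t(Suc L := t')) j)) = (\<Union>j\<in>{1..<k}. D (t j))"
        using k by (intro SUP_cong) auto
      show "1 - \<epsilon> \<le> measure_pmf.prob (P ((t(Suc L := t')) k))
          (D ((t(Suc L := t')) k) - (\<Union>j\<in>{1..<k}. D ((t(Suc L := t')) j)))"
        unfolding U using k bspec[OF t, of k] new by (cases "k = Suc L") (auto simp: B_def)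
    qed
  qed
  then show ?thesis by blast
qed

text \<open>A lossy covering with a gain in place of a distortion. With high probability a sequence
  drawn from the test channel has large gain and a likelihood ratio of at most
  \<open>\<kappa>\<close> against the product \<open>wn\<close> of the marginals of U. So a word
  drawn from \<open>wn\<close> is good with probability at least
  \<open>\<beta> s / \<kappa>\<close>, and \<open>K ^ n\<close> words outnumber
  \<open>\<kappa>\<close> exponentially.\<close>

lemma sequence_covering:
  fixes pS :: "'s::finite pmf" and pU :: "'s \<Rightarrow> nat pmf" and g :: "'s \<Rightarrow> nat \<Rightarrow> real"
    and K :: nat and \<delta> \<eta> :: real
  assumes finU: "\<And>s. finite (set_pmf (pU s))"
    and rate: "test_info pS pU < log 2 K" and \<delta>: "\<delta> > 0" and \<eta>: "\<eta> > 0" and K: "K \<ge> 1"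
  obtains N where "\<And>n. n \<ge> N \<Longrightarrow> \<exists>C. finite C \<and> card C \<le> K ^ n \<and>
      (\<forall>u\<in>C. \<forall>i\<in>{1..n}. u i \<in> set_pmf (bind_pmf pS pU)) \<and>
      measure_pmf.prob (Pi_pmf {1..n} undefined (\<lambda>_. pS))
        {s. \<forall>u\<in>C. (\<Sum>i\<in>{1..n}. g (s i) (u i)) <
           n * (measure_pmf.expectation pS (\<lambda>s. measure_pmf.expectation (pU s) (g s)) - \<delta>)} \<le> \<eta>"
proof -
  define w where "w = bind_pmf pS pU"
  define J where "J = bind_pmf pS (\<lambda>s. map_pmf (Pair s) (pU s))"
  define v where "v = measure_pmf.expectation pS (\<lambda>s. measure_pmf.expectation (pU s) (g s))"
  define T where "T = test_info pS pU"
  \<comment> \<open>Half of the gap in \<open>rate\<close> bounds the deviation of the information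
    density; the other half is the exponent by which \<open>K ^ n\<close> exceeds
    \<open>\<kappa>\<close>.\<close>
  define \<gamma> where "\<gamma> = (log 2 K - T) / 2"
  define \<iota> where "\<iota> = (\<lambda>(s, u). log 2 (pmf (pU s) u / pmf w u))"
  have \<gamma>: "\<gamma> > 0" using rate by (simp add: \<gamma>_def T_def)
  have finw: "finite (set_pmf w)" by (simp add: w_def finU)
  have finJ: "finite (set_pmf J)" by (simp add: J_def finU)
  have EJ: "measure_pmf.expectation J h = measure_pmf.expectation pS (\<lambda>s. measure_pmf.expectation (pU s) (\<lambda>u. h (s, u)))"
    for h :: "_ \<Rightarrow> real"
    unfolding J_def by (simp add: expectation_bind_pmf_finite finU)
  have EJ\<iota>: "measure_pmf.expectation J \<iota> = T"
    by (simp add: EJ \<iota>_def T_def test_info_def w_def)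
  have EJg: "measure_pmf.expectation J (\<lambda>(s, u). g s u) = v"
    by (simp add: EJ v_def)
  define B where "B = Max (insert 1 ((\<lambda>z. \<bar>\<iota> z\<bar>) ` set_pmf J \<union> (\<lambda>(s, u). \<bar>g s u\<bar>) ` set_pmf J))"
  have B: "B \<ge> 1" "\<bar>\<iota> z\<bar> \<le> B" "\<bar>case z of (s, u) \<Rightarrow> g s u\<bar> \<le> B" if "z \<in> set_pmf J" for z
    unfolding B_def using finJ that by (auto intro!: Max_ge simp: case_prod_unfold)
  have B1: "B \<ge> 1" unfolding B_def using finJ by (intro Max_ge) auto
  then have "B > 0" by simp
  \<comment> \<open>One third each for a deviation of the gain, a deviation of the information
    density, and the exponential term of the covering inequality.\<close>
  have "\<eta> / 3 > 0" using \<eta> by simp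
  obtain N1 where "N1 \<ge> 1" and N1: "\<And>(I :: nat set) (d :: 's \<times> nat) P f. finite I \<Longrightarrow> card I \<ge> N1 \<Longrightarrow>
    (\<And>i a. i \<in> I \<Longrightarrow> a \<in> set_pmf (P i) \<Longrightarrow> \<bar>f i a\<bar> \<le> B) \<Longrightarrow>
    measure_pmf.prob (Pi_pmf I d P)
      {z. (\<Sum>i\<in>I. f i (z i)) \<le> (\<Sum>i\<in>I. measure_pmf.expectation (P i) (f i)) - card I * \<delta>} \<le> \<eta> / 3"
    by (rule Pi_pmf_lower_tail_vanishes[OF \<open>B > 0\<close> \<delta> \<open>\<eta> / 3 > 0\<close>]) blast
  obtain N2 where "N2 \<ge> 1" and N2: "\<And>(I :: nat set) (d :: 's \<times> nat) P f. finite I \<Longrightarrow> card I \<ge> N2 \<Longrightarrow>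
    (\<And>i a. i \<in> I \<Longrightarrow> a \<in> set_pmf (P i) \<Longrightarrow> \<bar>f i a\<bar> \<le> B) \<Longrightarrow>
    measure_pmf.prob (Pi_pmf I d P)
      {z. (\<Sum>i\<in>I. f i (z i)) \<le> (\<Sum>i\<in>I. measure_pmf.expectation (P i) (f i)) - card I * \<gamma>} \<le> \<eta> / 3"
    by (rule Pi_pmf_lower_tail_vanishes[OF \<open>B > 0\<close> \<gamma> \<open>\<eta> / 3 > 0\<close>]) blast
  have "((\<lambda>n::nat. exp (- (2 powr (n * \<gamma>)))) \<longlongrightarrow> 0) sequentially"
    using \<gamma> by real_asymp
  then have "eventually (\<lambda>n::nat. exp (- (2 powr (n * \<gamma>))) < \<eta> / 3) sequentially"
    using \<open>\<eta> / 3 > 0\<close> by (rule order_tendstoD)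
  then obtain N3 where N3: "\<And>n. n \<ge> N3 \<Longrightarrow> exp (- (2 powr (real n * \<gamma>))) < \<eta> / 3"
    by (auto simp: eventually_sequentially)
  show ?thesis
  proof (rule that[of "max N1 (max N2 N3)"])
    fix n assume n: "n \<ge> max N1 (max N2 N3)"
    define I where "I = {1..n}"
    have I: "finite I" and cI: "card I = n" by (auto simp: I_def)
    define P where "P = Pi_pmf I (undefined :: 's) (\<lambda>_. pS)"
    define wn where "wn = Pi_pmf I (undefined :: nat) (\<lambda>_. w)"
    define V where "V s = Pi_pmf I (undefined :: nat) (\<lambda>i. pU (s i))" for s
    define \<kappa> where "\<kappa> = 2 powr (n * (T + \<gamma>))"
    define G where "G s = {u. n * (v - \<delta>) \<le> (\<Sum>i\<in>I. g (s i) (u i))}" for s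
    define L where "L s = {u. pmf (V s) u \<le> \<kappa> * pmf wn u}" for s
    define \<beta> where "\<beta> s = measure_pmf.prob (V s) (G s \<inter> L s)" for s
    define \<rho> where "\<rho> s = measure_pmf.prob wn (G s)" for s
    have \<kappa>: "\<kappa> > 0" by (simp add: \<kappa>_def)
    have finP: "finite (set_pmf P)" unfolding P_def by (intro finite_set_Pi_pmf I) auto
    have finwn: "finite (set_pmf wn)" unfolding wn_def by (intro finite_set_Pi_pmf I finw)
    have finV: "finite (set_pmf (V s))" for s unfolding V_def by (intro finite_set_Pi_pmf I finU)
    obtain C where C: "finite C" "card C \<le> K ^ n" "C \<subseteq> set_pmf wn"
      "(\<Sum>s\<in>set_pmf P. pmf P s * of_bool (C \<inter> G s = {})) \<le> (\<Sum>s\<in>set_pmf P. pmf P s * (1 - \<rho> s) ^ (K ^ n))"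
      using greedy_codebook[OF finP finwn, of "pmf P" "K ^ n" G] unfolding \<rho>_def by auto
    have "\<beta> s \<le> \<kappa> * \<rho> s" for s
    proof -
      have "\<beta> s \<le> \<kappa> * measure_pmf.prob wn (G s \<inter> L s)"
        unfolding \<beta>_def using \<kappa> finV by (intro prob_le_of_pmf_le) (auto simp: L_def)
      also have "\<dots> \<le> \<kappa> * \<rho> s"
        unfolding \<rho>_def using \<kappa> by (intro mult_left_mono measure_pmf.finite_measure_mono) auto
      finally show ?thesis .
    qed
    then have pw: "(1 - \<rho> s) ^ (K ^ n) \<le> 1 - \<beta> s + exp (- (real (K ^ n) / \<kappa>))" for s
      using \<kappa> by (intro power_one_minus_le_exp) (auto simp: \<rho>_def \<beta>_def)
    have M\<kappa>: "real (K ^ n) / \<kappa> = 2 powr (n * \<gamma>)"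
    proof -
      have "real (K ^ n) = 2 powr (n * log 2 K)"
        using K by (simp add: powr_mult[symmetric] powr_powr[symmetric] powr_realpow mult.commute[of "real n"])
      then show ?thesis by (simp add: \<kappa>_def powr_diff[symmetric] \<gamma>_def field_simps)
    qed
    have "measure_pmf.expectation P \<beta> \<ge> 1 - (\<eta> / 3 + \<eta> / 3)"
    proof -
      define Z where "Z = Pi_pmf I (undefined, undefined) (\<lambda>_. J)"
      let ?A = "{(s, u). u \<in> G s \<inter> L s}"
      let ?b1 = "{z. (\<Sum>i\<in>I. (case z i of (s, u) \<Rightarrow> g s u)) \<le> (\<Sum>i\<in>I. measure_pmf.expectation J (\<lambda>(s, u). g s u)) - card I * \<delta>}"
      \<comment> \<open>The upper tail of the information density is the lower tail of its
        negative.\<close>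
      let ?b2 = "{z. (\<Sum>i\<in>I. - \<iota> (z i)) \<le> (\<Sum>i\<in>I. measure_pmf.expectation J (\<lambda>z. - \<iota> z)) - card I * \<gamma>}"
      have "measure_pmf.expectation P \<beta> = measure_pmf.prob (bind_pmf P (\<lambda>s. map_pmf (Pair s) (V s))) ?A"
      proof -
        have "{u. (s, u) \<in> ?A} = G s \<inter> L s" for s by auto
        then show ?thesis by (simp only: prob_bind_map_Pair[OF finP finV] \<beta>_def[abs_def])
      qed
      also have "bind_pmf P (\<lambda>s. map_pmf (Pair s) (V s)) = map_pmf (\<lambda>z. (\<lambda>i. fst (z i), \<lambda>i. snd (z i))) Z"
        unfolding P_def V_def Z_def J_def by (rule Pi_pmf_joint[OF I])
      also have "measure_pmf.prob \<dots> ?A = measure_pmf.prob Z ((\<lambda>z. (\<lambda>i. fst (z i), \<lambda>i. snd (z i))) -` ?A)"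
        by simp
      also have "\<dots> \<ge> measure_pmf.prob Z (- (?b1 \<union> ?b2))"
      proof (rule measure_pmf.finite_measure_mono_AE, unfold AE_measure_pmf_iff, intro ballI impI)
        fix z assume z: "z \<in> set_pmf Z" and nb: "z \<in> - (?b1 \<union> ?b2)"
        let ?s = "\<lambda>i. fst (z i)" and ?u = "\<lambda>i. snd (z i)"
        have "?u \<in> G ?s"
          using nb by (simp add: G_def EJg[unfolded case_prod_unfold] cI case_prod_unfold algebra_simps)
        moreover have "?u \<in> L ?s"
        proof -
          have zi: "z i \<in> set_pmf J" if "i \<in> I" for i
            using z that I by (auto simp: Z_def set_Pi_pmf_iff)
          have zo: "z i = (undefined, undefined)" if "i \<notin> I" for i
            using z that I by (auto simp: Z_def set_Pi_pmf_iff)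
          have u: "?u \<in> set_pmf (V ?s)"
            unfolding V_def using zi zo by (fastforce simp: set_Pi_pmf_iff[OF I] J_def)
          have w: "pmf w (?u i) > 0" if "i \<in> I" for i
            using zi[OF that] by (force simp: pmf_positive_iff w_def J_def)
          note r = log2_pmf_Pi_ratio[OF I u[unfolded V_def], of "\<lambda>_. w", OF w, folded V_def wn_def]
          have "log 2 (pmf (V ?s) ?u / pmf wn ?u) = (\<Sum>i\<in>I. \<iota> (z i))"
            by (subst r(1)) (auto simp: \<iota>_def case_prod_unfold)
          also have "\<dots> < n * (T + \<gamma>)"
            using nb by (simp add: EJ\<iota> cI sum_negf algebra_simps)
          finally have "pmf (V ?s) ?u / pmf wn ?u < \<kappa>"
            unfolding \<kappa>_def using u r(2) by (subst (asm) log_less_iff) (auto simp: pmf_positive_iff)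
          then show ?thesis using r(2) by (simp add: L_def field_simps)
        qed
        ultimately show "z \<in> (\<lambda>z. (\<lambda>i. fst (z i), \<lambda>i. snd (z i))) -` ?A" by simp
      qed auto
      also have "measure_pmf.prob Z (- (?b1 \<union> ?b2)) = 1 - measure_pmf.prob Z (?b1 \<union> ?b2)"
        using measure_pmf.prob_compl[of "?b1 \<union> ?b2" Z] by (simp add: Compl_eq_Diff_UNIV)
      finally have "1 - measure_pmf.prob Z (?b1 \<union> ?b2) \<le> measure_pmf.expectation P \<beta>" .
      moreover have "measure_pmf.prob Z (?b1 \<union> ?b2) \<le> measure_pmf.prob Z ?b1 + measure_pmf.prob Z ?b2"
        by (intro measure_Un_le) auto
      moreover have "measure_pmf.prob Z ?b1 \<le> \<eta> / 3"
        unfolding Z_def by (rule N1) (use n I cI B in auto)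
      moreover have "measure_pmf.prob Z ?b2 \<le> \<eta> / 3"
        unfolding Z_def by (rule N2) (use n I cI B in auto)
      ultimately show ?thesis by linarith
    qed
    have "measure_pmf.prob P {s. \<forall>u\<in>C. (\<Sum>i\<in>I. g (s i) (u i)) < n * (v - \<delta>)} =
        (\<Sum>s\<in>set_pmf P. pmf P s * of_bool (C \<inter> G s = {}))"
    proof -
      have "{s. \<forall>u\<in>C. (\<Sum>i\<in>I. g (s i) (u i)) < n * (v - \<delta>)} = {s. C \<inter> G s = {}}"
        unfolding disjoint_iff G_def mem_Collect_eq not_le by blast
      moreover have "indicator {s. C \<inter> G s = {}} s = (of_bool (C \<inter> G s = {}) :: real)" for s
        by (simp add: indicator_def)
      ultimately show ?thesis
        by (simp only: prob_eq_expectation expectation_eq_sum_set_pmf[OF finP])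
    qed
    also note C(4)
    also have "(\<Sum>s\<in>set_pmf P. pmf P s * (1 - \<rho> s) ^ (K ^ n)) \<le>
        (\<Sum>s\<in>set_pmf P. pmf P s * (1 - \<beta> s + exp (- (real (K ^ n) / \<kappa>))))"
      by (intro sum_mono mult_left_mono pw) auto
    also have "\<dots> = 1 - measure_pmf.expectation P \<beta> + exp (- (real (K ^ n) / \<kappa>))"
      using finP by (simp add: expectation_eq_sum_set_pmf sum.distrib sum_subtractf distrib_left
        right_diff_distrib sum_distrib_right[symmetric] sum_pmf_eq_1)
    also have "\<dots> \<le> \<eta>"
      using \<open>measure_pmf.expectation P \<beta> \<ge> 1 - (\<eta> / 3 + \<eta> / 3)\<close> N3[of n] n M\<kappa> by simp
    finally have "measure_pmf.prob P {s. \<forall>u\<in>C. (\<Sum>i\<in>I. g (s i) (u i)) < n * (v - \<delta>)} \<le> \<eta>" .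
    moreover have "\<forall>u\<in>C. \<forall>i\<in>I. u i \<in> set_pmf w"
      using C(3) by (auto simp: wn_def set_Pi_pmf_iff[OF I])
    ultimately show "\<exists>C. finite C \<and> card C \<le> K ^ n \<and>
      (\<forall>u\<in>C. \<forall>i\<in>{1..n}. u i \<in> set_pmf (bind_pmf pS pU)) \<and>
      measure_pmf.prob (Pi_pmf {1..n} undefined (\<lambda>_. pS))
        {s. \<forall>u\<in>C. (\<Sum>i\<in>{1..n}. g (s i) (u i)) <
           n * (measure_pmf.expectation pS (\<lambda>s. measure_pmf.expectation (pU s) (g s)) - \<delta>)} \<le> \<eta>"
      using C(1,2) unfolding I_def w_def P_def v_def by blast
  qed
qed

section \<open>Achievability\<close>

text \<open>A value \<open>v\<close> of the gain \<open>g\<close> is describable if the state encoder, spending one output letter per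
  state, can convey an auxiliary sequence whose average gain is almost \<open>v\<close>.\<close>

definition describable ::
  "'x1::finite itself \<Rightarrow> 's::finite pmf \<Rightarrow> ('s \<Rightarrow> nat \<Rightarrow> real) \<Rightarrow> nat set \<Rightarrow> real \<Rightarrow> bool" where
  "describable X1 pS g A v \<longleftrightarrow>
    (\<forall>\<delta>>0. \<forall>\<eta>>0. \<forall>N. \<exists>n\<ge>N. \<exists>(enc :: (nat \<Rightarrow> 's) \<Rightarrow> nat \<Rightarrow> 'x1) \<phi>.
      (\<forall>s. enc s \<in> {1..n} \<rightarrow>\<^sub>E UNIV) \<and> (\<forall>z i. \<phi> z i \<in> A) \<and>
      measure_pmf.prob (Pi_pmf {1..n} undefined (\<lambda>_. pS))
        {s. (\<Sum>i\<in>{1..n}. g (s i) (\<phi> (enc s) i)) < n * (v - \<delta>)} \<le> \<eta>)"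

text \<open>There are at least as many output words of length \<open>n\<close> as codewords, so the
  covering codebook embeds injectively into them, and the receiver inverts the embedding.\<close>

lemma describable_test_channel:
  fixes pU :: "'s::finite \<Rightarrow> nat pmf"
  assumes finU: "\<And>s. finite (set_pmf (pU s))"
    and rate: "test_info pS pU < log 2 (real CARD('x1::finite))"
  shows "describable TYPE('x1) pS g (set_pmf (bind_pmf pS pU))
    (measure_pmf.expectation pS (\<lambda>s. measure_pmf.expectation (pU s) (g s)))"
  unfolding describable_def
proof (intro allI impI)
  fix \<delta> \<eta> :: real and N0 :: nat
  assume \<delta>: "\<delta> > 0" and \<eta>: "\<eta> > 0"
  define v where "v = measure_pmf.expectation pS (\<lambda>s. measure_pmf.expectation (pU s) (g s))"
  define A where "A = set_pmf (bind_pmf pS pU)"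
  have "CARD('x1) \<ge> 1" by (simp add: Suc_leI)
  obtain N where N: "\<And>n. n \<ge> N \<Longrightarrow> \<exists>C. finite C \<and> card C \<le> CARD('x1) ^ n \<and>
      (\<forall>u\<in>C. \<forall>i\<in>{1..n}. u i \<in> A) \<and>
      measure_pmf.prob (Pi_pmf {1..n} undefined (\<lambda>_. pS))
        {s. \<forall>u\<in>C. (\<Sum>i\<in>{1..n}. g (s i) (u i)) < n * (v - \<delta>)} \<le> \<eta>"
    by (rule sequence_covering[OF finU rate \<delta> \<eta> \<open>CARD('x1) \<ge> 1\<close>, where g = g, folded A_def v_def]) blast
  define n where "n = max N N0"
  obtain C where C: "finite C" "card C \<le> CARD('x1) ^ n" "\<And>u i. u \<in> C \<Longrightarrow> i \<in> {1..n} \<Longrightarrow> u i \<in> A"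
    "measure_pmf.prob (Pi_pmf {1..n} undefined (\<lambda>_. pS))
        {s. \<forall>u\<in>C. (\<Sum>i\<in>{1..n}. g (s i) (u i)) < n * (v - \<delta>)} \<le> \<eta>"
    using N[of n] by (auto simp: n_def)
  define Z where "Z = ({1..n} \<rightarrow>\<^sub>E (UNIV :: 'x1 set))"
  have "finite Z" "card Z = CARD('x1) ^ n" by (auto simp: Z_def card_PiE intro!: finite_PiE)
  then obtain f where f: "inj_on f C" "f ` C \<subseteq> Z"
    using card_le_inj[of C Z] C by auto
  obtain z0 where z0: "z0 \<in> Z" using \<open>card Z = _\<close> by (fastforce simp: Z_def PiE_eq_empty_iff)
  obtain a0 where a0: "a0 \<in> A" unfolding A_def using set_pmf_not_empty by fast
  let ?good = "\<lambda>s u. u \<in> C \<and> \<not> (\<Sum>i\<in>{1..n}. g (s i) (u i)) < n * (v - \<delta>)"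
  define enc where "enc s = (if \<exists>u. ?good s u then f (SOME u. ?good s u) else z0)" for s
  \<comment> \<open>Patched by \<open>a0\<close> so that every word, also one outside the image of
    the codebook, is read as letters of \<open>A\<close>, as \<open>describable\<close>
    requires.\<close>
  define \<phi> where "\<phi> z i = (if inv_into C f z i \<in> A then inv_into C f z i else a0)" for z i
  have good: "?good s (SOME u. ?good s u)" if "\<exists>u. ?good s u" for s
    using that by (rule someI_ex)
  have "enc s \<in> Z" for s
    using good[of s] f z0 unfolding enc_def by (cases "\<exists>u. ?good s u") auto
  moreover have "\<phi> z i \<in> A" for z i by (simp add: \<phi>_def a0)
  moreover have "measure_pmf.prob (Pi_pmf {1..n} undefined (\<lambda>_. pS))
      {s. (\<Sum>i\<in>{1..n}. g (s i) (\<phi> (enc s) i)) < n * (v - \<delta>)} \<le> \<eta>"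
  proof (rule order_trans[OF measure_pmf.finite_measure_mono C(4)])
    show "{s. (\<Sum>i\<in>{1..n}. g (s i) (\<phi> (enc s) i)) < n * (v - \<delta>)} \<subseteq>
        {s. \<forall>u\<in>C. (\<Sum>i\<in>{1..n}. g (s i) (u i)) < n * (v - \<delta>)}"
    proof (rule ccontr)
      assume "\<not> ?thesis"
      then obtain s where s: "(\<Sum>i\<in>{1..n}. g (s i) (\<phi> (enc s) i)) < n * (v - \<delta>)" "\<exists>u. ?good s u"
        by blast
      let ?u = "SOME u. ?good s u"
      have "inv_into C f (enc s) = ?u"
        using good[OF s(2)] f(1) s(2) by (simp add: enc_def)
      then have "\<phi> (enc s) i = ?u i" if "i \<in> {1..n}" for i
        using C(3) good[OF s(2)] that by (simp add: \<phi>_def)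
      then have "(\<Sum>i\<in>{1..n}. g (s i) (\<phi> (enc s) i)) = (\<Sum>i\<in>{1..n}. g (s i) (?u i))"
        by (intro sum.cong) auto
      then show False using s(1) good[OF s(2)] by simp
    qed
  qed simp
  ultimately have "(\<forall>s. enc s \<in> {1..n} \<rightarrow>\<^sub>E UNIV) \<and> (\<forall>z i. \<phi> z i \<in> A) \<and>
      measure_pmf.prob (Pi_pmf {1..n} undefined (\<lambda>_. pS))
        {s. (\<Sum>i\<in>{1..n}. g (s i) (\<phi> (enc s) i)) < n * (v - \<delta>)} \<le> \<eta>"
    by (simp add: Z_def)
  moreover have "n \<ge> N0" by (simp add: n_def)
  ultimately show "\<exists>n\<ge>N0. \<exists>(enc :: (nat \<Rightarrow> 's) \<Rightarrow> nat \<Rightarrow> 'x1) \<phi>.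
      (\<forall>s. enc s \<in> {1..n} \<rightarrow>\<^sub>E UNIV) \<and> (\<forall>z i. \<phi> z i \<in> set_pmf (bind_pmf pS pU)) \<and>
      measure_pmf.prob (Pi_pmf {1..n} undefined (\<lambda>_. pS))
        {s. (\<Sum>i\<in>{1..n}. g (s i) (\<phi> (enc s) i)) <
          n * (measure_pmf.expectation pS (\<lambda>s. measure_pmf.expectation (pU s) (g s)) - \<delta>)} \<le> \<eta>"
    unfolding A_def v_def by blast
qed

text \<open>A constant letter conveys nothing, so the law of large numbers alone controls the gain.
  This serves the one-letter output alphabet, where no information rate lies strictly below log|X1|
  = 0.\<close>

lemma describable_constant:
  fixes pS :: "'s::finite pmf"
  assumes a: "a \<in> A"
  shows "describable TYPE('x1::finite) pS g A (measure_pmf.expectation pS (\<lambda>s. g s a))"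
  unfolding describable_def
proof (intro allI impI)
  fix \<delta> \<eta> :: real and N0 :: nat
  assume \<delta>: "\<delta> > 0" and \<eta>: "\<eta> > 0"
  let ?v = "measure_pmf.expectation pS (\<lambda>s. g s a)"
  define B where "B = Max (insert 1 (range (\<lambda>s. \<bar>g s a\<bar>)))"
  have B: "B \<ge> 1" "\<bar>g s a\<bar> \<le> B" for s
    unfolding B_def by (rule Max_ge; simp)+
  then have "B > 0" by simp
  obtain N where "N \<ge> 1" and N: "\<And>(I :: nat set) (d :: 's) P f. finite I \<Longrightarrow> card I \<ge> N \<Longrightarrow>
    (\<And>i a. i \<in> I \<Longrightarrow> a \<in> set_pmf (P i) \<Longrightarrow> \<bar>f i a\<bar> \<le> B) \<Longrightarrow>
    measure_pmf.prob (Pi_pmf I d P)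
      {z. (\<Sum>i\<in>I. f i (z i)) \<le> (\<Sum>i\<in>I. measure_pmf.expectation (P i) (f i)) - card I * \<delta>} \<le> \<eta>"
    by (rule Pi_pmf_lower_tail_vanishes[OF \<open>B > 0\<close> \<delta> \<eta>]) blast
  define n where "n = max N N0"
  define enc :: "(nat \<Rightarrow> 's) \<Rightarrow> nat \<Rightarrow> 'x1" where "enc s = (\<lambda>i\<in>{1..n}. undefined)" for s
  have "measure_pmf.prob (Pi_pmf {1..n} undefined (\<lambda>_. pS))
      {s. (\<Sum>i\<in>{1..n}. g (s i) a) < n * (?v - \<delta>)} \<le>
    measure_pmf.prob (Pi_pmf {1..n} undefined (\<lambda>_. pS))
      {s. (\<Sum>i\<in>{1..n}. g (s i) a) \<le> (\<Sum>i\<in>{1..n}. ?v) - card {1..n} * \<delta>}"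
    by (intro measure_pmf.finite_measure_mono) (auto simp: algebra_simps)
  also have "\<dots> \<le> \<eta>"
    by (rule N[of "{1..n}" "\<lambda>_. pS" "\<lambda>_ s. g s a"]) (use B in \<open>auto simp: n_def\<close>)
  finally have "measure_pmf.prob (Pi_pmf {1..n} undefined (\<lambda>_. pS))
      {s. (\<Sum>i\<in>{1..n}. g (s i) a) < n * (?v - \<delta>)} \<le> \<eta>" .
  then show "\<exists>n\<ge>N0. \<exists>(enc :: (nat \<Rightarrow> 's) \<Rightarrow> nat \<Rightarrow> 'x1) \<phi>.
      (\<forall>s. enc s \<in> {1..n} \<rightarrow>\<^sub>E UNIV) \<and> (\<forall>z i. \<phi> z i \<in> A) \<and>
      measure_pmf.prob (Pi_pmf {1..n} undefined (\<lambda>_. pS))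
        {s. (\<Sum>i\<in>{1..n}. g (s i) (\<phi> (enc s) i)) < n * (?v - \<delta>)} \<le> \<eta>"
    using a by (intro exI[of _ n] conjI exI[of _ enc] exI[of _ "\<lambda>_ _. a"]) (auto simp: n_def enc_def)
qed

section \<open>Channel coding for described states\<close>

lemma prob_likelihood_ratio_le:
  assumes "finite (set_pmf q)" "c > 0"
  shows "measure_pmf.prob q {y. pmf p y \<ge> c * pmf q y} \<le> 1 / c"
proof -
  have "measure_pmf.prob q {y. pmf p y \<ge> c * pmf q y} \<le> 1 / c * measure_pmf.prob p {y. pmf p y \<ge> c * pmf q y}"
    using assms by (intro prob_le_of_pmf_le) (auto simp: field_simps)
  also have "\<dots> \<le> 1 / c" using assms by (simp add: field_simps)
  finally show ?thesis .
qed

lemma expectation_swap: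
  fixes h :: "'a \<Rightarrow> 'b \<Rightarrow> real"
  assumes "finite (set_pmf p)" "finite (set_pmf q)"
  shows "measure_pmf.expectation p (\<lambda>a. measure_pmf.expectation q (h a)) =
    measure_pmf.expectation q (\<lambda>b. measure_pmf.expectation p (\<lambda>a. h a b))"
  using assms by (simp add: expectation_eq_sum_set_pmf sum_distrib_left)
    (subst sum.swap, simp add: mult.left_commute)

text \<open>Codewords are sequences of Shannon strategies, i.e. maps from the auxiliary alphabet \<open>A\<close> to
  the input alphabet; only the values \<open>t m i (u s i)\<close> are transmitted.\<close>

lemma strategy_code:
  fixes pS :: "'s::finite pmf" and W :: "'x2::finite \<Rightarrow> 's \<Rightarrow> 'y::finite pmf"
    and pX :: "nat \<Rightarrow> 'x2 pmf" and u :: "(nat \<Rightarrow> 's) \<Rightarrow> nat \<Rightarrow> nat" and \<epsilon> c :: real and I :: "nat set"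
  defines "P \<equiv> Pi_pmf I undefined (\<lambda>_. pS)"
  defines "V \<equiv> \<lambda>s x. Pi_pmf I undefined (\<lambda>i. W (x i) (s i))"
  defines "R \<equiv> \<lambda>s. Pi_pmf I undefined (\<lambda>i. bind_pmf (pX (u s i)) (\<lambda>x. W x (s i)))"
  assumes I: "finite I" and A: "finite A" "\<And>s i. i \<in> I \<Longrightarrow> u s i \<in> A" and c: "c > 0"
    and large: "measure_pmf.expectation P (\<lambda>s. measure_pmf.prob
        (bind_pmf (Pi_pmf I undefined (\<lambda>i. pX (u s i))) (\<lambda>x. map_pmf (Pair x) (V s x)))
        {(x, y). pmf (V s x) y \<ge> c * pmf (R s) y}) \<ge> 1 - \<epsilon> + M / c"
  shows "\<exists>(t :: nat \<Rightarrow> nat \<Rightarrow> nat \<Rightarrow> 'x2) d. \<forall>m\<in>{1..M}.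
    measure_pmf.expectation P (\<lambda>s. measure_pmf.prob (V s (\<lambda>i. t m i (u s i))) {y. d y s = m}) \<ge> 1 - \<epsilon>"
proof -
  \<comment> \<open>A random strategy has independent values over times and auxiliary letters, the
    value at \<open>a\<close> having law \<open>pX a\<close>.\<close>
  define Q where "Q = Pi_pmf I (\<lambda>_. undefined) (\<lambda>_. Pi_pmf A (undefined :: 'x2) pX)"
  \<comment> \<open>The states are treated as part of the channel output, so one code is good on
    average over them.\<close>
  define Pt where "Pt t = bind_pmf P (\<lambda>s. map_pmf (Pair s) (V s (\<lambda>i. t i (u s i))))" for t
  define D where "D t = {(s, y). pmf (V s (\<lambda>i. t i (u s i))) y \<ge> c * pmf (R s) y}" for t
  define xt where "xt s t = (\<lambda>i. if i \<in> I then t i (u s i) else (undefined :: 'x2))" for s t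
  have Vxt: "V s (xt s t) = V s (\<lambda>i. t i (u s i))" for s t
    unfolding V_def xt_def by (intro Pi_pmf_cong) auto
  have finP: "finite (set_pmf P)" unfolding P_def by (intro finite_set_Pi_pmf I) auto
  have finV: "finite (set_pmf (V s x))" for s x unfolding V_def by (intro finite_set_Pi_pmf I) auto
  have finR: "finite (set_pmf (R s))" for s unfolding R_def by (intro finite_set_Pi_pmf I) auto
  have finQ: "finite (set_pmf Q)" unfolding Q_def by (intro finite_set_Pi_pmf I A) auto
  have finPt: "finite (set_pmf (Pt t))" for t unfolding Pt_def using finP finV by auto
  \<comment> \<open>Whatever auxiliary sequence is described, one value of the strategy is read at
    each time, and these values are independent with laws \<open>pX (u s i)\<close>. Hence the
    output law averaged over strategies is \<open>R s\<close>.\<close>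
  have map_xt: "map_pmf (xt s) Q = Pi_pmf I undefined (\<lambda>i. pX (u s i))" for s
  proof -
    have "pX (u s i) = bind_pmf (Pi_pmf A undefined pX) (\<lambda>\<tau>. return_pmf (\<tau> (u s i)))" if "i \<in> I" for i
      using Pi_pmf_component[OF A(1), of "u s i" "undefined :: 'x2" pX] A(2)[OF that] by (simp add: map_pmf_def)
    then have "Pi_pmf I undefined (\<lambda>i. pX (u s i)) =
        Pi_pmf I undefined (\<lambda>i. bind_pmf (Pi_pmf A undefined pX) (\<lambda>\<tau>. return_pmf (\<tau> (u s i))))"
      by (intro Pi_pmf_cong) auto
    also have "\<dots> = bind_pmf Q (\<lambda>t. Pi_pmf I undefined (\<lambda>i. return_pmf (t i (u s i))))"
      unfolding Q_def by (rule Pi_pmf_bind[OF I])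
    also have "\<dots> = map_pmf (xt s) Q"
      using I by (simp add: map_pmf_def xt_def)
    finally show ?thesis ..
  qed
  have bindQ: "bind_pmf Q Pt = bind_pmf P (\<lambda>s. map_pmf (Pair s) (R s))"
  proof -
    have "R s = bind_pmf (map_pmf (xt s) Q) (V s)" for s
      unfolding map_xt R_def V_def by (rule Pi_pmf_bind[OF I])
    then have "R s = bind_pmf Q (\<lambda>t. V s (\<lambda>i. t i (u s i)))" for s
      by (simp add: bind_map_pmf Vxt)
    then show ?thesis
      unfolding Pt_def by (subst bind_commute_pmf) (simp add: map_bind_pmf)
  qed
  have "\<exists>t. \<forall>k\<in>{1..M}. measure_pmf.prob (Pt (t k)) (D (t k) - (\<Union>j\<in>{1..<k}. D (t j))) \<ge> 1 - \<epsilon>"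
  proof (rule feinstein[where Q = Q and \<kappa> = "1 / c"])
    fix t
    have "measure_pmf.prob (bind_pmf Q Pt) (D t) =
        measure_pmf.expectation P (\<lambda>s. measure_pmf.prob (R s) {y. (s, y) \<in> D t})"
      unfolding bindQ by (rule prob_bind_map_Pair[OF finP finR])
    also have "\<dots> \<le> measure_pmf.expectation P (\<lambda>s. 1 / c)"
      by (intro expectation_mono_pmf finP) (simp add: D_def prob_likelihood_ratio_le finR c)
    finally show "measure_pmf.prob (bind_pmf Q Pt) (D t) \<le> 1 / c" by simp
  next
    have "measure_pmf.expectation Q (\<lambda>t. measure_pmf.prob (Pt t) (D t)) =
        measure_pmf.expectation Q (\<lambda>t. measure_pmf.expectation P (\<lambda>s.
          measure_pmf.prob (V s (xt s t)) {y. pmf (V s (xt s t)) y \<ge> c * pmf (R s) y}))"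
      unfolding Pt_def by (subst prob_bind_map_Pair[OF finP finV]) (simp add: D_def Vxt)
    also have "\<dots> = measure_pmf.expectation P (\<lambda>s. measure_pmf.expectation (map_pmf (xt s) Q) (\<lambda>x.
          measure_pmf.prob (V s x) {y. pmf (V s x) y \<ge> c * pmf (R s) y}))"
      by (subst expectation_swap[OF finQ finP]) simp
    also have "\<dots> = measure_pmf.expectation P (\<lambda>s. measure_pmf.prob
        (bind_pmf (Pi_pmf I undefined (\<lambda>i. pX (u s i))) (\<lambda>x. map_pmf (Pair x) (V s x)))
        {(x, y). pmf (V s x) y \<ge> c * pmf (R s) y})"
      unfolding map_xt
      by (subst prob_bind_map_Pair) (auto simp: finV intro!: finite_set_Pi_pmf I)
    finally show "1 - \<epsilon> + M * (1 / c) \<le> measure_pmf.expectation Q (\<lambda>t. measure_pmf.prob (Pt t) (D t))"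
      using large by simp
  qed (use finQ finPt c in auto)
  then obtain t where t: "\<forall>k\<in>{1..M}.
      measure_pmf.prob (Pt (t k)) (D (t k) - (\<Union>j\<in>{1..<k}. D (t j))) \<ge> 1 - \<epsilon>" by (elim exE)
  \<comment> \<open>Deciding for the first index whose set contains the observation realizes the set
    differences in \<open>feinstein\<close>.\<close>
  define d where "d y s = (LEAST k. k \<ge> 1 \<and> (s, y) \<in> D (t k))" for y s
  have "1 - \<epsilon> \<le> measure_pmf.expectation P (\<lambda>s. measure_pmf.prob (V s (\<lambda>i. t m i (u s i))) {y. d y s = m})"
    if m: "m \<in> {1..M}" for m
  proof -
    have "1 - \<epsilon> \<le> measure_pmf.prob (Pt (t m)) (D (t m) - (\<Union>j\<in>{1..<m}. D (t j)))" by (rule bspec[OF t m])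
    also have "\<dots> \<le> measure_pmf.prob (Pt (t m)) {(s, y). d y s = m}"
    proof (intro measure_pmf.finite_measure_mono subsetI)
      fix o' assume o: "o' \<in> D (t m) - (\<Union>j\<in>{1..<m}. D (t j))"
      obtain s y where sy: "o' = (s, y)" by (cases o')
      have "d y s = m"
        unfolding d_def
      proof (rule Least_equality)
        show "1 \<le> m \<and> (s, y) \<in> D (t m)" using o sy m by auto
        fix k assume "1 \<le> k \<and> (s, y) \<in> D (t k)"
        then show "m \<le> k" using o sy by (force simp: not_le[symmetric])
      qed
      then show "o' \<in> {(s, y). d y s = m}" by (simp add: sy)
    qed simp
    also have "\<dots> = measure_pmf.expectation P (\<lambda>s. measure_pmf.prob (V s (\<lambda>i. t m i (u s i))) {y. d y s = m})"
      unfolding Pt_def by (subst prob_bind_map_Pair[OF finP finV]) simp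
    finally show ?thesis .
  qed
  then show ?thesis by blast
qed

lemma prob_bind_pmf_finite:
  assumes "finite (set_pmf p)" "\<And>x. x \<in> set_pmf p \<Longrightarrow> finite (set_pmf (f x))"
  shows "measure_pmf.prob (bind_pmf p f) A = measure_pmf.expectation p (\<lambda>x. measure_pmf.prob (f x) A)"
  using expectation_bind_pmf_finite[OF assms, where h = "indicator A"] by simp

text \<open>\<open>N\<close> is chosen before \<open>s\<close>, \<open>u\<close> and
  \<open>r\<close>, so one block length serves all state sequences whose description has enough
  gain. The information density takes finitely many values for letters in the finite set
  \<open>A\<close>, which gives a common bound for the uniform tail estimate; its mean is the
  gain.\<close>

lemma likelihood_ratio_concentration:
  fixes W :: "'x2::finite \<Rightarrow> 's::finite \<Rightarrow> 'y::finite pmf" and pX :: "nat \<Rightarrow> 'x2 pmf" and \<gamma> \<eta> :: real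
  assumes A: "finite A" and \<gamma>: "\<gamma> > 0" and \<eta>: "\<eta> > 0"
  obtains N where "\<And>(I :: nat set) (s :: nat \<Rightarrow> 's) (u :: nat \<Rightarrow> nat) (r :: real). finite I \<Longrightarrow> card I \<ge> N \<Longrightarrow> (\<And>i. i \<in> I \<Longrightarrow> u i \<in> A) \<Longrightarrow>
    card I * (r + \<gamma>) \<le> (\<Sum>i\<in>I. channel_info (\<lambda>x. W x (s i)) (pX (u i))) \<Longrightarrow>
    measure_pmf.prob
      (bind_pmf (Pi_pmf I undefined (\<lambda>i. pX (u i))) (\<lambda>x. map_pmf (Pair x) (Pi_pmf I undefined (\<lambda>i. W (x i) (s i)))))
      {(x, y). pmf (Pi_pmf I undefined (\<lambda>i. W (x i) (s i))) y \<ge> 2 powr (card I * r) *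
         pmf (Pi_pmf I undefined (\<lambda>i. bind_pmf (pX (u i)) (\<lambda>x. W x (s i)))) y} \<ge> 1 - \<eta>"
proof -
  define \<iota> where "\<iota> s a = (\<lambda>(x, y). log 2 (pmf (W x s) y / pmf (bind_pmf (pX a) (\<lambda>x. W x s)) y))" for s a
  define B where "B = Max (insert 1 ((\<lambda>(s, a, z). \<bar>\<iota> s a z\<bar>) ` (UNIV \<times> A \<times> UNIV)))"
  have fin: "finite (insert 1 ((\<lambda>(s, a, z). \<bar>\<iota> s a z\<bar>) ` (UNIV \<times> A \<times> UNIV)))"
    using A by simp
  have B1: "B \<ge> 1" unfolding B_def by (rule Max_ge[OF fin]) simp
  have B: "\<bar>\<iota> s a z\<bar> \<le> B" if "a \<in> A" for s a z
    unfolding B_def by (rule Max_ge[OF fin]) (use that in force)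
  have "B > 0" using B1 by simp
  obtain N where "N \<ge> 1" and N: "\<And>(I :: nat set) (d :: 'x2 \<times> 'y) P f. finite I \<Longrightarrow> card I \<ge> N \<Longrightarrow>
    (\<And>i a. i \<in> I \<Longrightarrow> a \<in> set_pmf (P i) \<Longrightarrow> \<bar>f i a\<bar> \<le> B) \<Longrightarrow>
    measure_pmf.prob (Pi_pmf I d P)
      {z. (\<Sum>i\<in>I. f i (z i)) \<le> (\<Sum>i\<in>I. measure_pmf.expectation (P i) (f i)) - card I * \<gamma>} \<le> \<eta>"
    by (rule Pi_pmf_lower_tail_vanishes[OF \<open>B > 0\<close> \<gamma> \<eta>]) blast
  show ?thesis
  proof (rule that[of N])
    fix I :: "nat set" and s :: "nat \<Rightarrow> 's" and u :: "nat \<Rightarrow> nat" and r :: real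
    assume I: "finite I" "card I \<ge> N" and u: "\<And>i. i \<in> I \<Longrightarrow> u i \<in> A"
      and gain: "card I * (r + \<gamma>) \<le> (\<Sum>i\<in>I. channel_info (\<lambda>x. W x (s i)) (pX (u i)))"
    define V where "V x = Pi_pmf I undefined (\<lambda>i. W (x i) (s i))" for x
    define R where "R = Pi_pmf I undefined (\<lambda>i. bind_pmf (pX (u i)) (\<lambda>x. W x (s i)))"
    define J where "J i = bind_pmf (pX (u i)) (\<lambda>x. map_pmf (Pair x) (W x (s i)))" for i
    define Z where "Z = Pi_pmf I (undefined, undefined) J"
    define h :: "(nat \<Rightarrow> 'x2 \<times> 'y) \<Rightarrow> _" where "h z = (\<lambda>i. fst (z i), \<lambda>i. snd (z i))" for z
    let ?E = "{(x, y). pmf (V x) y \<ge> 2 powr (card I * r) * pmf R y}"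
    let ?bad = "{z. (\<Sum>i\<in>I. \<iota> (s i) (u i) (z i)) \<le>
      (\<Sum>i\<in>I. measure_pmf.expectation (J i) (\<iota> (s i) (u i))) - card I * \<gamma>}"
    have EJ: "measure_pmf.expectation (J i) (\<iota> (s i) (u i)) = channel_info (\<lambda>x. W x (s i)) (pX (u i))" for i
      unfolding J_def by (subst expectation_bind_pmf_finite) (auto simp: channel_info_eq \<iota>_def)
    have "1 - \<eta> \<le> 1 - measure_pmf.prob Z ?bad"
      unfolding Z_def
      using N[where I = I and P = J and f = "\<lambda>i. \<iota> (s i) (u i)" and d = "(undefined, undefined)"] I B u by simp
    also have "\<dots> = measure_pmf.prob Z (- ?bad)"
      using measure_pmf.prob_compl[of ?bad Z] by (simp add: Compl_eq_Diff_UNIV)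
    also have "\<dots> \<le> measure_pmf.prob Z (h -` ?E)"
    proof (rule measure_pmf.finite_measure_mono_AE, unfold AE_measure_pmf_iff, intro ballI impI)
      fix z assume z: "z \<in> set_pmf Z" and nb: "z \<in> - ?bad"
      let ?x = "\<lambda>i. fst (z i)" and ?y = "\<lambda>i. snd (z i)"
      have zi: "z i \<in> set_pmf (J i)" if "i \<in> I" for i
        using z that I by (auto simp: Z_def set_Pi_pmf_iff)
      have zo: "z i = (undefined, undefined)" if "i \<notin> I" for i
        using z that I by (auto simp: Z_def set_Pi_pmf_iff)
      have y: "?y \<in> set_pmf (V ?x)"
        unfolding V_def using zi zo by (fastforce simp: set_Pi_pmf_iff[OF I(1)] J_def)
      have pos: "pmf (bind_pmf (pX (u i)) (\<lambda>x. W x (s i))) (?y i) > 0" if "i \<in> I" for i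
        using zi[OF that] by (force simp: pmf_positive_iff J_def)
      note r = log2_pmf_Pi_ratio[OF I(1) y[unfolded V_def], of "\<lambda>i. bind_pmf (pX (u i)) (\<lambda>x. W x (s i))",
          OF pos, folded V_def R_def]
      have "card I * r < (\<Sum>i\<in>I. \<iota> (s i) (u i) (z i))"
        using nb gain by (simp add: EJ algebra_simps)
      also have "\<dots> = log 2 (pmf (V ?x) ?y / pmf R ?y)"
        by (subst r(1)) (auto simp: \<iota>_def case_prod_unfold)
      finally have "2 powr (card I * r) < pmf (V ?x) ?y / pmf R ?y"
        using y r(2) by (subst (asm) less_log_iff) (auto simp: pmf_positive_iff)
      then show "z \<in> h -` ?E" using r(2) by (simp add: h_def field_simps)
    qed auto
    also have "\<dots> = measure_pmf.prob (map_pmf h Z) ?E" by simp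
    also have "map_pmf h Z = bind_pmf (Pi_pmf I undefined (\<lambda>i. pX (u i))) (\<lambda>x. map_pmf (Pair x) (V x))"
      unfolding h_def Z_def J_def V_def by (rule Pi_pmf_joint[OF I(1), symmetric])
    finally show "1 - \<eta> \<le> measure_pmf.prob
      (bind_pmf (Pi_pmf I undefined (\<lambda>i. pX (u i))) (\<lambda>x. map_pmf (Pair x) (Pi_pmf I undefined (\<lambda>i. W (x i) (s i)))))
      {(x, y). pmf (Pi_pmf I undefined (\<lambda>i. W (x i) (s i))) y \<ge> 2 powr (card I * r) *
         pmf (Pi_pmf I undefined (\<lambda>i. bind_pmf (pX (u i)) (\<lambda>x. W x (s i)))) y}"
      unfolding V_def R_def .
  qed
qed

section \<open>Block scheme\<close>

lemma sum_blocks: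
  fixes F :: "nat \<Rightarrow> 'a::comm_monoid_add"
  shows "(\<Sum>i\<in>{1..B * n}. F i) = (\<Sum>b<B. \<Sum>j\<in>{1..n}. F (b * n + j))"
proof -
  have "(\<Sum>i\<in>{1..B * n}. F i) = (\<Sum>i<B * n. F (Suc i))"
    by (simp add: sum.atLeast1_atMost_eq)
  also have "\<dots> = (\<Sum>b<B. \<Sum>i\<in>{b * n..<b * n + n}. F (Suc i))"
    by (simp add: sum.nat_group)
  also have "\<dots> = (\<Sum>b<B. \<Sum>j\<in>{1..n}. F (b * n + j))"
  proof (rule sum.cong[OF refl])
    fix b
    show "(\<Sum>i\<in>{b * n..<b * n + n}. F (Suc i)) = (\<Sum>j\<in>{1..n}. F (b * n + j))"
      by (rule sum.reindex_bij_witness[of _ "\<lambda>j. b * n + j - 1" "\<lambda>i. Suc i - b * n"]) auto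
  qed
  finally show ?thesis .
qed

lemma Pi_pmf_block:
  fixes b B n :: nat
  assumes "b < B"
  shows "map_pmf (\<lambda>s. \<lambda>j\<in>{1..n}. s (b * n + j)) (Pi_pmf {1..B * n} undefined (\<lambda>_. p)) =
    Pi_pmf {1..n} undefined (\<lambda>_. p)"
proof -
  let ?I = "{b * n + 1..b * n + n}"
  have "b * n + n \<le> B * n"
    using mult_le_mono1[of "Suc b" B n] assms by simp
  then have sub: "?I \<subseteq> {1..B * n}" by auto
  have bij: "bij_betw (\<lambda>j. b * n + j) {1..n} ?I"
    by (rule bij_betw_byWitness[where f' = "\<lambda>i. i - b * n"]) auto
  have "Pi_pmf {1..n} undefined (\<lambda>_. p) = map_pmf (\<lambda>s. s \<circ> (\<lambda>j. b * n + j)) (Pi_pmf ?I undefined (\<lambda>_. p))"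
    by (rule Pi_pmf_bij_betw[OF _ bij]) auto
  also have "\<dots> = map_pmf ((\<lambda>s. s \<circ> (\<lambda>j. b * n + j)) \<circ> (\<lambda>s i. if i \<in> ?I then s i else undefined))
      (Pi_pmf {1..B * n} undefined (\<lambda>_. p))"
    by (subst Pi_pmf_subset[OF _ sub]) (simp_all add: pmf.map_comp)
  also have "(\<lambda>s. s \<circ> (\<lambda>j. b * n + j)) \<circ> (\<lambda>s i. if i \<in> ?I then s i else undefined) =
      (\<lambda>s. \<lambda>j\<in>{1..n}. s (b * n + j))"
    by (auto simp: fun_eq_iff)
  finally show ?thesis ..
qed

text \<open>\<open>B\<close> blocks of length \<open>n\<close>, where all but the first have
  described letters. The first uses a fixed letter, and its gain is nonnegative. So the total gain
  is at least (B - 1) n (v - \<gamma>) outside an event of probability \<epsilon>/3, which is enough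
  for a strategy code over the whole horizon.\<close>

lemma achievable_of_describable:
  fixes pS :: "'s::finite pmf" and W :: "'x2::finite \<Rightarrow> 's \<Rightarrow> 'y::finite pmf" and pX :: "nat \<Rightarrow> 'x2 pmf"
  assumes A: "finite A"
    and desc: "describable TYPE('x1::finite) pS (\<lambda>s a. channel_info (\<lambda>x. W x s) (pX a)) A v"
    and R: "0 \<le> R" "R < v"
  shows "achievable TYPE('x1) pS W R"
  unfolding achievable_def
proof (intro conjI R allI impI)
  fix \<epsilon> :: real and N0 :: nat assume \<epsilon>: "\<epsilon> > 0"
  define g where "g s a = channel_info (\<lambda>x. W x s) (pX a)" for s a
  have g: "g s a \<ge> 0" for s a by (simp add: g_def channel_info_nonneg)
  \<comment> \<open>Four slacks fit between \<open>R\<close> and \<open>v\<close>: for the imperfect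
    description, for the lost block, for the concentration of the likelihood ratio, and for the
    number of messages against the decoding threshold.\<close>
  define \<gamma> where "\<gamma> = (v - R) / 4"
  have \<gamma>: "\<gamma> > 0" and v: "v = R + 4 * \<gamma>" using R by (auto simp: \<gamma>_def field_simps)
  \<comment> \<open>Enough blocks for a slack of \<open>\<gamma>\<close> per block to make up for
    the gain that the first block may miss.\<close>
  obtain B0 :: nat where B0: "real B0 \<ge> v / \<gamma>" using real_arch_simple by blast
  define B where "B = Suc B0"
  have B: "B \<ge> 1" "B * \<gamma> \<ge> v"
  proof -
    have "v \<le> B0 * \<gamma>" using B0 \<gamma> by (simp add: field_simps)
    then show "B * \<gamma> \<ge> v" using \<gamma> by (simp add: B_def algebra_simps)
  qed (simp add: B_def)
  \<comment> \<open>A third of \<open>\<epsilon>\<close> each for concentration, for a failing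
    description in some block (hence the factor \<open>B\<close>), and for the number of
    messages.\<close>
  have \<epsilon>3: "\<epsilon> / 3 > 0" "\<epsilon> / (3 * B) > 0" using \<epsilon> B by auto
  obtain N1 where N1: "\<And>(I :: nat set) (s :: nat \<Rightarrow> 's) (u :: nat \<Rightarrow> nat) (r :: real). finite I \<Longrightarrow> card I \<ge> N1 \<Longrightarrow> (\<And>i. i \<in> I \<Longrightarrow> u i \<in> A) \<Longrightarrow>
    card I * (r + \<gamma>) \<le> (\<Sum>i\<in>I. channel_info (\<lambda>x. W x (s i)) (pX (u i))) \<Longrightarrow>
    measure_pmf.prob
      (bind_pmf (Pi_pmf I undefined (\<lambda>i. pX (u i))) (\<lambda>x. map_pmf (Pair x) (Pi_pmf I undefined (\<lambda>i. W (x i) (s i)))))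
      {(x, y). pmf (Pi_pmf I undefined (\<lambda>i. W (x i) (s i))) y \<ge> 2 powr (card I * r) *
         pmf (Pi_pmf I undefined (\<lambda>i. bind_pmf (pX (u i)) (\<lambda>x. W x (s i)))) y} \<ge> 1 - \<epsilon> / 3"
    by (rule likelihood_ratio_concentration[OF A \<gamma> \<epsilon>3(1), of W pX]) blast
  have "((\<lambda>n::nat. 2 powr (- (n * \<gamma>))) \<longlongrightarrow> 0) sequentially"
    using \<gamma> by real_asymp
  then have "eventually (\<lambda>n::nat. 2 powr (- (n * \<gamma>)) < \<epsilon> / 3) sequentially"
    using \<epsilon>3(1) by (rule order_tendstoD)
  then obtain N2 where N2: "\<And>n. n \<ge> N2 \<Longrightarrow> 2 powr (- (real n * \<gamma>)) < \<epsilon> / 3"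
    by (auto simp: eventually_sequentially)
  obtain n and enc :: "(nat \<Rightarrow> 's) \<Rightarrow> nat \<Rightarrow> 'x1" and \<phi> where n: "n \<ge> max (max 1 N0) (max N1 N2)"
    and enc: "\<forall>s. enc s \<in> {1..n} \<rightarrow>\<^sub>E UNIV" and \<phi>: "\<forall>z i. \<phi> z i \<in> A"
    and bad: "measure_pmf.prob (Pi_pmf {1..n} undefined (\<lambda>_. pS))
        {s. (\<Sum>i\<in>{1..n}. g (s i) (\<phi> (enc s) i)) < n * (v - \<gamma>)} \<le> \<epsilon> / (3 * B)"
    using desc[unfolded describable_def g_def[symmetric], rule_format, OF \<gamma> \<epsilon>3(2), of "max (max 1 N0) (max N1 N2)"]
    by (elim exE conjE)
  define N where "N = B * n"
  have "N \<ge> n" using B by (simp add: N_def)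
  with n have N: "N \<ge> N0" "N \<ge> N1" "N \<ge> N2" and n1: "n \<ge> 1" by auto
  define I where "I = {1..N}"
  have I: "finite I" and cI: "card I = N" by (auto simp: I_def)
  define \<sigma> where "\<sigma> b s = (\<lambda>j\<in>{1..n}. s (b * n + j))" for b :: nat and s :: "nat \<Rightarrow> 's"
  \<comment> \<open>Times start at 1 and blocks at 0, hence the shifts by one.\<close>
  define blk where "blk i = (i - 1) div n" for i
  define pos where "pos i = (i - 1) mod n + 1" for i
  have blkpos: "blk (b * n + j) = b" "pos (b * n + j) = j" if j: "j \<in> {1..n}" for b j
  proof -
    obtain k where "j = Suc k" "k < n" using j by (cases j) auto
    then show "blk (b * n + j) = b" "pos (b * n + j) = j"
      by (auto simp: blk_def pos_def)
  qed
  define a0 where "a0 = \<phi> undefined 0"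
  define u where "u s i = (if i \<le> n then a0 else \<phi> (enc (\<sigma> (blk i) s)) (pos i))" for s i
  have u: "u s i \<in> A" for s i by (simp add: u_def a0_def \<phi>)
  define P where "P = Pi_pmf I undefined (\<lambda>_. pS)"
  have finP: "finite (set_pmf P)" unfolding P_def by (intro finite_set_Pi_pmf I) auto
  define Bad where "Bad b = {s. (\<Sum>j\<in>{1..n}. g (\<sigma> b s j) (\<phi> (enc (\<sigma> b s)) j)) < n * (v - \<gamma>)}" for b
  define BadU where "BadU = (\<Union>b\<in>{1..<B}. Bad b)"
  have prob_Bad: "measure_pmf.prob P BadU \<le> \<epsilon> / 3"
  proof -
    have "measure_pmf.prob P BadU \<le> (\<Sum>b\<in>{1..<B}. measure_pmf.prob P (Bad b))"
      unfolding BadU_def by (intro measure_pmf.finite_measure_subadditive_finite) auto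
    also have "\<dots> \<le> (\<Sum>b\<in>{1..<B}. \<epsilon> / (3 * B))"
    proof (rule sum_mono)
      fix b assume "b \<in> {1..<B}"
      then have "map_pmf (\<sigma> b) P = Pi_pmf {1..n} undefined (\<lambda>_. pS)"
        unfolding \<sigma>_def P_def I_def N_def by (intro Pi_pmf_block) auto
      then have "measure_pmf.prob (map_pmf (\<sigma> b) P)
          {s. (\<Sum>i\<in>{1..n}. g (s i) (\<phi> (enc s) i)) < n * (v - \<gamma>)} \<le> \<epsilon> / (3 * B)"
        using bad by simp
      then show "measure_pmf.prob P (Bad b) \<le> \<epsilon> / (3 * B)"
        by (simp add: Bad_def vimage_def)
    qed
    also have "\<dots> = real (B - 1) * (\<epsilon> / (3 * B))" by simp
    also have "\<dots> \<le> B * (\<epsilon> / (3 * B))"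
      using \<epsilon>3(2) by (intro mult_right_mono) auto
    also have "\<dots> = \<epsilon> / 3" using B by simp
    finally show ?thesis .
  qed
  have gain: "card I * (R + \<gamma> + \<gamma>) \<le> (\<Sum>i\<in>I. g (s i) (u s i))" if s: "s \<notin> BadU" for s
  proof -
    have "card I * (R + \<gamma> + \<gamma>) = n * (B * (R + 2 * \<gamma>))" by (simp add: cI N_def)
    also have "\<dots> \<le> n * ((real B - 1) * (v - \<gamma>))"
    proof (rule mult_left_mono)
      show "B * (R + 2 * \<gamma>) \<le> (real B - 1) * (v - \<gamma>)"
        using B \<gamma> by (simp add: v algebra_simps)
    qed simp
    also have "\<dots> = (\<Sum>b\<in>{1..<B}. n * (v - \<gamma>))" using B by (simp add: of_nat_diff)
    also have "\<dots> \<le> (\<Sum>b\<in>{1..<B}. \<Sum>j\<in>{1..n}. g (s (b * n + j)) (u s (b * n + j)))"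
    proof (rule sum_mono)
      fix b assume b: "b \<in> {1..<B}"
      have "n * (v - \<gamma>) \<le> (\<Sum>j\<in>{1..n}. g (\<sigma> b s j) (\<phi> (enc (\<sigma> b s)) j))"
        using s b by (auto simp: BadU_def Bad_def not_less)
      also have "\<dots> = (\<Sum>j\<in>{1..n}. g (s (b * n + j)) (u s (b * n + j)))"
      proof (rule sum.cong[OF refl])
        fix j assume j: "j \<in> {1..n}"
        have "n \<le> b * n" using b by simp
        moreover have "j \<ge> 1" using j by simp
        ultimately have "\<not> b * n + j \<le> n" by linarith
        then have "u s (b * n + j) = \<phi> (enc (\<sigma> b s)) j"
          unfolding u_def blkpos[OF j] by simp
        then show "g (\<sigma> b s j) (\<phi> (enc (\<sigma> b s)) j) = g (s (b * n + j)) (u s (b * n + j))"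
          using j by (simp add: \<sigma>_def)
      qed
      finally show "n * (v - \<gamma>) \<le> (\<Sum>j\<in>{1..n}. g (s (b * n + j)) (u s (b * n + j)))" .
    qed
    also have "\<dots> \<le> (\<Sum>b<B. \<Sum>j\<in>{1..n}. g (s (b * n + j)) (u s (b * n + j)))"
      by (intro sum_mono2 sum_nonneg g) auto
    also have "\<dots> = (\<Sum>i\<in>I. g (s i) (u s i))"
      unfolding I_def N_def by (rule sum_blocks[symmetric])
    finally show ?thesis .
  qed
  define V where "V s x = Pi_pmf I undefined (\<lambda>i. W (x i) (s i))" for s x
  define L where "L s = measure_pmf.prob
      (bind_pmf (Pi_pmf I undefined (\<lambda>i. pX (u s i))) (\<lambda>x. map_pmf (Pair x) (Pi_pmf I undefined (\<lambda>i. W (x i) (s i)))))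
      {(x, y). pmf (Pi_pmf I undefined (\<lambda>i. W (x i) (s i))) y \<ge> 2 powr (N * (R + \<gamma>)) *
         pmf (Pi_pmf I undefined (\<lambda>i. bind_pmf (pX (u s i)) (\<lambda>x. W x (s i)))) y}" for s
  define M where "M = nat \<lfloor>2 powr (real N * R)\<rfloor>"
  have M: "messages N R = {1..M}" by (simp add: messages_def M_def)
  have "M \<ge> 1"
  proof -
    have "2 powr 0 \<le> (2 :: real) powr (real N * R)" using R by (intro powr_mono) auto
    then show ?thesis unfolding M_def by (simp add: le_nat_iff le_floor_iff)
  qed
  have "measure_pmf.expectation P L \<ge> 1 - \<epsilon> + M / 2 powr (N * (R + \<gamma>))"
  proof -
    have "M / 2 powr (N * (R + \<gamma>)) \<le> 2 powr (N * R) / 2 powr (N * (R + \<gamma>))"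
      by (intro divide_right_mono) (auto simp: M_def)
    also have "\<dots> = 2 powr (- (N * \<gamma>))" by (simp add: powr_diff[symmetric] algebra_simps)
    also have "\<dots> < \<epsilon> / 3" by (rule N2[OF N(3)])
    finally have small: "M / 2 powr (N * (R + \<gamma>)) < \<epsilon> / 3" .
    have "1 - \<epsilon> / 3 - \<epsilon> / 3 \<le> measure_pmf.expectation P (\<lambda>s. 1 - \<epsilon> / 3 - indicator BadU s)"
      using prob_Bad by (subst Bochner_Integration.integral_diff) (auto intro: integrable_measure_pmf_finite finP)
    also have "\<dots> \<le> measure_pmf.expectation P L"
    proof (rule expectation_mono_pmf[OF finP])
      fix s
      show "1 - \<epsilon> / 3 - indicator BadU s \<le> L s"
      proof (cases "s \<in> BadU")
        case True
        have "L s \<ge> 0" by (simp add: L_def)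
        with True \<epsilon> show ?thesis by simp
      next
        case False
        have "1 - \<epsilon> / 3 \<le> L s"
          unfolding L_def cI[symmetric]
          by (rule N1[OF I]) (use N cI u gain[OF False] in \<open>auto simp: g_def\<close>)
        with False show ?thesis by simp
      qed
    qed
    finally show ?thesis using small by linarith
  qed
  then obtain t :: "nat \<Rightarrow> nat \<Rightarrow> nat \<Rightarrow> 'x2" and d where td: "\<forall>m\<in>{1..M}.
    measure_pmf.expectation P (\<lambda>s. measure_pmf.prob (V s (\<lambda>i. t m i (u s i))) {y. d y s = m}) \<ge> 1 - \<epsilon>"
    using strategy_code[OF I A, where u = u and pX = pX and W = W and pS = pS and \<epsilon> = \<epsilon> and M = M
        and c = "2 powr (N * (R + \<gamma>))"] u
    unfolding V_def P_def L_def by auto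
  \<comment> \<open>The state encoder describes the block after the current one, and the message
    encoder reads the word of the block before it, which lies in the strict past. An index outside
    the message set is replaced by 1 to meet \<open>is_code\<close>.\<close>
  define c :: "('s, 'x1, 'x2, 'y) code" where "c =
    \<lparr>state_enc = \<lambda>i s. enc (\<sigma> (blk i + 1) s) (pos i),
     msg_enc = \<lambda>i m z. t m i (if i \<le> n then a0 else \<phi> (\<lambda>j\<in>{1..n}. z ((blk i - 1) * n + j)) (pos i)),
     decoder = \<lambda>y s. if d y s \<in> {1..M} then d y s else 1\<rparr>"
  have ci: "channel_input c m s i = t m i (u s i)" if "i \<in> I" for m s i
  proof (cases "i \<le> n")
    case True
    then show ?thesis by (simp add: channel_input_def c_def u_def)
  next
    case False
    define b where "b = blk i"
    have "n \<le> i - 1" using False by simp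
    then have b1: "b \<ge> 1" using n1 by (simp add: b_def blk_def div_greater_zero_iff Suc_le_eq)
    have bi: "b * n \<le> i - 1" by (simp add: b_def blk_def)
    have "(\<lambda>j\<in>{1..n}. (\<lambda>k\<in>{1..<i}. state_enc c k s) ((b - 1) * n + j)) = enc (\<sigma> b s)"
    proof (rule extensionalityI[where A = "{1..n}"])
      fix j assume j: "j \<in> {1..n}"
      have "(b - 1) * n + n = b * n" using b1 by (cases b) auto
      then have "(b - 1) * n + j \<in> {1..<i}" using bi j False by auto
      then show "(\<lambda>j\<in>{1..n}. (\<lambda>k\<in>{1..<i}. state_enc c k s) ((b - 1) * n + j)) j = enc (\<sigma> b s) j"
        using j b1 by (simp add: c_def blkpos[OF j])
    qed (use enc[rule_format, of "\<sigma> b s"] in \<open>auto simp: PiE_def\<close>)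
    then show ?thesis using False by (simp add: channel_input_def c_def u_def b_def)
  qed
  have "is_code N R c"
    unfolding is_code_def M using \<open>M \<ge> 1\<close> by (simp add: c_def)
  moreover have "error_prob N R pS W c \<le> \<epsilon>"
  proof -
    let ?Er = "{(m, s, y). decoder c y s \<noteq> m}"
    have finV: "finite (set_pmf (V s x))" for s x unfolding V_def by (intro finite_set_Pi_pmf I) auto
    have "transmission_pmf N R pS W c = bind_pmf (pmf_of_set {1..M}) (\<lambda>m. bind_pmf P (\<lambda>s.
        map_pmf (\<lambda>y. (m, s, y)) (V s (\<lambda>i. t m i (u s i)))))"
      unfolding transmission_pmf_def I_def[symmetric] P_def[symmetric] V_def M
      by (auto simp: map_pmf_def ci intro!: bind_pmf_cong Pi_pmf_cong)
    then have "1 - error_prob N R pS W c = measure_pmf.prob (bind_pmf (pmf_of_set {1..M}) (\<lambda>m. bind_pmf P (\<lambda>s.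
        map_pmf (\<lambda>y. (m, s, y)) (V s (\<lambda>i. t m i (u s i)))))) (- ?Er)"
      unfolding error_prob_def using measure_pmf.prob_compl[of ?Er]
      by (simp add: Compl_eq_Diff_UNIV)
    also have "\<dots> = measure_pmf.expectation (pmf_of_set {1..M}) (\<lambda>m. measure_pmf.expectation P (\<lambda>s.
        measure_pmf.prob (V s (\<lambda>i. t m i (u s i))) ((\<lambda>y. (m, s, y)) -` (- ?Er))))"
      using \<open>M \<ge> 1\<close> by (simp add: prob_bind_pmf_finite finP finV)
    also have "\<dots> \<ge> measure_pmf.expectation (pmf_of_set {1..M}) (\<lambda>m. 1 - \<epsilon>)"
    proof (rule expectation_mono_pmf)
      fix m assume "m \<in> set_pmf (pmf_of_set {1..M})"
      then have m: "m \<in> {1..M}" using \<open>M \<ge> 1\<close> by simp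
      have "1 - \<epsilon> \<le> measure_pmf.expectation P (\<lambda>s. measure_pmf.prob (V s (\<lambda>i. t m i (u s i))) {y. d y s = m})"
        by (rule bspec[OF td m])
      also have "\<dots> \<le> measure_pmf.expectation P (\<lambda>s.
          measure_pmf.prob (V s (\<lambda>i. t m i (u s i))) ((\<lambda>y. (m, s, y)) -` (- ?Er)))"
        using m by (intro expectation_mono_pmf finP measure_pmf.finite_measure_mono) (auto simp: c_def)
      finally show "1 - \<epsilon> \<le> \<dots>" .
    qed (use \<open>M \<ge> 1\<close> in simp)
    finally show ?thesis by simp
  qed
  ultimately show "\<exists>n\<ge>N0. \<exists>c :: ('s, 'x1, 'x2, 'y) code. is_code n R c \<and> error_prob n R pS W c \<le> \<epsilon>"
    using N(1) by blast
qed

section \<open>Matching the two bounds\<close>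

lemma feasible_iff:
  fixes pS :: "'s::finite pmf" and W :: "'x2::finite \<Rightarrow> 's \<Rightarrow> 'y::finite pmf"
  shows "feasible TYPE('x1::finite) pS W pU pX \<longleftrightarrow>
    (\<exists>A. finite A \<and> (\<forall>s. set_pmf (pU s) \<subseteq> A)) \<and> test_info pS pU \<le> log 2 (real CARD('x1))"
proof -
  have "mutual_info (joint_pmf pS W pU pX) (\<lambda>(s, u, x, y). u) (\<lambda>(s, u, x, y). s) = test_info pS pU"
    if "finite A" "\<forall>s. set_pmf (pU s) \<subseteq> A" for A
    using that by (intro mutual_info_joint) (auto intro: finite_subset)
  then show ?thesis unfolding feasible_def by (auto cong: conj_cong)
qed

text \<open>The equality case of ln t \<le> t - 1. The defect \<open>f\<close> of this inequality at
  the likelihood ratio is nonnegative with mean at most \<open>ln 2 * test_info pS pU\<close>, so it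
  vanishes on the support, and there the ratio is 1.\<close>

lemma independent_if_test_info_nonpos:
  fixes pS :: "'s::finite pmf"
  assumes fin: "\<And>s. finite (set_pmf (pU s))" and le: "test_info pS pU \<le> 0"
    and s: "s \<in> set_pmf pS"
  shows "pU s = bind_pmf pS pU"
proof -
  define w where "w = bind_pmf pS pU"
  have finw: "finite (set_pmf w)" by (simp add: w_def fin)
  define f where "f s u = pmf w u / pmf (pU s) u - 1 - ln (pmf w u / pmf (pU s) u)" for s u
  have pos: "pmf w u > 0" "pmf (pU s) u > 0" if "s \<in> set_pmf pS" "u \<in> set_pmf (pU s)" for s u
    using that by (auto simp: pmf_positive_iff w_def)
  have f: "f s u \<ge> 0" if "s \<in> set_pmf pS" "u \<in> set_pmf (pU s)" for s u
    using ln_le_minus_one[of "pmf w u / pmf (pU s) u"] pos[OF that] by (simp add: f_def)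
  have "measure_pmf.expectation pS (\<lambda>s. measure_pmf.expectation (pU s) (f s)) \<le>
      measure_pmf.expectation pS (\<lambda>s. measure_pmf.expectation (pU s)
        (\<lambda>u. ln 2 * log 2 (pmf (pU s) u / pmf w u)))"
  proof (rule expectation_mono_pmf, simp)
    fix s assume s: "s \<in> set_pmf pS"
    have "measure_pmf.expectation (pU s) (f s) = measure_pmf.expectation (pU s)
        (\<lambda>u. pmf w u / pmf (pU s) u * 1 - 1 + ln 2 * log 2 (pmf (pU s) u / pmf w u))"
      by (rule expectation_cong_pmf) (use pos[OF s] in \<open>auto simp: f_def log_def ln_div\<close>)
    also have "\<dots> = measure_pmf.expectation (pU s) (\<lambda>u. pmf w u / pmf (pU s) u * 1) - 1 +
        measure_pmf.expectation (pU s) (\<lambda>u. ln 2 * log 2 (pmf (pU s) u / pmf w u))"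
      by (subst Bochner_Integration.integral_add, (rule integrable_measure_pmf_finite[OF fin])+,
          subst Bochner_Integration.integral_diff) (auto intro: integrable_measure_pmf_finite[OF fin])
    also have "\<dots> \<le> measure_pmf.expectation (pU s) (\<lambda>u. ln 2 * log 2 (pmf (pU s) u / pmf w u))"
      using expectation_likelihood_le[OF fin[of s] finw, where f = "\<lambda>_. 1"] by simp
    finally show "measure_pmf.expectation (pU s) (f s) \<le> \<dots>" .
  qed
  also have "\<dots> = ln 2 * test_info pS pU" by (simp add: test_info_def w_def)
  also have "\<dots> \<le> 0" using le by (simp add: mult_le_0_iff)
  finally have le0: "(\<Sum>s\<in>set_pmf pS. pmf pS s * measure_pmf.expectation (pU s) (f s)) \<le> 0"
    by (simp add: expectation_eq_sum_set_pmf)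
  have nonneg: "measure_pmf.expectation (pU s) (f s) \<ge> 0" if "s \<in> set_pmf pS" for s
    using f[OF that] by (intro integral_nonneg_AE) (simp add: AE_measure_pmf_iff)
  have "(\<Sum>s\<in>set_pmf pS. pmf pS s * measure_pmf.expectation (pU s) (f s)) = 0"
    by (rule antisym[OF le0]) (intro sum_nonneg mult_nonneg_nonneg nonneg; simp)
  then have "pmf pS s * measure_pmf.expectation (pU s) (f s) = 0"
    using s by (subst (asm) sum_nonneg_eq_0_iff) (auto intro: mult_nonneg_nonneg nonneg)
  then have "(\<Sum>u\<in>set_pmf (pU s). pmf (pU s) u * f s u) = 0"
    using s by (simp add: expectation_eq_sum_set_pmf[OF fin] set_pmf_eq)
  then have "pmf (pU s) u * f s u = 0" if "u \<in> set_pmf (pU s)" for u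
    using that s by (subst (asm) sum_nonneg_eq_0_iff) (auto intro: mult_nonneg_nonneg f fin)
  then have f0: "f s u = 0" if "u \<in> set_pmf (pU s)" for u
    using that by (simp add: set_pmf_eq)
  have eq: "pmf w u = pmf (pU s) u" if "u \<in> set_pmf (pU s)" for u
  proof -
    have "ln (pmf w u / pmf (pU s) u) = pmf w u / pmf (pU s) u - 1"
      using f0[OF that] by (simp add: f_def)
    then have "pmf w u / pmf (pU s) u = 1"
      using pos[OF s that] by (intro ln_eq_minus_one) auto
    then show ?thesis using pos[OF s that] by simp
  qed
  \<comment> \<open>Agreement on the support of \<open>pU s\<close> already exhausts the mass of
    \<open>w\<close>, so both vanish elsewhere.\<close>
  have "pmf (pU s) u = pmf w u" for u
  proof (cases "u \<in> set_pmf (pU s)")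
    case False
    have "(\<Sum>u\<in>set_pmf (pU s). pmf w u) = 1"
      using eq fin by (simp add: sum_pmf_eq_1)
    then have "measure_pmf.prob w (set_pmf (pU s)) = 1"
      using fin by (simp add: measure_measure_pmf_finite)
    then have "set_pmf w \<subseteq> set_pmf (pU s)"
      by (simp add: measure_pmf.prob_eq_1 AE_measure_pmf_iff subset_iff)
    with False show ?thesis by (metis pmf_eq_0_set_pmf subsetD)
  qed (simp add: eq)
  then show ?thesis unfolding w_def by (rule pmf_eqI)
qed

text \<open>The covering argument needs \<open>I(U;S)\<close> strictly below the rate of the state encoder. If the
  latter is positive, mixing with a test channel independent of the state gives the slack; if it is
  zero, \<open>U\<close> is independent of the state and can be replaced by its best value.\<close>

lemma achievable_below_test_gain:
  fixes pS :: "'s::finite pmf" and W :: "'x2::finite \<Rightarrow> 's \<Rightarrow> 'y::finite pmf"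
  assumes A: "finite A" "\<And>s. set_pmf (pU s) \<subseteq> A"
    and info: "test_info pS pU \<le> log 2 (real CARD('x1::finite))"
    and R: "0 \<le> R" "R < test_gain pS W pU pX"
  shows "achievable TYPE('x1) pS W R"
proof (cases "CARD('x1) = 1")
  case True
  let ?h = "\<lambda>u. measure_pmf.expectation pS (\<lambda>s. channel_info (\<lambda>x. W x s) (pX u))"
  have fin: "finite (set_pmf (pU s))" for s using A finite_subset by blast
  have finw: "finite (set_pmf (bind_pmf pS pU))" by (simp add: fin)
  \<comment> \<open>With one output letter the bound is \<open>log 2 1 = 0\<close>.\<close>
  have indep: "pU s = bind_pmf pS pU" if "s \<in> set_pmf pS" for s
    using info that fin True by (intro independent_if_test_info_nonpos) auto
  have "test_gain pS W pU pX = measure_pmf.expectation pS (\<lambda>s. measure_pmf.expectation (bind_pmf pS pU)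
     (\<lambda>u. channel_info (\<lambda>x. W x s) (pX u)))"
    unfolding test_gain_def by (intro expectation_cong_pmf) (simp flip: indep)
  also have "\<dots> = measure_pmf.expectation (bind_pmf pS pU) ?h"
    by (rule expectation_swap) (auto simp: fin)
  finally have gain: "test_gain pS W pU pX = measure_pmf.expectation (bind_pmf pS pU) ?h" .
  obtain u where "?h u \<ge> measure_pmf.expectation (bind_pmf pS pU) ?h"
    using exists_ge_expectation[OF finw, of ?h] by (elim bexE)
  with gain R(2) have "R < ?h u" by linarith
  then show ?thesis
    using R(1) achievable_of_describable[OF _ describable_constant[of u "{u}"], where R = R and W = W and pX = pX]
    by simp
next
  case False
  define k where "k = log 2 (real CARD('x1))"
  have "CARD('x1) > 1" using False by (metis One_nat_def Suc_lessI zero_less_card_finite)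
  then have k: "k > 0" by (simp add: k_def)
  define G where "G = test_gain pS W pU pX"
  \<comment> \<open>The witness makes \<open>(1 - \<theta>) * G\<close> the midpoint of
    \<open>R\<close> and \<open>G\<close>.\<close>
  obtain \<theta> where l: "0 < \<theta>" "\<theta> < 1" "R < (1 - \<theta>) * G"
  proof
    have G: "G > R" "G > 0" using R by (auto simp: G_def)
    show "0 < (G - R) / (2 * G)" "(G - R) / (2 * G) < 1" using G R by (auto simp: field_simps)
    have "(1 - (G - R) / (2 * G)) * G = (G + R) / 2" using G by (simp add: field_simps)
    then show "R < (1 - (G - R) / (2 * G)) * G" using G by simp
  qed
  define q0 :: "'x2 pmf" where "q0 = return_pmf undefined"
  define g0 where "g0 = (\<Sum>s\<in>UNIV. pmf pS s * channel_info (\<lambda>x. W x s) q0)"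
  have g0: "g0 \<ge> 0" unfolding g0_def by (intro sum_nonneg mult_nonneg_nonneg channel_info_nonneg) auto
  have conv: "convex (info_region W)" unfolding info_region_def by (rule convex_convex_hull)
  \<comment> \<open>The point of a constant U has full entropy \<open>shannon pS\<close>, that is
    I(U;S) = 0. Moving a fraction \<open>\<theta>\<close> towards it scales I(U;S) by
    \<open>1 - \<theta>\<close>.\<close>
  have z0: "(pmf_vec pS, shannon pS, g0) \<in> info_region W"
    unfolding info_region_def by (rule hull_inc) (auto simp: info_point_def g0_def)
  have z1: "(pmf_vec pS, shannon pS - test_info pS pU, G) \<in> info_region W"
    unfolding G_def by (rule test_channel_in_info_region[OF A])
  have "(1 - \<theta>) *\<^sub>R (pmf_vec pS, shannon pS - test_info pS pU, G) + \<theta> *\<^sub>R (pmf_vec pS, shannon pS, g0)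
      \<in> info_region W"
    using convexD[OF conv z1 z0, of "1 - \<theta>" \<theta>] l by simp
  also have "(1 - \<theta>) *\<^sub>R (pmf_vec pS, shannon pS - test_info pS pU, G) + \<theta> *\<^sub>R (pmf_vec pS, shannon pS, g0) =
      (pmf_vec pS, shannon pS - (1 - \<theta>) * test_info pS pU, (1 - \<theta>) * G + \<theta> * g0)"
    by (simp add: scaleR_left_distrib[symmetric] algebra_simps)
  finally obtain A' pU' pX' where A': "finite A'" "\<And>s. set_pmf (pU' s) \<subseteq> A'"
    and h': "shannon pS - (1 - \<theta>) * test_info pS pU = shannon pS - test_info pS pU'"
    and g': "(1 - \<theta>) * G + \<theta> * g0 = test_gain pS W pU' pX'"
    by (rule info_region_test_channel) blast
  have fin': "finite (set_pmf (pU' s))" for s using A' finite_subset by blast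
  have "test_info pS pU' = (1 - \<theta>) * test_info pS pU" using h' by simp
  also have "\<dots> \<le> (1 - \<theta>) * k" using info l by (intro mult_left_mono) (auto simp: k_def)
  also have "\<dots> < k" using l k by simp
  finally have rate: "test_info pS pU' < log 2 (real CARD('x1))" by (simp add: k_def)
  have "R < test_gain pS W pU' pX'" using l g0 g'[symmetric] by (simp add: add_strict_increasing2 mult_nonneg_nonneg add.commute)
  then show ?thesis
    using describable_test_channel[OF fin' rate, of "\<lambda>s u. channel_info (\<lambda>x. W x s) (pX' u)"]
      achievable_of_describable[OF _ _ R(1), where A = "set_pmf (bind_pmf pS pU')" and pS = pS and W = W
        and pX = pX' and v = "test_gain pS W pU' pX'"] fin'
    unfolding test_gain_def by simp
qed

text \<open>At length n the converse loses \<open>\<epsilon> * R\<close> through the error, 1/n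
  through its additive constant and at most 1/n through rounding 2^{nR} down; all three become
  arbitrarily small.\<close>

lemma achievable_le:
  fixes pS :: "'s::finite pmf" and W :: "'x2::finite \<Rightarrow> 's \<Rightarrow> 'y::finite pmf"
  assumes max: "\<And>h g. (pmf_vec pS, h, g) \<in> info_region W \<Longrightarrow>
      h \<ge> shannon pS - log 2 (real CARD('x1::finite)) \<Longrightarrow> g \<le> C"
    and R: "achievable TYPE('x1) pS W R"
  shows "R \<le> C"
proof (rule field_le_epsilon)
  fix e :: real assume e: "e > 0"
  have "R \<ge> 0" using R by (simp add: achievable_def)
  \<comment> \<open>The bound \<open>1 / 2\<close> keeps \<open>1 - \<epsilon>\<close> positive, and
    the other one yields \<open>\<epsilon> * R \<le> e / 2\<close>, with \<open>R + 1\<close> as a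
    nonzero divisor even at rate 0.\<close>
  define \<epsilon> where "\<epsilon> = min (1 / 2) (e / (2 * (R + 1)))"
  have \<epsilon>: "\<epsilon> > 0" "\<epsilon> \<le> 1 / 2" "\<epsilon> * (R + 1) \<le> e / 2"
  proof -
    show "\<epsilon> > 0" using e \<open>R \<ge> 0\<close> by (simp add: \<epsilon>_def)
    show "\<epsilon> \<le> 1 / 2" unfolding \<epsilon>_def by (rule min.cobounded1)
    have "\<epsilon> * (R + 1) \<le> e / (2 * (R + 1)) * (R + 1)"
      using \<open>R \<ge> 0\<close> by (intro mult_right_mono) (auto simp: \<epsilon>_def)
    also have "\<dots> = e / 2" using \<open>R \<ge> 0\<close> by (simp add: field_simps)
    finally show "\<epsilon> * (R + 1) \<le> e / 2" .
  qed
  obtain N :: nat where N: "real N \<ge> 4 / e" using real_arch_simple by blast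
  obtain n and c :: "('s, 'x1, 'x2, 'y) code" where n: "n \<ge> max 1 N" and c: "error_prob n R pS W c \<le> \<epsilon>"
    using R \<epsilon>(1) unfolding achievable_def by blast
  have n0: "real n > 0" using n by simp
  have ne: "2 / real n \<le> e / 2"
  proof -
    have "4 / e \<le> real n" using N n by linarith
    then show ?thesis using e n0 by (simp add: field_simps)
  qed
  define a where "a = 2 powr (real n * R)"
  have a: "a \<ge> 1" using \<open>R \<ge> 0\<close> by (simp add: a_def ge_one_powr_ge_zero)
  have cM: "card (messages n R) = nat \<lfloor>a\<rfloor>" by (simp add: messages_def a_def)
  have "\<lfloor>a\<rfloor> \<ge> 1" using a by (simp add: le_floor_iff)
  \<comment> \<open>Rounding down at most halves a number that is at least 1, a loss of one
    bit.\<close>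
  then have "a / 2 \<le> real (nat \<lfloor>a\<rfloor>)" using floor_correct[of a] by (simp del: one_le_floor) linarith
  then have "log 2 (a / 2) \<le> log 2 (card (messages n R))"
    unfolding cM using a by (subst log_le_cancel_iff) auto
  moreover have "log 2 (a / 2) = real n * R - 1"
    using a by (simp add: log_divide a_def)
  ultimately have logM: "real n * R - 1 \<le> log 2 (card (messages n R))" by simp
  have ne_M: "messages n R \<noteq> {}" using \<open>\<lfloor>a\<rfloor> \<ge> 1\<close> by (simp add: messages_def a_def le_nat_iff)
  obtain h g :: real where "(pmf_vec pS, h, g) \<in> info_region W" "h \<ge> shannon pS - log 2 (real CARD('x1))"
    and gg: "(1 - error_prob n R pS W c) * log 2 (card (messages n R)) \<le> 1 + n * g"
  proof (rule info_region_converse[where n = n and R = R and c = c and pS = pS and W = W])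
    show "1 \<le> n" using n by simp
  qed (use ne_M in auto)
  then have "g \<le> C" using max by blast
  have logM0: "log 2 (card (messages n R)) \<ge> 0"
    unfolding cM using a by (subst zero_le_log_cancel_iff) (auto simp: le_nat_iff le_floor_iff)
  have "(1 - \<epsilon>) * (real n * R - 1) \<le> (1 - \<epsilon>) * log 2 (card (messages n R))"
    using logM \<epsilon> by (intro mult_left_mono) auto
  also have "\<dots> \<le> (1 - error_prob n R pS W c) * log 2 (card (messages n R))"
    using c logM0 by (intro mult_right_mono) auto
  also have "\<dots> \<le> 1 + n * C" using gg \<open>g \<le> C\<close> n0 by (smt (verit) mult_left_mono)
  finally have "real n * (R - \<epsilon> * R) \<le> real n * (C + 2 / n)"
    using \<epsilon> n0 by (simp add: algebra_simps)
  then have "R - \<epsilon> * R \<le> C + 2 / n" using n0 by simp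
  moreover have "\<epsilon> * R \<le> e / 2" using \<epsilon> by (simp add: algebra_simps)
  ultimately show "R \<le> C + e" using ne by simp
qed

text \<open>\<open>achievable_below_test_gain\<close> reaches only rates strictly below the gain,
  hence none at gain zero. Rate 0, with its single message, keeps the supremum from running over the
  empty set.\<close>

lemma achievable_zero:
  fixes pS :: "'s::finite pmf" and W :: "'x2::finite \<Rightarrow> 's \<Rightarrow> 'y::finite pmf"
  shows "achievable TYPE('x1::finite) pS W 0"
  unfolding achievable_def
proof (intro conjI allI impI)
  fix \<epsilon> :: real and N :: nat assume "\<epsilon> > 0"
  define c :: "('s, 'x1, 'x2, 'y) code" where
    "c = \<lparr>state_enc = \<lambda>_ _. undefined, msg_enc = \<lambda>_ _ _. undefined, decoder = \<lambda>_ _. 1\<rparr>"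
  have M: "messages N 0 = {1}" by (simp add: messages_def)
  have "error_prob N 0 pS W c = 0"
    unfolding error_prob_def transmission_pmf_def M
    by (auto simp: measure_pmf_zero_iff c_def)
  then have "is_code N 0 c \<and> error_prob N 0 pS W c \<le> \<epsilon>"
    using \<open>\<epsilon> > 0\<close> by (simp add: is_code_def M c_def)
  then show "\<exists>n\<ge>N. \<exists>c :: ('s, 'x1, 'x2, 'y) code. is_code n 0 c \<and> error_prob n 0 pS W c \<le> \<epsilon>"
    by blast
qed simp

theorem mainTheorem4:
  fixes pS :: "'s::finite pmf"
    and W :: "'x2::finite \<Rightarrow> 's \<Rightarrow> 'y::finite pmf"
  shows "\<exists>pU pX.
    feasible TYPE('x1::finite) pS W pU pX \<and>
    (\<forall>pU' pX'. feasible TYPE('x1) pS W pU' pX' \<longrightarrow>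
       objective pS W pU' pX' \<le> objective pS W pU pX) \<and>
    capacity TYPE('x1) pS W = ereal (objective pS W pU pX)"
proof -
  define k where "k = log 2 (real CARD('x1))"
  have "real CARD('x1) \<ge> 1" by (simp add: Suc_leI)
  then have "k \<ge> 0" by (simp add: k_def)
  \<comment> \<open>The maximum is attained in the region, where the constraint on I(U;S) is a lower
    bound on the entropy coordinate, and is then pulled back to a test channel.\<close>
  then obtain h g where hg: "(pmf_vec pS, h, g) \<in> info_region W" "h \<ge> shannon pS - k"
    and max: "\<And>h' g'. (pmf_vec pS, h', g') \<in> info_region W \<Longrightarrow> h' \<ge> shannon pS - k \<Longrightarrow> g' \<le> g"
    by (rule info_region_max_exists) blast
  obtain A pU pX where A: "finite A" "\<And>s. set_pmf (pU s) \<subseteq> A"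
    and h: "h = shannon pS - test_info pS pU" and g: "g = test_gain pS W pU pX"
    by (rule info_region_test_channel[OF hg(1)]) blast
  have fin: "finite (set_pmf (pU s))" for s using A finite_subset by blast
  have info: "test_info pS pU \<le> log 2 (real CARD('x1))" using hg(2) h by (simp add: k_def)
  have feas: "feasible TYPE('x1) pS W pU pX"
    unfolding feasible_iff using A info by blast
  have obj: "objective pS W pU pX = g" using fin by (simp add: objective_eq g)
  have opt: "objective pS W pU' pX' \<le> g" if "feasible TYPE('x1) pS W pU' pX'" for pU' pX'
  proof -
    obtain A' where A': "finite A'" "\<And>s. set_pmf (pU' s) \<subseteq> A'"
      and info': "test_info pS pU' \<le> log 2 (real CARD('x1))"
      using \<open>feasible TYPE('x1) pS W pU' pX'\<close> unfolding feasible_iff by blast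
    have "finite (set_pmf (pU' s))" for s using A' finite_subset by blast
    then have "objective pS W pU' pX' = test_gain pS W pU' pX'" by (simp add: objective_eq)
    also have "\<dots> \<le> g"
      using max[OF test_channel_in_info_region[OF A', where pS = pS and W = W and pX = pX']] info' by (simp add: k_def)
    finally show ?thesis .
  qed
  have g0: "g \<ge> 0" unfolding g by (rule test_gain_nonneg[OF fin])
  have "capacity TYPE('x1) pS W = ereal g"
    unfolding capacity_def
  proof (rule antisym)
    show "Sup (ereal ` {R. achievable TYPE('x1) pS W R}) \<le> ereal g"
    proof (rule Sup_least)
      fix x assume "x \<in> ereal ` {R. achievable TYPE('x1) pS W R}"
      then obtain R where x: "x = ereal R" and R: "achievable TYPE('x1) pS W R" by auto
      have "R \<le> g" using max by (intro achievable_le[OF _ R]) (simp add: k_def)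
      then show "x \<le> ereal g" by (simp add: x)
    qed
    show "ereal g \<le> Sup (ereal ` {R. achievable TYPE('x1) pS W R})"
    proof (rule dense_le)
      fix r assume r: "r < ereal g"
      show "r \<le> Sup (ereal ` {R. achievable TYPE('x1) pS W R})"
      proof (cases r)
        case (real r')
        then have "r' < g" using r by simp
        \<comment> \<open>Achievable rates are nonnegative by definition, so a negative
          \<open>r'\<close> is raised to 0.\<close>
        have "achievable TYPE('x1) pS W (max 0 r')"
        proof (cases "g = 0")
          case True
          then show ?thesis using \<open>r' < g\<close> achievable_zero[where pS = pS and W = W] by (simp add: max_def)
        next
          case False
          then have "max 0 r' < test_gain pS W pU pX" using g0 \<open>r' < g\<close> g by simp
          then show ?thesis using achievable_below_test_gain[OF A info, where R = "max 0 r'" and W = W and pX = pX] by simp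
        qed
        then have "ereal (max 0 r') \<le> Sup (ereal ` {R. achievable TYPE('x1) pS W R})"
          by (intro Sup_upper imageI) simp
        then show ?thesis using real by (auto intro: order_trans[rotated])
      qed (use r in auto)
    qed
  qed
  with feas opt obj show ?thesis by metis
qed

end
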